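(* Let $n\in\{2,3,4,5\}$ and let $f_n$ be any Hauptmodul for the principal congruence subgroup $\Gamma(n)$. Then $f_n$ is a solution on $\mathcal H$ to the equation $$\{f,z\}\,=\,\frac{4\pi^2}{n^2}\,E_4(z).$$ Furthermore, if we set $$u_n\,=\,-\frac{n}{2\pi i}\,\frac{f_n''}{f_n'},$$ then $u_n$ is a solution of the Riccati equation $$\frac{n}{i\pi}\,u'\,+\,u^2\,=\,E_4.$$
   Context: $\mathcal H=\{z\in\mathbb C:\Im z>0\}$ is the upper half-plane, and $'$ denotes $d/dz$. The Eisenstein series $E_4$ is $E_4(z)=1+240\sum_{m\ge1}\sigma_3(m)e^{2\pi i m z}$, where $\sigma_3(m)$ is the sum of the cubes of the positive divisors of $m$. The Schwarz derivative is normalized as $$\{f,z\}=2\left(\frac{f''}{f'}\right)'-\left(\frac{f''}{f'}\right)^2 .$$ $\Gamma(n)$ is the principal congruence subgroup of level $n$ of $\mathrm{SL}_2(\mathbb Z)$, i.e. the matrices congruent to the identity mod $n$. For $2\le n\le 5$ the compactification of $\Gamma(n)\backslash\mathcal H$ is a compact Riemann surface of genus $0$. A Hauptmodul for $\Gamma(n)$ is a $\Gamma(n)$-invariant meromorphic function on $\mathcal H$, meromorphic at the cusps, that generates the field of meromorphic functions of this compact Riemann surface. Equations involving meromorphic functions are understood as identities of meromorphic functions on $\mathcal H$. *)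

theory Defs
  imports
    "HOL-Complex_Analysis.Complex_Analysis"
    "HOL-Number_Theory.Cong"
begin

text \<open>
  Meromorphic functions on the upper half-plane are functions \<open>f\<close> with \<open>f meromorphic_on \<H>\<close>.
  Their values on a sparse set (in particular at poles) carry no information, so an identity of
  meromorphic functions is an equation that holds for all \<open>z \<in> \<H>\<close> outside a sparse subset,
  \<open>\<forall>\<^sub>\<approx>z\<in>\<H>. f z = g z\<close>.
\<close>

definition upper_half_plane :: "complex set" (\<open>\<H>\<close>) where
  "\<H> = {z. Im z > 0}"

definition sigma3 :: "nat \<Rightarrow> nat" where
  "sigma3 m = (\<Sum>d | d dvd m. d ^ 3)"

text \<open>The summation index is shifted by one: the term for \<open>m\<close> is the one of index \<open>Suc m\<close>.\<close>

definition Eisenstein_E4 :: "complex \<Rightarrow> complex" where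
  "Eisenstein_E4 z =
     1 + 240 * (\<Sum>m. of_nat (sigma3 (Suc m)) * exp (2 * of_real pi * \<i> * of_nat (Suc m) * z))"

definition Schwarz_deriv :: "(complex \<Rightarrow> complex) \<Rightarrow> complex \<Rightarrow> complex" where
  "Schwarz_deriv f z =
     2 * deriv (\<lambda>w. deriv (deriv f) w / deriv f w) z - (deriv (deriv f) z / deriv f z)\<^sup>2"

definition SL2Z :: "(int ^ 2 ^ 2) set" where
  "SL2Z = {A. det A = 1}"

definition principal_congruence_subgroup :: "nat \<Rightarrow> (int ^ 2 ^ 2) set" (\<open>\<Gamma>\<close>) where
  "\<Gamma> n = {A \<in> SL2Z. \<forall>i j. [A $ i $ j = mat 1 $ i $ j] (mod int n)}"

definition modular_act :: "int ^ 2 ^ 2 \<Rightarrow> complex \<Rightarrow> complex" where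
  "modular_act A =
     moebius (of_int (A $ 1 $ 1)) (of_int (A $ 1 $ 2)) (of_int (A $ 2 $ 1)) (of_int (A $ 2 $ 2))"

text \<open>
  The cusps of \<open>\<Gamma> n\<close> are the points \<open>A \<infinity>\<close> with \<open>A \<in> SL2Z\<close>. All of them have width \<open>n\<close>
  (if \<open>n > 0\<close>), so \<open>exp (2 \<pi> \<i> z / n)\<close> is a local coordinate of the compactified quotient
  at \<open>A \<infinity>\<close> after translation by \<open>A\<close>. It maps \<open>\<H>\<close> onto the punctured open unit disc.
\<close>

definition meromorphic_at_cusps :: "nat \<Rightarrow> (complex \<Rightarrow> complex) \<Rightarrow> bool" where
  "meromorphic_at_cusps n f \<longleftrightarrow>
     (\<forall>A\<in>SL2Z. \<exists>F. F meromorphic_on ball 0 1 \<and>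
        (\<forall>\<^sub>\<approx>z\<in>\<H>. f (modular_act A z) = F (exp (2 * of_real pi * \<i> * z / of_nat n))))"

text \<open>
  The modular functions for \<open>\<Gamma> n\<close> are the pullbacks to \<open>\<H>\<close> of the meromorphic functions on the
  compactification of \<open>\<Gamma> n \ \<H>\<close>.
\<close>

definition modular_function :: "nat \<Rightarrow> (complex \<Rightarrow> complex) \<Rightarrow> bool" where
  "modular_function n f \<longleftrightarrow>
     f meromorphic_on \<H> \<and>
     (\<forall>A\<in>\<Gamma> n. \<forall>\<^sub>\<approx>z\<in>\<H>. f (modular_act A z) = f z) \<and>
     meromorphic_at_cusps n f"

text \<open>
  A Hauptmodul generates the field of modular functions over the constants: every modular function
  is of the form \<open>p(f) / q(f)\<close>, where \<open>q(f)\<close> is not the zero function. As \<open>q(f)\<close> is meromorphic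
  on the connected set \<open>\<H>\<close>, this means that it is nonzero outside a sparse set.
\<close>

definition Hauptmodul :: "nat \<Rightarrow> (complex \<Rightarrow> complex) \<Rightarrow> bool" where
  "Hauptmodul n f \<longleftrightarrow>
     modular_function n f \<and>
     (\<forall>g. modular_function n g \<longrightarrow>
        (\<exists>p q :: complex poly.
           \<forall>\<^sub>\<approx>z\<in>\<H>. poly q (f z) \<noteq> 0 \<and> g z = poly p (f z) / poly q (f z)))"

end

theory Submission
  imports Defs
begin

text \<open>
  Let \<open>q = exp (2 \<pi> \<i> z / n)\<close>. Lattice sums over residue classes modulo \<open>n\<close> give modular functions for
  \<open>\<Gamma> n\<close> whose values determine the lattice \<open>\<int> z + \<int>\<close> with its \<open>n\<close>-division points up to scaling: the sums
  over all weights are the Taylor coefficients of a meromorphic function whose poles are the squares of the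
  lattice points. As a Hauptmodul \<open>f\<close> generates all modular functions, it separates the orbits of \<open>\<Gamma> n\<close>, and
  since \<open>\<Gamma> n\<close> acts without fixed points, \<open>f\<close> is a local coordinate everywhere, also in \<open>q\<close> at every cusp.

  Hence \<open>({f, z} - 4 \<pi>\<^sup>2 / n\<^sup>2 E\<^sub>4) / f'\<^sup>2\<close> is a modular function without poles. At a cusp,
  \<open>{f, z} = 4 \<pi>\<^sup>2 / n\<^sup>2 + O(q\<^sup>2)\<close> by the chain rule for the Schwarzian derivative, while
  \<open>E\<^sub>4 = 1 + O(q\<^sup>n)\<close> and \<open>n \<ge> 2\<close>, so that the numerator vanishes to the order \<open>2\<close> needed against the
  simple zero of \<open>f'\<close>. By the maximum principle the quotient is constant; it vanishes at a pole of \<open>f\<close>, and \<open>f\<close> has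
  one because otherwise it would be constant itself.
\<close>

text \<open>Three points shape the proof. First, each lattice function is a rational function of
  \<open>f\<close> only off a sparse set of its own, and over all weights these sets add up to a
  merely countable set. So \<open>f\<close> is first seen to separate orbits off a countable set,
  and the open mapping theorem then upgrades this to injectivity of its expansions. Second, a
  lattice sum of weight \<open>2k\<close> is not invariant; multiplying it by
  \<open>(G4 / G6) ^ k\<close>, with G4 and G6 the full lattice sums of weights 4 and 6, makes it
  so, at the price of an unknown common scale. Third, the compactified curve is never built:
  finitely many expansions in \<open>q\<close> on the unit disc, one for each coset of
  \<open>\<Gamma> n\<close>, stand in for it, and closed discs of radius below 1 supply the
  compactness behind the maximum principle. The quotient has weight 0 because Moebius maps have
  vanishing Schwarzian derivative. For the same reason \<open>f = 1 / h\<close> near a simple pole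
  has the Schwarzian of \<open>h\<close>, while \<open>f' = - h' / h^2\<close>, so the quotient
  acquires the factor \<open>h^4\<close> there.\<close>

no_notation fps_nth (infixl \<open>$\<close> 75)

subsection \<open>The action of the modular group\<close>

definition aut_factor :: "int ^ 2 ^ 2 \<Rightarrow> complex \<Rightarrow> complex" where
  "aut_factor A z = of_int (A $ 2 $ 1) * z + of_int (A $ 2 $ 2)"

text \<open>The adjugate: it stays integral and inverts every matrix of determinant 1.\<close>

definition sl2_inv :: "int ^ 2 ^ 2 \<Rightarrow> int ^ 2 ^ 2" where
  "sl2_inv A = vector [vector [A $ 2 $ 2, - (A $ 1 $ 2)], vector [- (A $ 2 $ 1), A $ 1 $ 1]]"

lemma in_upper_half_plane_iff: "z \<in> \<H> \<longleftrightarrow> Im z > 0"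
  by (simp add: upper_half_plane_def)

lemma open_upper_half_plane: "open \<H>"
  unfolding upper_half_plane_def by (rule open_halfspace_Im_gt)

lemma convex_upper_half_plane: "convex \<H>"
  unfolding upper_half_plane_def by (rule convex_halfspace_Im_gt)

lemma connected_upper_half_plane: "connected \<H>"
  by (rule convex_connected[OF convex_upper_half_plane])

lemma cosparse_upper_half_plane: "\<forall>\<^sub>\<approx>z\<in>\<H>. z \<in> \<H>"
  by (rule eventually_in_cosparse) (auto simp: open_upper_half_plane)

lemma linear_form_nonzero:
  fixes c d :: int
  assumes "z \<in> \<H>" "(c, d) \<noteq> (0, 0)"
  shows "of_int c * z + of_int d \<noteq> 0"
proof
  assume *: "of_int c * z + of_int d = 0"
  have "Im (of_int c * z + of_int d) = of_int c * Im z" by simp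
  with * assms have "c = 0" by (simp add: in_upper_half_plane_iff)
  with * assms show False by simp
qed

lemma SL2Z_iff: "A \<in> SL2Z \<longleftrightarrow> A $ 1 $ 1 * A $ 2 $ 2 - A $ 1 $ 2 * A $ 2 $ 1 = 1"
  by (simp add: SL2Z_def det_2)

lemma SL2Z_of_int_det:
  assumes "A \<in> SL2Z"
  shows "of_int (A $ 1 $ 1) * of_int (A $ 2 $ 2) - of_int (A $ 1 $ 2) * of_int (A $ 2 $ 1) = (1 :: 'a :: ring_1)"
proof -
  have "(of_int (A $ 1 $ 1 * A $ 2 $ 2 - A $ 1 $ 2 * A $ 2 $ 1) :: 'a) = of_int 1"
    using assms by (simp only: SL2Z_iff)
  then show ?thesis by (simp only: of_int_diff of_int_mult of_int_1)
qed

lemma aut_factor_nonzero: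
  assumes "A \<in> SL2Z" "z \<in> \<H>"
  shows "aut_factor A z \<noteq> 0"
  unfolding aut_factor_def
  by (rule linear_form_nonzero) (use assms in \<open>auto simp: SL2Z_iff\<close>)

lemma modular_act_eq:
  "modular_act A z = (of_int (A $ 1 $ 1) * z + of_int (A $ 1 $ 2)) / aut_factor A z"
  by (simp add: modular_act_def moebius_def aut_factor_def)

text \<open>The determinant is arbitrary because \<open>lattice_sums_transfer\<close> applies this
  to an integral matrix not yet known to have determinant 1.\<close>

lemma Im_fractional_linear:
  fixes a b c d :: int
  assumes "of_int c * z + of_int d \<noteq> (0 :: complex)"
  shows "Im ((of_int a * z + of_int b) / (of_int c * z + of_int d)) =
           of_int (a * d - b * c) * Im z / (cmod (of_int c * z + of_int d))\<^sup>2"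
proof -
  let ?u = "of_int a * z + of_int b" and ?v = "of_int c * z + of_int d"
  have "Im (?u / ?v) = Im (?u * cnj ?v) / (cmod ?v)\<^sup>2"
    by (subst complex_div_cnj) (metis Im_divide_of_real of_real_power)
  also have "Im (?u * cnj ?v) = of_int (a * d - b * c) * Im z"
    by (simp add: algebra_simps)
  finally show ?thesis .
qed

lemma Im_modular_act:
  assumes "A \<in> SL2Z" "z \<in> \<H>"
  shows "Im (modular_act A z) = Im z / (cmod (aut_factor A z))\<^sup>2"
  using Im_fractional_linear[OF aut_factor_nonzero[OF assms, unfolded aut_factor_def],
      of "A $ 1 $ 1" "A $ 1 $ 2"] assms(1)
  unfolding modular_act_eq aut_factor_def SL2Z_iff by (simp only: of_int_1 mult_1)

lemma modular_act_in_upper_half_plane: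
  assumes "A \<in> SL2Z" "z \<in> \<H>"
  shows "modular_act A z \<in> \<H>"
  using Im_modular_act[OF assms] aut_factor_nonzero[OF assms] assms
  by (simp add: in_upper_half_plane_iff)

lemma SL2Z_mult: "A \<in> SL2Z \<Longrightarrow> B \<in> SL2Z \<Longrightarrow> A ** B \<in> SL2Z"
  by (simp add: SL2Z_def det_mul)

lemma mat_1_in_SL2Z: "mat 1 \<in> SL2Z"
  by (simp add: SL2Z_def)

lemma sl2_inv_entries [simp]:
  "sl2_inv A $ 1 $ 1 = A $ 2 $ 2" "sl2_inv A $ 1 $ 2 = - (A $ 1 $ 2)"
  "sl2_inv A $ 2 $ 1 = - (A $ 2 $ 1)" "sl2_inv A $ 2 $ 2 = A $ 1 $ 1"
  by (simp_all add: sl2_inv_def)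

lemma matrix_mult_2:
  fixes A B :: "int ^ 2 ^ 2"
  shows "(A ** B) $ i $ j = A $ i $ 1 * B $ 1 $ j + A $ i $ 2 * B $ 2 $ j"
  by (simp add: matrix_matrix_mult_def sum_2)

lemma sl2_inv_in_SL2Z: "A \<in> SL2Z \<Longrightarrow> sl2_inv A \<in> SL2Z"
  unfolding SL2Z_iff by (simp add: mult.commute)

lemma sl2_inv_left: "A \<in> SL2Z \<Longrightarrow> sl2_inv A ** A = mat 1"
  unfolding SL2Z_iff by (simp add: vec_eq_iff forall_2 mat_def matrix_mult_2 mult.commute)

lemma sl2_inv_right: "A \<in> SL2Z \<Longrightarrow> A ** sl2_inv A = mat 1"
  unfolding SL2Z_iff by (simp add: vec_eq_iff forall_2 mat_def matrix_mult_2 mult.commute)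

lemma aut_factor_mult:
  assumes "B \<in> SL2Z" "z \<in> \<H>"
  shows "aut_factor (A ** B) z = aut_factor A (modular_act B z) * aut_factor B z"
proof -
  have "modular_act B z * aut_factor B z = of_int (B $ 1 $ 1) * z + of_int (B $ 1 $ 2)"
    using aut_factor_nonzero[OF assms] by (simp add: modular_act_eq)
  then have "aut_factor A (modular_act B z) * aut_factor B z =
      of_int (A $ 2 $ 1) * (of_int (B $ 1 $ 1) * z + of_int (B $ 1 $ 2)) + of_int (A $ 2 $ 2) * aut_factor B z"
    unfolding aut_factor_def[of A] by (simp only: distrib_right mult.assoc)
  then show ?thesis
    by (simp add: aut_factor_def matrix_mult_2 algebra_simps)
qed

lemma modular_act_mult:
  assumes "A \<in> SL2Z" "B \<in> SL2Z" "z \<in> \<H>"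
  shows "modular_act (A ** B) z = modular_act A (modular_act B z)"
proof -
  have nz: "aut_factor B z \<noteq> 0" "aut_factor A (modular_act B z) \<noteq> 0"
    using assms by (simp_all add: aut_factor_nonzero modular_act_in_upper_half_plane)
  have "(of_int (A $ 1 $ 1) * modular_act B z + of_int (A $ 1 $ 2)) * aut_factor B z =
      of_int ((A ** B) $ 1 $ 1) * z + of_int ((A ** B) $ 1 $ 2)"
  proof -
    have "modular_act B z * aut_factor B z = of_int (B $ 1 $ 1) * z + of_int (B $ 1 $ 2)"
      using nz(1) by (simp add: modular_act_eq)
    then have "(of_int (A $ 1 $ 1) * modular_act B z + of_int (A $ 1 $ 2)) * aut_factor B z =
        of_int (A $ 1 $ 1) * (of_int (B $ 1 $ 1) * z + of_int (B $ 1 $ 2)) + of_int (A $ 1 $ 2) * aut_factor B z"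
      by (simp only: distrib_right mult.assoc)
    then show ?thesis
      by (simp add: aut_factor_def matrix_mult_2 algebra_simps)
  qed
  then show ?thesis
    using nz unfolding modular_act_eq[of "A ** B"] modular_act_eq[of A]
      aut_factor_mult[OF assms(2,3)]
    by (metis nonzero_mult_divide_mult_cancel_right)
qed

lemma modular_act_one [simp]: "modular_act (mat 1) z = z"
  by (simp add: modular_act_eq aut_factor_def mat_def)

lemma modular_act_sl2_inv:
  assumes "A \<in> SL2Z" "z \<in> \<H>"
  shows "modular_act (sl2_inv A) (modular_act A z) = z"
    and "modular_act A (modular_act (sl2_inv A) z) = z"
  using assms by (simp_all add: modular_act_mult[symmetric] sl2_inv_in_SL2Z sl2_inv_left sl2_inv_right)

lemma modular_act_has_derivative:
  assumes "A \<in> SL2Z" "z \<in> \<H>"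
  shows "(modular_act A has_field_derivative 1 / (aut_factor A z)\<^sup>2) (at z)"
proof -
  have nz: "aut_factor A z \<noteq> 0" by (rule aut_factor_nonzero[OF assms])
  have "of_int (A $ 1 $ 1) * of_int (A $ 2 $ 2) - of_int (A $ 1 $ 2) * of_int (A $ 2 $ 1) = (1 :: complex)"
    by (rule SL2Z_of_int_det[OF assms(1)])
  then have *: "of_int (A $ 1 $ 1) * aut_factor A z -
      (of_int (A $ 1 $ 1) * z + of_int (A $ 1 $ 2)) * of_int (A $ 2 $ 1) = 1"
    by (simp add: aut_factor_def algebra_simps)
  have "((\<lambda>z. (of_int (A $ 1 $ 1) * z + of_int (A $ 1 $ 2)) / aut_factor A z) has_field_derivative
      (of_int (A $ 1 $ 1) * aut_factor A z -
      (of_int (A $ 1 $ 1) * z + of_int (A $ 1 $ 2)) * of_int (A $ 2 $ 1)) / (aut_factor A z * aut_factor A z)) (at z)"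
    unfolding aut_factor_def
    by (rule derivative_eq_intros refl | use nz in \<open>simp add: aut_factor_def\<close>)+
  then show ?thesis
    unfolding * by (simp add: modular_act_eq[abs_def] power2_eq_square)
qed

lemma modular_act_holomorphic: "A \<in> SL2Z \<Longrightarrow> modular_act A holomorphic_on \<H>"
  unfolding holomorphic_on_def
  by (metis field_differentiable_def has_field_derivative_at_within modular_act_has_derivative)

section \<open>The principal congruence subgroup: cosets, normality, traces\<close>

lemma Gamma_iff:
  "A \<in> \<Gamma> n \<longleftrightarrow> A \<in> SL2Z \<and> [A $ 1 $ 1 = 1] (mod int n) \<and> [A $ 1 $ 2 = 0] (mod int n) \<and>
     [A $ 2 $ 1 = 0] (mod int n) \<and> [A $ 2 $ 2 = 1] (mod int n)"
  by (auto simp: principal_congruence_subgroup_def forall_2 mat_def)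

lemma Gamma_subset_SL2Z: "A \<in> \<Gamma> n \<Longrightarrow> A \<in> SL2Z"
  by (simp add: Gamma_iff)

text \<open>Modulo \<open>n\<close> the first factor may be replaced by \<open>B\<close>, and the
  product becomes the identity. So a coset of \<open>\<Gamma> n\<close> is determined by the entries
  modulo \<open>n\<close>, which leaves finitely many cosets.\<close>

lemma mult_sl2_inv_in_Gamma:
  fixes A B :: "int ^ 2 ^ 2"
  assumes "A \<in> SL2Z" "B \<in> SL2Z" "\<And>i j. [A $ i $ j = B $ i $ j] (mod int n)"
  shows "A ** sl2_inv B \<in> \<Gamma> n"
proof -
  have det: "B $ 1 $ 1 * B $ 2 $ 2 - B $ 1 $ 2 * B $ 2 $ 1 = 1"
    using assms(2) by (simp add: SL2Z_iff)
  note cong = cong_add[OF cong_mult cong_mult, OF assms(3) cong_refl assms(3) cong_refl]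
  have "[(A ** sl2_inv B) $ i $ j = (B ** sl2_inv B) $ i $ j] (mod int n)" for i j :: 2
    unfolding matrix_mult_2 by (rule cong)
  then show ?thesis
    using assms by (simp add: principal_congruence_subgroup_def SL2Z_mult sl2_inv_in_SL2Z sl2_inv_right)
qed

text \<open>Modulo \<open>n\<close> the middle factor may be replaced by the identity. Conjugation
  by \<open>A\<close> carries equivalence of points near the cusp \<open>A \<infinity>\<close> to
  equivalence near infinity.\<close>

lemma Gamma_normal:
  assumes "A \<in> SL2Z" "C \<in> \<Gamma> n"
  shows "sl2_inv A ** C ** A \<in> \<Gamma> n"
proof -
  have C: "C \<in> SL2Z" "\<And>i j. [C $ i $ j = mat 1 $ i $ j] (mod int n)"
    using assms(2) by (auto simp: principal_congruence_subgroup_def)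
  have "[(sl2_inv A ** C ** A) $ i $ j = (sl2_inv A ** mat 1 ** A) $ i $ j] (mod int n)" for i j :: 2
    unfolding matrix_mult_2 by (intro cong_add cong_mult cong_refl C(2))
  then show ?thesis
    using assms C(1) by (simp add: principal_congruence_subgroup_def SL2Z_mult sl2_inv_in_SL2Z sl2_inv_left)
qed

text \<open>The diagonal entries are units with product 1, so both are 1 or both are -1. The second
  case occurs only if \<open>n\<close> divides 2, and it translates in the opposite
  direction.\<close>

lemma Gamma_unipotent_act:
  fixes C :: "int ^ 2 ^ 2"
  assumes "C \<in> \<Gamma> n" "C $ 2 $ 1 = 0"
  obtains k :: int where "\<And>z. modular_act C z = z + of_nat n * of_int k"
proof -
  have det: "C $ 1 $ 1 * C $ 2 $ 2 = 1" using assms by (simp add: Gamma_iff SL2Z_iff)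
  then have "(C $ 1 $ 1 = 1 \<and> C $ 2 $ 2 = 1) \<or> (C $ 1 $ 1 = -1 \<and> C $ 2 $ 2 = -1)"
    by (rule zmult_eq_1_iff[THEN iffD1])
  moreover have "int n dvd C $ 1 $ 2" using assms(1) by (simp add: Gamma_iff cong_0_iff)
  then obtain k where k: "C $ 1 $ 2 = int n * k" by auto
  ultimately show ?thesis
    using that[of k] that[of "-k"] assms(2) by (auto simp: modular_act_eq aut_factor_def)
qed

text \<open>With C = I + n X, determinant 1 gives tr X = - n det X. Hence the trace of C is 2 - n^2
  det X, where n^2 \<ge> 4. This excludes elliptic elements, whose traces are -1, 0 and 1.\<close>

lemma Gamma_trace:
  fixes C :: "int ^ 2 ^ 2"
  assumes "C \<in> \<Gamma> n" "n \<ge> 2"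
  shows "\<bar>C $ 1 $ 1 + C $ 2 $ 2\<bar> \<ge> 2"
proof -
  have "int n dvd C $ 1 $ 1 - 1" "int n dvd C $ 1 $ 2" "int n dvd C $ 2 $ 1" "int n dvd C $ 2 $ 2 - 1"
    using assms(1) by (auto simp: Gamma_iff cong_iff_dvd_diff)
  then obtain p q r s where "C $ 1 $ 1 - 1 = int n * p" "C $ 1 $ 2 = int n * q" "C $ 2 $ 1 = int n * r"
    "C $ 2 $ 2 - 1 = int n * s"
    unfolding dvd_def by blast
  then have *: "C $ 1 $ 1 = 1 + int n * p" "C $ 1 $ 2 = int n * q" "C $ 2 $ 1 = int n * r"
    "C $ 2 $ 2 = 1 + int n * s"
    by linarith+
  have "(1 + int n * p) * (1 + int n * s) - int n * q * (int n * r) = 1"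
    using assms(1) by (simp only: Gamma_iff SL2Z_iff *)
  then have "int n * (p + s + int n * (p * s - q * r)) = 0" by (simp only: algebra_simps)
  then have ps: "p + s = - int n * (p * s - q * r)" using assms(2) by simp
  have "C $ 1 $ 1 + C $ 2 $ 2 = 2 + int n * (p + s)"
    unfolding * by (simp add: distrib_left)
  also have "\<dots> = 2 - (int n)\<^sup>2 * (p * s - q * r)"
    unfolding ps by (simp add: power2_eq_square)
  finally have "C $ 1 $ 1 + C $ 2 $ 2 = 2 - (int n)\<^sup>2 * (p * s - q * r)" .
  moreover have "\<bar>2 - (int n)\<^sup>2 * k\<bar> \<ge> 2" for k
  proof -
    have "(int n)\<^sup>2 \<ge> 4" using power_mono[of 2 "int n" 2] assms(2) by simp
    consider "k \<ge> 1" | "k = 0" | "k \<le> -1" by linarith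
    then show ?thesis
    proof cases
      case 1
      then have "(int n)\<^sup>2 * k \<ge> (int n)\<^sup>2 * 1" by (intro mult_left_mono) auto
      with \<open>(int n)\<^sup>2 \<ge> 4\<close> show ?thesis by linarith
    next
      case 3
      then have "(int n)\<^sup>2 * k \<le> (int n)\<^sup>2 * (-1)" by (intro mult_left_mono) auto
      with \<open>(int n)\<^sup>2 \<ge> 4\<close> show ?thesis by linarith
    qed auto
  qed
  ultimately show ?thesis by metis
qed

subsection \<open>Lattice sums\<close>

definition lattice_pt :: "int \<times> int \<Rightarrow> complex \<Rightarrow> complex" where
  "lattice_pt x z = of_int (fst x) * z + of_int (snd x)"

definition sqnorm :: "int \<times> int \<Rightarrow> real" where
  "sqnorm x = (of_int (fst x))\<^sup>2 + (of_int (snd x))\<^sup>2"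

lemma lattice_pt_nonzero: "z \<in> \<H> \<Longrightarrow> x \<noteq> (0, 0) \<Longrightarrow> lattice_pt x z \<noteq> 0"
  unfolding lattice_pt_def by (rule linear_form_nonzero) (auto simp: prod_eq_iff)

lemma sqnorm_ge_1: "x \<noteq> (0, 0) \<Longrightarrow> sqnorm x \<ge> 1"
proof -
  assume "x \<noteq> (0, 0)"
  then have "fst x \<noteq> 0 \<or> snd x \<noteq> 0" by (auto simp: prod_eq_iff)
  then have "(fst x)\<^sup>2 + (snd x)\<^sup>2 > 0" by (auto intro: add_pos_nonneg add_nonneg_pos)
  then have "(fst x)\<^sup>2 + (snd x)\<^sup>2 \<ge> 1" by linarith
  then have "real_of_int ((fst x)\<^sup>2 + (snd x)\<^sup>2) \<ge> 1" by linarith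
  then show ?thesis by (simp add: sqnorm_def)
qed

section \<open>Absolute convergence with a majorant that does not depend on the lattice\<close>

lemma summable_on_inverse_int_square: "(\<lambda>n::int. 1 / (1 + (real_of_int n)\<^sup>2)) summable_on UNIV"
proof -
  have "summable (\<lambda>n. 1 / (1 + (real n)\<^sup>2))"
  proof (rule summable_comparison_test_ev[OF _ inverse_power_summable[of 2]])
    show "\<forall>\<^sub>F n in sequentially. norm (1 / (1 + (real n)\<^sup>2)) \<le> inverse (real n ^ 2)"
      using eventually_gt_at_top[of 0]
      by eventually_elim (simp add: inverse_eq_divide frac_le)
  qed simp
  note s = this summable_Suc_iff[THEN iffD2, OF this]
  have "(\<lambda>n. 1 / (1 + (real n)\<^sup>2)) summable_on UNIV"
    by (rule summable_nonneg_imp_summable_on[OF s(1)]) simp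
  then have "(\<lambda>n::int. 1 / (1 + (real_of_int n)\<^sup>2)) summable_on (int ` UNIV)"
    by (subst summable_on_reindex) (auto simp: o_def inj_on_def)
  moreover have "(\<lambda>n. 1 / (1 + (real (Suc n))\<^sup>2)) summable_on UNIV"
    by (rule summable_nonneg_imp_summable_on[OF s(2)]) simp
  then have "(\<lambda>n::int. 1 / (1 + (real_of_int n)\<^sup>2)) summable_on ((\<lambda>n. - int (Suc n)) ` UNIV)"
    by (subst summable_on_reindex) (auto simp: o_def inj_on_def power2_eq_square algebra_simps)
  moreover have "int ` UNIV \<inter> (\<lambda>n. - int (Suc n)) ` UNIV = {}" by auto
  moreover have "int ` UNIV \<union> (\<lambda>n. - int (Suc n)) ` UNIV = UNIV"
  proof -
    have "x \<in> int ` UNIV \<union> (\<lambda>n. - int (Suc n)) ` UNIV" for x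
      by (cases x rule: int_cases) auto
    then show ?thesis by blast
  qed
  ultimately show ?thesis using summable_on_Un_disjoint by metis
qed

text \<open>Away from the origin a^2 + b^2 \<ge> 1, so (1 + a^2) (1 + b^2) \<le> (1 + a^2 + b^2)^2
  \<le> 4 (a^2 + b^2)^2, and a product of two one-dimensional series dominates.\<close>

lemma summable_on_sqnorm: "(\<lambda>x. 1 / (sqnorm x)\<^sup>2) summable_on (UNIV - {(0, 0)})"
proof -
  define g where "g = (\<lambda>n::int. 1 / (1 + (real_of_int n)\<^sup>2))"
  have g: "(g has_sum infsum g UNIV) UNIV"
    using summable_on_inverse_int_square unfolding g_def by (rule has_sum_infsum)
  have "(\<lambda>x. g (fst x) * g (snd x)) summable_on Sigma UNIV (\<lambda>_. UNIV)"
  proof (rule summable_on_SigmaI)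
    show "((\<lambda>y. g (fst (x, y)) * g (snd (x, y))) has_sum g x * infsum g UNIV) UNIV" for x
      using has_sum_cmult_right[OF g] by simp
    show "(\<lambda>x. g x * infsum g UNIV) summable_on UNIV"
      using g by (intro summable_on_cmult_left) (auto simp: summable_on_def)
  qed (auto simp: g_def)
  then have "(\<lambda>x. 4 * (g (fst x) * g (snd x))) summable_on UNIV"
    by (intro summable_on_cmult_right) simp
  then have "(\<lambda>x. 4 * (g (fst x) * g (snd x))) summable_on (UNIV - {(0, 0)})"
    by (rule summable_on_subset) simp
  then show ?thesis
  proof (rule summable_on_comparison_test)
    fix x :: "int \<times> int" assume "x \<in> UNIV - {(0, 0)}"
    then have s: "sqnorm x \<ge> 1" by (intro sqnorm_ge_1) auto
    let ?a = "(real_of_int (fst x))\<^sup>2" and ?b = "(real_of_int (snd x))\<^sup>2"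
    have "(1 + ?a) * (1 + ?b) \<le> (1 + ?a + ?b) * (1 + ?a + ?b)"
      by (intro mult_mono) auto
    also have "\<dots> \<le> (2 * sqnorm x) * (2 * sqnorm x)"
      using s by (intro mult_mono) (auto simp: sqnorm_def)
    finally have "(1 + ?a) * (1 + ?b) \<le> 4 * (sqnorm x)\<^sup>2" by (simp add: power2_eq_square)
    moreover have "(1 + ?a) * (1 + ?b) > 0" by (intro mult_pos_pos) (auto intro: add_pos_nonneg)
    ultimately have "1 / (4 * (sqnorm x)\<^sup>2) \<le> 1 / ((1 + ?a) * (1 + ?b))"
      using s by (intro divide_left_mono) auto
    then show "1 / (sqnorm x)\<^sup>2 \<le> 4 * (g (fst x) * g (snd x))"
      by (simp add: g_def field_simps)
  qed auto
qed

text \<open>Two positive definite quadratic forms in the coordinates of \<open>x\<close> are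
  compared. The constant depends only on \<open>y\<close> and \<open>X\<close>, so it serves both
  near a point and in a whole vertical half-strip reaching up to infinity.\<close>

lemma lattice_pt_lower_bound:
  assumes "y > 0"
  obtains K where "K > 0"
    "\<And>z x. Im z \<ge> y \<Longrightarrow> \<bar>Re z\<bar> \<le> X \<Longrightarrow> sqnorm x \<le> K * (cmod (lattice_pt x z))\<^sup>2"
proof
  define K where "K = 2 + (1 + 2 * X\<^sup>2) / y\<^sup>2"
  show "K > 0" unfolding K_def by (intro add_pos_nonneg divide_nonneg_nonneg) auto
  fix z x assume z: "Im z \<ge> y" "\<bar>Re z\<bar> \<le> X"
  define c d where "c = real_of_int (fst x)" and "d = real_of_int (snd x)"
  let ?l = "c * Re z + d"
  have norm: "(cmod (lattice_pt x z))\<^sup>2 = ?l\<^sup>2 + c\<^sup>2 * (Im z)\<^sup>2"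
    by (simp add: cmod_power2 lattice_pt_def c_def d_def power_mult_distrib)
  \<comment> \<open>As d = l - c Re z with l = \<open>?l\<close>, this square gives d^2 \<le> 2 l^2
    + 2 c^2 (Re z)^2.\<close>
  have "0 \<le> (?l + c * Re z)\<^sup>2" by simp
  then have "d\<^sup>2 \<le> 2 * ?l\<^sup>2 + 2 * c\<^sup>2 * (Re z)\<^sup>2"
    by (simp add: power2_eq_square algebra_simps)
  also have "(Re z)\<^sup>2 \<le> X\<^sup>2" using z(2) by (metis abs_ge_zero power2_abs power_mono)
  then have "2 * c\<^sup>2 * (Re z)\<^sup>2 \<le> 2 * c\<^sup>2 * X\<^sup>2" by (intro mult_left_mono) auto
  finally have 1: "sqnorm x \<le> 2 * ?l\<^sup>2 + (1 + 2 * X\<^sup>2) * c\<^sup>2"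
    by (simp add: sqnorm_def c_def d_def algebra_simps)
  have "c\<^sup>2 \<le> c\<^sup>2 * (Im z)\<^sup>2 / y\<^sup>2"
    using assms z(1) by (simp add: field_simps) (intro mult_left_mono power_mono; simp)
  also have "\<dots> \<le> (cmod (lattice_pt x z))\<^sup>2 / y\<^sup>2"
    unfolding norm by (intro divide_right_mono) auto
  finally have "(1 + 2 * X\<^sup>2) * c\<^sup>2 \<le> (1 + 2 * X\<^sup>2) * ((cmod (lattice_pt x z))\<^sup>2 / y\<^sup>2)"
    by (intro mult_left_mono) auto
  moreover have "?l\<^sup>2 \<le> (cmod (lattice_pt x z))\<^sup>2" unfolding norm by simp
  ultimately show "sqnorm x \<le> K * (cmod (lattice_pt x z))\<^sup>2"
    using 1 unfolding K_def by (simp add: algebra_simps)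
qed

lemma lattice_pt_lower_bound_at:
  assumes "z \<in> \<H>"
  obtains K where "K > 0" "\<And>x. sqnorm x \<le> K * (cmod (lattice_pt x z))\<^sup>2"
  using lattice_pt_lower_bound[of "Im z" "\<bar>Re z\<bar>"] assms
  by (metis in_upper_half_plane_iff order_refl)

lemma finite_sqnorm_le: "finite {x. sqnorm x \<le> R}"
proof -
  have "{x. sqnorm x \<le> R} \<subseteq> {- \<lceil>max R 1\<rceil>..\<lceil>max R 1\<rceil>} \<times> {- \<lceil>max R 1\<rceil>..\<lceil>max R 1\<rceil>}"
  proof
    fix x assume "x \<in> {x. sqnorm x \<le> R}"
    then have *: "(real_of_int (fst x))\<^sup>2 + (real_of_int (snd x))\<^sup>2 \<le> R" by (simp add: sqnorm_def)
    \<comment> \<open>The bound \<open>max R 1\<close> avoids a square root: |a| > 1 gives a^2 >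
      |a|.\<close>
    have "\<bar>a\<bar> \<le> max R 1" if "(a::real)\<^sup>2 \<le> R" for a
    proof (rule ccontr)
      assume "\<not> ?thesis"
      then have a: "\<bar>a\<bar> > R" "\<bar>a\<bar> > 1" by auto
      then have "\<bar>a\<bar> * 1 < \<bar>a\<bar> * \<bar>a\<bar>" by (intro mult_strict_left_mono) auto
      with that a(1) show False by (simp add: power2_eq_square)
    qed
    moreover have "(real_of_int (fst x))\<^sup>2 \<le> R" "(real_of_int (snd x))\<^sup>2 \<le> R"
      using * by (smt (verit) zero_le_power2)+
    ultimately have "\<bar>real_of_int (fst x)\<bar> \<le> max R 1" "\<bar>real_of_int (snd x)\<bar> \<le> max R 1" by blast+
    then have "\<bar>fst x\<bar> \<le> \<lceil>max R 1\<rceil>" "\<bar>snd x\<bar> \<le> \<lceil>max R 1\<rceil>" by linarith+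
    then show "x \<in> {- \<lceil>max R 1\<rceil>..\<lceil>max R 1\<rceil>} \<times> {- \<lceil>max R 1\<rceil>..\<lceil>max R 1\<rceil>}"
      by (auto simp: mem_Times_iff)
  qed
  then show ?thesis by (rule finite_subset) auto
qed

text \<open>The M-test with a separate majorant near each point, over an arbitrary index set: finite
  partial sums converge locally uniformly. The ball of the majorant may stick out of
  \<open>U\<close>, hence the intersection in \<open>bound\<close>.\<close>

lemma holomorphic_infsum:
  fixes f :: "'a \<Rightarrow> complex \<Rightarrow> complex"
  assumes U: "open U" and holo: "\<And>x. x \<in> X \<Longrightarrow> f x holomorphic_on U"
    and bound: "\<And>z. z \<in> U \<Longrightarrow> \<exists>r M. r > 0 \<and> M summable_on X \<and>
                  (\<forall>x\<in>X. \<forall>w\<in>cball z r \<inter> U. norm (f x w) \<le> M x)"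
  shows "(\<lambda>w. \<Sum>\<^sub>\<infinity>x\<in>X. f x w) holomorphic_on U"
proof (rule holomorphic_on_open[THEN iffD2, OF U], intro ballI)
  fix z assume z: "z \<in> U"
  obtain r M where r: "r > 0" "M summable_on X" "\<And>x w. x \<in> X \<Longrightarrow> w \<in> cball z r \<inter> U \<Longrightarrow> norm (f x w) \<le> M x"
    using bound[OF z] by blast
  obtain e where e: "e > 0" "cball z e \<subseteq> U" using U z open_contains_cball by blast
  define \<rho> where "\<rho> = min r e"
  have \<rho>: "\<rho> > 0" "cball z \<rho> \<subseteq> cball z r" "cball z \<rho> \<subseteq> U"
    using r e by (auto simp: \<rho>_def)
  have ul: "uniform_limit (cball z \<rho>) (\<lambda>S w. \<Sum>x\<in>S. f x w) (\<lambda>w. \<Sum>\<^sub>\<infinity>x\<in>X. f x w) (finite_subsets_at_top X)"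
    by (rule Weierstrass_m_test_general[OF _ r(2)]) (use r(3) \<rho> in blast)
  have "\<forall>\<^sub>F S in finite_subsets_at_top X. continuous_on (cball z \<rho>) (\<lambda>w. \<Sum>x\<in>S. f x w) \<and>
          (\<lambda>w. \<Sum>x\<in>S. f x w) holomorphic_on ball z \<rho>"
  proof (rule eventually_finite_subsets_at_top_weakI)
    fix S assume S: "finite S" "S \<subseteq> X"
    have "(\<lambda>w. \<Sum>x\<in>S. f x w) holomorphic_on cball z \<rho>"
      using S \<rho> by (intro holomorphic_on_sum holomorphic_on_subset[OF holo]) auto
    then show "continuous_on (cball z \<rho>) (\<lambda>w. \<Sum>x\<in>S. f x w) \<and>
          (\<lambda>w. \<Sum>x\<in>S. f x w) holomorphic_on ball z \<rho>"
      by (meson ball_subset_cball holomorphic_on_imp_continuous_on holomorphic_on_subset)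
  qed
  from holomorphic_uniform_limit[OF this ul]
  have "(\<lambda>w. \<Sum>\<^sub>\<infinity>x\<in>X. f x w) holomorphic_on ball z \<rho>" by auto
  then show "\<exists>f'. ((\<lambda>w. \<Sum>\<^sub>\<infinity>x\<in>X. f x w) has_field_derivative f') (at z)"
    using \<rho>(1) by (metis centre_in_ball holomorphic_on_open open_ball)
qed

text \<open>The parameter \<open>k\<close> is half the weight.\<close>

definition lattice_sum :: "(int \<times> int) set \<Rightarrow> nat \<Rightarrow> complex \<Rightarrow> complex" where
  "lattice_sum P k z = (\<Sum>\<^sub>\<infinity>x\<in>P. 1 / (lattice_pt x z)\<^sup>2 ^ k)"

text \<open>Since \<open>sqnorm x\<close> is at least 1 and \<open>k\<close> at least 2, the
  exponent may be lowered to 2; one convergent series then majorizes every weight up to a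
  constant.\<close>

lemma lattice_term_bound:
  assumes "K > 0" "sqnorm x \<le> K * (cmod (lattice_pt x z))\<^sup>2" "x \<noteq> (0, 0)" "k \<ge> 2"
  shows "norm (1 / (lattice_pt x z)\<^sup>2 ^ k) \<le> K ^ k * (1 / (sqnorm x)\<^sup>2)"
proof -
  have s: "sqnorm x \<ge> 1" using assms(3) by (rule sqnorm_ge_1)
  have p: "lattice_pt x z \<noteq> 0" using s assms(2) by auto
  have "1 / (cmod (lattice_pt x z))\<^sup>2 \<le> K / sqnorm x"
    using assms(1,2) s p by (simp add: field_simps)
  then have "(1 / (cmod (lattice_pt x z))\<^sup>2) ^ k \<le> (K / sqnorm x) ^ k"
    by (intro power_mono) auto
  moreover have "(K / sqnorm x) ^ k \<le> K ^ k * (1 / (sqnorm x)\<^sup>2)"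
    using s assms(1,4) unfolding power_divide
    by (auto simp: divide_simps intro!: power_increasing mult_left_mono)
  ultimately show ?thesis
    by (simp add: norm_divide norm_power power_divide)
qed

lemma lattice_sum_abs_summable:
  assumes "z \<in> \<H>" "P \<subseteq> UNIV - {(0, 0)}" "k \<ge> 2"
  shows "(\<lambda>x. norm (1 / (lattice_pt x z)\<^sup>2 ^ k)) summable_on P"
proof -
  obtain K where K: "K > 0" "\<And>x. sqnorm x \<le> K * (cmod (lattice_pt x z))\<^sup>2"
    using lattice_pt_lower_bound_at[OF assms(1)] by blast
  have "(\<lambda>x. K ^ k * (1 / (sqnorm x)\<^sup>2)) summable_on P"
    by (intro summable_on_cmult_right summable_on_subset[OF summable_on_sqnorm] assms)
  then show ?thesis
    by (rule Infinite_Sum.abs_summable_on_comparison_test')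
      (use lattice_term_bound[OF K] assms in blast)
qed

lemma lattice_sum_holomorphic:
  assumes "P \<subseteq> UNIV - {(0, 0)}" "k \<ge> 2"
  shows "lattice_sum P k holomorphic_on \<H>"
  unfolding lattice_sum_def[abs_def]
proof (rule holomorphic_infsum[OF open_upper_half_plane])
  fix x assume "x \<in> P"
  then have "x \<noteq> (0, 0)" using assms by auto
  then show "(\<lambda>z. 1 / (lattice_pt x z)\<^sup>2 ^ k) holomorphic_on \<H>"
    using lattice_pt_nonzero[of _ x] unfolding lattice_pt_def by (intro holomorphic_intros) auto
next
  fix z assume z: "z \<in> \<H>"
  define y where "y = Im z / 2"
  have y: "y > 0" using z by (simp add: y_def in_upper_half_plane_iff)
  obtain K where K: "K > 0"
    "\<And>w x. Im w \<ge> y \<Longrightarrow> \<bar>Re w\<bar> \<le> \<bar>Re z\<bar> + y \<Longrightarrow> sqnorm x \<le> K * (cmod (lattice_pt x w))\<^sup>2"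
    using lattice_pt_lower_bound[OF y] by metis
  show "\<exists>r M. r > 0 \<and> M summable_on P \<and>
      (\<forall>x\<in>P. \<forall>w\<in>cball z r \<inter> \<H>. norm (1 / (lattice_pt x w)\<^sup>2 ^ k) \<le> M x)"
  proof (intro exI conjI ballI)
    show "y > 0" by (rule y)
    show "(\<lambda>x. K ^ k * (1 / (sqnorm x)\<^sup>2)) summable_on P"
      by (intro summable_on_cmult_right summable_on_subset[OF summable_on_sqnorm] assms)
    fix x w assume x: "x \<in> P" and w: "w \<in> cball z y \<inter> \<H>"
    have "\<bar>Re (z - w)\<bar> \<le> y" "\<bar>Im (z - w)\<bar> \<le> y"
      using w abs_Re_le_cmod[of "z - w"] abs_Im_le_cmod[of "z - w"] by (auto simp: dist_norm)
    then have "Im w \<ge> y" "\<bar>Re w\<bar> \<le> \<bar>Re z\<bar> + y" unfolding y_def minus_complex.sel by linarith+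
    then show "norm (1 / (lattice_pt x w)\<^sup>2 ^ k) \<le> K ^ k * (1 / (sqnorm x)\<^sup>2)"
      using x assms by (intro lattice_term_bound K) auto
  qed
qed

text \<open>With \<open>X = n\<close> the half-strip contains a full period, so the sum is bounded
  near \<open>q = 0\<close> and its singularity there is removable.\<close>

lemma lattice_sum_bounded:
  assumes "P \<subseteq> UNIV - {(0, 0)}" "k \<ge> 2"
  obtains C where "\<And>z. Im z \<ge> 1 \<Longrightarrow> \<bar>Re z\<bar> \<le> X \<Longrightarrow> norm (lattice_sum P k z) \<le> C"
proof -
  obtain K where K: "K > 0"
    "\<And>w x. Im w \<ge> 1 \<Longrightarrow> \<bar>Re w\<bar> \<le> X \<Longrightarrow> sqnorm x \<le> K * (cmod (lattice_pt x w))\<^sup>2"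
    using lattice_pt_lower_bound[of 1] by (metis zero_less_one)
  have s: "(\<lambda>x. K ^ k * (1 / (sqnorm x)\<^sup>2)) summable_on P"
    by (intro summable_on_cmult_right summable_on_subset[OF summable_on_sqnorm] assms)
  show ?thesis
  proof
    fix z assume z: "Im z \<ge> 1" "\<bar>Re z\<bar> \<le> X"
    then have "z \<in> \<H>" by (simp add: in_upper_half_plane_iff)
    show "norm (lattice_sum P k z) \<le> (\<Sum>\<^sub>\<infinity>x\<in>P. K ^ k * (1 / (sqnorm x)\<^sup>2))"
      unfolding lattice_sum_def
    proof (rule norm_infsum_le[OF has_sum_infsum[OF abs_summable_summable] has_sum_infsum[OF s]])
      show "(\<lambda>x. norm (1 / (lattice_pt x z)\<^sup>2 ^ k)) summable_on P"
        by (rule lattice_sum_abs_summable[OF \<open>z \<in> \<H>\<close> assms])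
      show "norm (1 / (lattice_pt x z)\<^sup>2 ^ k) \<le> K ^ k * (1 / (sqnorm x)\<^sup>2)" if "x \<in> P" for x
        using that assms z by (intro lattice_term_bound K) auto
    qed
  qed
qed

section \<open>Transformation of lattice sums under the modular group\<close>

definition row_act :: "int ^ 2 ^ 2 \<Rightarrow> int \<times> int \<Rightarrow> int \<times> int" where
  "row_act A x = (fst x * A $ 1 $ 1 + snd x * A $ 2 $ 1, fst x * A $ 1 $ 2 + snd x * A $ 2 $ 2)"

text \<open>Substituting \<open>A z\<close> into the linear form with coefficients \<open>x\<close>
  multiplies the row vector \<open>x\<close> by \<open>A\<close> from the right, up to the
  automorphy factor. This is the origin of \<open>row_act\<close>.\<close>

lemma lattice_pt_modular_act:
  assumes "A \<in> SL2Z" "z \<in> \<H>"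
  shows "lattice_pt x (modular_act A z) = lattice_pt (row_act A x) z / aut_factor A z"
proof -
  have nz: "aut_factor A z \<noteq> 0" by (rule aut_factor_nonzero[OF assms])
  have "modular_act A z * aut_factor A z = of_int (A $ 1 $ 1) * z + of_int (A $ 1 $ 2)"
    using nz by (simp add: modular_act_eq)
  then have "lattice_pt x (modular_act A z) * aut_factor A z =
      of_int (fst x) * (of_int (A $ 1 $ 1) * z + of_int (A $ 1 $ 2)) + of_int (snd x) * aut_factor A z"
    unfolding lattice_pt_def by (simp only: distrib_right mult.assoc)
  also have "\<dots> = lattice_pt (row_act A x) z"
    by (simp add: lattice_pt_def row_act_def aut_factor_def algebra_simps)
  finally show ?thesis using nz by (simp add: field_simps)
qed

lemma row_act_inv:
  assumes "A \<in> SL2Z"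
  shows "row_act A (row_act (sl2_inv A) x) = x" "row_act (sl2_inv A) (row_act A x) = x"
proof -
  have det: "A $ 1 $ 1 * A $ 2 $ 2 = 1 + A $ 1 $ 2 * A $ 2 $ 1" using assms by (simp add: SL2Z_iff)
  have "a * (A $ 1 $ 1 * A $ 2 $ 2) = a + a * (A $ 1 $ 2 * A $ 2 $ 1)" for a
    unfolding det by (simp add: distrib_left)
  from this[of "fst x"] this[of "snd x"]
  show "row_act A (row_act (sl2_inv A) x) = x" "row_act (sl2_inv A) (row_act A x) = x"
    by (auto simp: row_act_def prod_eq_iff algebra_simps)
qed

lemma inj_row_act: "A \<in> SL2Z \<Longrightarrow> inj (row_act A)"
  by (metis injI row_act_inv(2))

lemma row_act_zero_iff: "A \<in> SL2Z \<Longrightarrow> row_act A x = (0, 0) \<longleftrightarrow> x = (0, 0)"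
  using inj_eq[OF inj_row_act, of A x "(0, 0)"] by (simp add: row_act_def)

lemma lattice_sum_modular_act:
  assumes "A \<in> SL2Z" "z \<in> \<H>"
  shows "lattice_sum P k (modular_act A z) = (aut_factor A z)\<^sup>2 ^ k * lattice_sum (row_act A ` P) k z"
proof -
  have "lattice_sum (row_act A ` P) k z = (\<Sum>\<^sub>\<infinity>x\<in>P. 1 / (lattice_pt (row_act A x) z)\<^sup>2 ^ k)"
    unfolding lattice_sum_def
    by (subst infsum_reindex) (use inj_row_act[OF assms(1)] in \<open>auto simp: o_def inj_on_def\<close>)
  then have "(aut_factor A z)\<^sup>2 ^ k * lattice_sum (row_act A ` P) k z =
      (\<Sum>\<^sub>\<infinity>x\<in>P. (aut_factor A z)\<^sup>2 ^ k * (1 / (lattice_pt (row_act A x) z)\<^sup>2 ^ k))"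
    by (simp only: infsum_cmult_right')
  also have "\<dots> = lattice_sum P k (modular_act A z)"
    unfolding lattice_sum_def lattice_pt_modular_act[OF assms]
    by (intro infsum_cong) (simp add: power_divide)
  finally show ?thesis ..
qed

text \<open>Unions of residue classes modulo \<open>n\<close> without the origin.
  \<open>SL2Z\<close> permutes these sets and \<open>\<Gamma> n\<close> fixes each of them, so their
  lattice sums are modular for \<open>\<Gamma> n\<close> and have expansions at every cusp.\<close>

definition residue_closed :: "nat \<Rightarrow> (int \<times> int) set \<Rightarrow> bool" where
  "residue_closed n P \<longleftrightarrow> P \<subseteq> UNIV - {(0, 0)} \<and>
     (\<forall>x\<in>P. \<forall>y. y \<noteq> (0, 0) \<longrightarrow> [fst x = fst y] (mod int n) \<longrightarrow> [snd x = snd y] (mod int n) \<longrightarrow> y \<in> P)"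

lemma residue_closed_row_act:
  assumes "A \<in> SL2Z" "residue_closed n P"
  shows "residue_closed n (row_act A ` P)"
  unfolding residue_closed_def
proof (intro conjI ballI allI impI)
  show "row_act A ` P \<subseteq> UNIV - {(0, 0)}"
  proof (rule image_subsetI)
    show "row_act A x \<in> UNIV - {(0, 0)}" if "x \<in> P" for x
      using that assms row_act_zero_iff[OF assms(1), of x] unfolding residue_closed_def by blast
  qed
  fix x y assume x: "x \<in> row_act A ` P" and y: "y \<noteq> (0, 0)"
    "[fst x = fst y] (mod int n)" "[snd x = snd y] (mod int n)"
  obtain u where u: "u \<in> P" "x = row_act A u" using x by blast
  have "[fst (row_act (sl2_inv A) x) = fst (row_act (sl2_inv A) y)] (mod int n)"
    "[snd (row_act (sl2_inv A) x) = snd (row_act (sl2_inv A) y)] (mod int n)"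
    unfolding row_act_def fst_conv snd_conv by (intro cong_add cong_mult cong_refl y)+
  moreover have "row_act (sl2_inv A) x = u" using u(2) assms(1) by (simp add: row_act_inv)
  moreover have "row_act (sl2_inv A) y \<noteq> (0, 0)"
    using y(1) assms(1) by (simp add: row_act_zero_iff sl2_inv_in_SL2Z)
  ultimately have "row_act (sl2_inv A) y \<in> P"
    using assms(2) u(1) unfolding residue_closed_def by blast
  then have "row_act A (row_act (sl2_inv A) y) \<in> row_act A ` P" by (rule imageI)
  then show "y \<in> row_act A ` P" using assms(1) by (simp add: row_act_inv)
qed

lemma row_act_Gamma_subset:
  assumes "A \<in> \<Gamma> n" "residue_closed n P"
  shows "row_act A ` P \<subseteq> P"
proof (rule image_subsetI)
  fix x assume "x \<in> P"
  then obtain a b where ab: "x = (a, b)" and x: "(a, b) \<in> P" by (cases x) auto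
  have A: "A \<in> SL2Z" "[A $ 1 $ 1 = 1] (mod int n)" "[A $ 1 $ 2 = 0] (mod int n)"
     "[A $ 2 $ 1 = 0] (mod int n)" "[A $ 2 $ 2 = 1] (mod int n)" using assms(1) by (auto simp: Gamma_iff)
  have "[a * A $ 1 $ 1 + b * A $ 2 $ 1 = a * 1 + b * 0] (mod int n)"
    "[a * A $ 1 $ 2 + b * A $ 2 $ 2 = a * 0 + b * 1] (mod int n)"
    by (intro cong_add cong_mult cong_refl A)+
  then have "[fst (a, b) = fst (row_act A (a, b))] (mod int n)" "[snd (a, b) = snd (row_act A (a, b))] (mod int n)"
    by (simp_all add: row_act_def cong_sym)
  moreover have "row_act A (a, b) \<noteq> (0, 0)"
    using x assms(2) row_act_zero_iff[OF A(1), of "(a, b)"] unfolding residue_closed_def by blast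
  ultimately show "row_act A x \<in> P" using x assms(2) unfolding residue_closed_def ab by blast
qed

lemma sl2_inv_in_Gamma: "A \<in> \<Gamma> n \<Longrightarrow> sl2_inv A \<in> \<Gamma> n"
  using cong_minus_minus_iff[of "A $ 1 $ 2" 0 "int n"] cong_minus_minus_iff[of "A $ 2 $ 1" 0 "int n"]
  by (auto simp: Gamma_iff sl2_inv_in_SL2Z)

lemma row_act_Gamma:
  assumes "A \<in> \<Gamma> n" "residue_closed n P"
  shows "row_act A ` P = P"
proof
  show "row_act A ` P \<subseteq> P" by (rule row_act_Gamma_subset[OF assms])
  show "P \<subseteq> row_act A ` P"
  proof
    fix x assume "x \<in> P"
    then have "row_act (sl2_inv A) x \<in> P"
      using row_act_Gamma_subset[OF sl2_inv_in_Gamma[OF assms(1)] assms(2)] by blast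
    then show "x \<in> row_act A ` P"
      by (metis Gamma_subset_SL2Z assms(1) imageI row_act_inv(1))
  qed
qed

lemma translation_in_Gamma: "vector [vector [1, int n], vector [0, 1]] \<in> \<Gamma> n"
  by (simp add: Gamma_iff SL2Z_iff cong_def)

lemma translation_act: "modular_act (vector [vector [1, k], vector [0, 1]]) z = z + of_int k"
  by (simp add: modular_act_eq aut_factor_def)

lemma lattice_sum_periodic:
  assumes "residue_closed n P" "z \<in> \<H>"
  shows "lattice_sum P k (z + of_nat n) = lattice_sum P k z"
proof -
  let ?T = "vector [vector [1, int n], vector [0, 1]] :: int ^ 2 ^ 2"
  have "lattice_sum P k (modular_act ?T z) = (aut_factor ?T z)\<^sup>2 ^ k * lattice_sum (row_act ?T ` P) k z"
    by (rule lattice_sum_modular_act) (use translation_in_Gamma assms in \<open>auto simp: Gamma_iff\<close>)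
  then show ?thesis
    unfolding row_act_Gamma[OF translation_in_Gamma assms(1)] translation_act
    by (simp add: aut_factor_def)
qed

subsection \<open>Recovering a lattice from its power sums\<close>

text \<open>
  The double poles of this function are the squares of the lattice points with coordinates in \<open>P\<close>,
  and its Taylor coefficients at \<open>0\<close> are the numbers \<open>(k + 1) * lattice_sum P (k + 2) z\<close>.
\<close>

definition pole_sum :: "(int \<times> int) set \<Rightarrow> complex \<Rightarrow> complex \<Rightarrow> complex" where
  "pole_sum P z t = (\<Sum>\<^sub>\<infinity>x\<in>P. 1 / ((lattice_pt x z)\<^sup>2 - t)\<^sup>2)"

text \<open>Only finitely many terms have poles in the ball. For a lattice point p outside
  \<open>X\<close>, |p|^2 \<ge> 2 |R| and |t| < R give |p^2 - t| \<ge> |p|^2 / 2, so the remaining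
  terms have a common summable majorant.\<close>

lemma pole_sum_split:
  assumes "z \<in> \<H>" "P \<subseteq> UNIV - {(0, 0)}"
  obtains X h where "finite X" "X \<subseteq> P" "{x\<in>P. (cmod (lattice_pt x z))\<^sup>2 < R} \<subseteq> X" "h holomorphic_on ball 0 R"
    "\<forall>t\<in>ball 0 R. pole_sum P z t = (\<Sum>x\<in>X. 1 / ((lattice_pt x z)\<^sup>2 - t)\<^sup>2) + h t"
proof -
  obtain K where K: "K > 0" "\<And>x. sqnorm x \<le> K * (cmod (lattice_pt x z))\<^sup>2"
    using lattice_pt_lower_bound_at[OF assms(1)] by blast
  define X where "X = {x\<in>P. (cmod (lattice_pt x z))\<^sup>2 < 2 * \<bar>R\<bar>}"
  define h where "h = (\<lambda>t. \<Sum>\<^sub>\<infinity>x\<in>P - X. 1 / ((lattice_pt x z)\<^sup>2 - t)\<^sup>2)"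
  have "X \<subseteq> {x. sqnorm x \<le> K * (2 * \<bar>R\<bar>)}"
    using K by (auto simp: X_def intro: order_trans[OF K(2)] mult_left_mono)
  then have "finite X" using finite_sqnorm_le finite_subset by blast
  \<comment> \<open>From |p^2 - t| \<ge> |p|^2 / 2 and |p|^2 \<ge>
    \<open>sqnorm x / K\<close>.\<close>
  define M where "M = (\<lambda>x. 4 * K\<^sup>2 * (1 / (sqnorm x)\<^sup>2))"
  have M: "M summable_on (P - X)"
    unfolding M_def using assms(2)
    by (intro summable_on_cmult_right summable_on_subset[OF summable_on_sqnorm]) auto
  have lower: "(cmod (lattice_pt x z))\<^sup>2 / 2 \<le> cmod ((lattice_pt x z)\<^sup>2 - t)"
    if "x \<in> P - X" "t \<in> ball 0 R" for x t
  proof -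
    have "cmod t < \<bar>R\<bar>" using that(2) by simp
    moreover have "(cmod (lattice_pt x z))\<^sup>2 \<ge> 2 * \<bar>R\<bar>" using that(1) by (auto simp: X_def)
    moreover have "(cmod (lattice_pt x z))\<^sup>2 - cmod t \<le> cmod ((lattice_pt x z)\<^sup>2 - t)"
      using norm_triangle_ineq2[of "(lattice_pt x z)\<^sup>2" t] by (simp add: norm_power)
    ultimately show ?thesis by linarith
  qed
  have pos: "(cmod (lattice_pt x z))\<^sup>2 / 2 > 0" if "x \<in> P" for x
    using that lattice_pt_nonzero[OF assms(1), of x] assms(2) by auto
  have bound: "norm (1 / ((lattice_pt x z)\<^sup>2 - t)\<^sup>2) \<le> M x" if x: "x \<in> P - X" and t: "t \<in> ball 0 R" for x t
  proof -
    have p: "(cmod (lattice_pt x z))\<^sup>2 / 2 > 0" using pos x by simp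
    have "x \<noteq> (0, 0)" using x assms(2) by auto
    then have s: "sqnorm x \<ge> 1" by (rule sqnorm_ge_1)
    have "norm (1 / ((lattice_pt x z)\<^sup>2 - t)\<^sup>2) = 1 / (cmod ((lattice_pt x z)\<^sup>2 - t))\<^sup>2"
      by (simp add: norm_divide norm_power)
    also have "\<dots> \<le> 1 / ((cmod (lattice_pt x z))\<^sup>2 / 2)\<^sup>2"
      using lower[OF x t] p by (intro frac_le power_mono) auto
    also have "\<dots> \<le> 1 / (sqnorm x / K / 2)\<^sup>2"
      using K(2)[of x] s K(1) by (intro frac_le power_mono) (auto simp: field_simps)
    also have "\<dots> = M x" by (simp add: M_def power_divide)
    finally show ?thesis .
  qed
  have "h holomorphic_on ball 0 R"
    unfolding h_def
  proof (rule holomorphic_infsum)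
    fix x assume x: "x \<in> P - X"
    have "(lattice_pt x z)\<^sup>2 - t \<noteq> 0" if "t \<in> ball 0 R" for t
      using lower[OF x that] pos[of x] x by auto
    then show "(\<lambda>t. 1 / ((lattice_pt x z)\<^sup>2 - t)\<^sup>2) holomorphic_on ball 0 R"
      by (intro holomorphic_intros) auto
  next
    fix t :: complex assume "t \<in> ball 0 R"
    show "\<exists>r M. r > 0 \<and> M summable_on (P - X) \<and>
        (\<forall>x\<in>P - X. \<forall>w\<in>cball t r \<inter> ball 0 R. norm (1 / ((lattice_pt x z)\<^sup>2 - w)\<^sup>2) \<le> M x)"
      by (rule exI[of _ 1], rule exI[of _ M]) (use M bound in auto)
  qed auto
  moreover have "pole_sum P z t = (\<Sum>x\<in>X. 1 / ((lattice_pt x z)\<^sup>2 - t)\<^sup>2) + h t" if t: "t \<in> ball 0 R" for t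
  proof -
    have "(\<lambda>x. norm (1 / ((lattice_pt x z)\<^sup>2 - t)\<^sup>2)) summable_on (P - X)"
      by (rule Infinite_Sum.abs_summable_on_comparison_test'[OF M]) (use bound t in blast)
    then have "(\<lambda>x. 1 / ((lattice_pt x z)\<^sup>2 - t)\<^sup>2) summable_on (P - X)"
      by (rule abs_summable_summable)
    then have "(\<Sum>\<^sub>\<infinity>x\<in>X \<union> (P - X). 1 / ((lattice_pt x z)\<^sup>2 - t)\<^sup>2) =
        (\<Sum>\<^sub>\<infinity>x\<in>X. 1 / ((lattice_pt x z)\<^sup>2 - t)\<^sup>2) + h t"
      unfolding h_def using \<open>finite X\<close> by (intro infsum_Un_disjoint) auto
    moreover have "X \<union> (P - X) = P" by (auto simp: X_def)
    ultimately show ?thesis using \<open>finite X\<close> by (simp add: pole_sum_def)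
  qed
  ultimately show ?thesis
    using \<open>finite X\<close> by (intro that[of X h]) (auto simp: X_def)
qed

lemma pole_sum_holomorphic:
  assumes "z \<in> \<H>" "P \<subseteq> UNIV - {(0, 0)}"
  obtains F where "finite F" "0 \<notin> F" "pole_sum P z holomorphic_on ball 0 R - F"
proof -
  obtain X h where X: "finite X" "X \<subseteq> P" "{x\<in>P. (cmod (lattice_pt x z))\<^sup>2 < R} \<subseteq> X"
    and h: "h holomorphic_on ball 0 R"
    and eq: "\<forall>t\<in>ball 0 R. pole_sum P z t = (\<Sum>x\<in>X. 1 / ((lattice_pt x z)\<^sup>2 - t)\<^sup>2) + h t"
    using pole_sum_split[OF assms, of R] by blast
  define F where "F = (\<lambda>x. (lattice_pt x z)\<^sup>2) ` X"
  have "(\<lambda>t. (\<Sum>x\<in>X. 1 / ((lattice_pt x z)\<^sup>2 - t)\<^sup>2) + h t) holomorphic_on ball 0 R - F"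
    by (intro holomorphic_intros holomorphic_on_subset[OF h]) (auto simp: F_def)
  then have "pole_sum P z holomorphic_on ball 0 R - F"
    by (rule holomorphic_transform) (use eq in auto)
  moreover have "lattice_pt x z \<noteq> 0" if "x \<in> X" for x
    using that X(2) assms(2) by (intro lattice_pt_nonzero[OF assms(1)]) auto
  then have "0 \<notin> F" by (auto simp: F_def)
  ultimately show ?thesis using X(1) that[of F] by (simp add: F_def)
qed

text \<open>Every \<open>x\<close> whose lattice point has square \<open>s\<close> contributes
  exactly 1 to the coefficient of (t - s)^(-2), so contributions cannot cancel. Opposite points of
  \<open>P\<close> share a square, which is why a cardinality appears.\<close>

lemma pole_sum_principal_part:
  assumes "z \<in> \<H>" "P \<subseteq> UNIV - {(0, 0)}"
  shows "finite {x\<in>P. (lattice_pt x z)\<^sup>2 = s}"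
    and "((\<lambda>t. (t - s)\<^sup>2 * pole_sum P z t) \<longlongrightarrow> of_nat (card {x\<in>P. (lattice_pt x z)\<^sup>2 = s})) (at s)"
proof -
  define R where "R = cmod s + 1"
  obtain X h where X: "finite X" "X \<subseteq> P" "{x\<in>P. (cmod (lattice_pt x z))\<^sup>2 < R} \<subseteq> X"
    and h: "h holomorphic_on ball 0 R"
    and eq: "\<forall>t\<in>ball 0 R. pole_sum P z t = (\<Sum>x\<in>X. 1 / ((lattice_pt x z)\<^sup>2 - t)\<^sup>2) + h t"
    using pole_sum_split[OF assms, of R] by blast
  have s: "s \<in> ball 0 R" by (simp add: R_def)
  have *: "{x\<in>P. (lattice_pt x z)\<^sup>2 = s} = {x\<in>X. (lattice_pt x z)\<^sup>2 = s}"
    using X by (auto simp: R_def norm_power[symmetric])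
  show "finite {x\<in>P. (lattice_pt x z)\<^sup>2 = s}" using X(1) unfolding * by simp
  have "((\<lambda>t. (t - s)\<^sup>2 * (1 / ((lattice_pt x z)\<^sup>2 - t)\<^sup>2)) \<longlongrightarrow> (if (lattice_pt x z)\<^sup>2 = s then 1 else 0)) (at s)" for x
  proof (cases "(lattice_pt x z)\<^sup>2 = s")
    case True
    have "\<forall>\<^sub>F t in at s. (t - s)\<^sup>2 * (1 / ((lattice_pt x z)\<^sup>2 - t)\<^sup>2) = 1"
      using eventually_neq_at_within[of s s UNIV]
      by eventually_elim (simp add: True power2_commute[of s])
    then show ?thesis using True by (simp add: tendsto_eventually)
  next
    case False
    then have "((\<lambda>t. (t - s)\<^sup>2 * (1 / ((lattice_pt x z)\<^sup>2 - t)\<^sup>2)) \<longlongrightarrow> (s - s)\<^sup>2 * (1 / ((lattice_pt x z)\<^sup>2 - s)\<^sup>2)) (at s)"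
      by (intro tendsto_intros) auto
    then show ?thesis using False by simp
  qed
  moreover have "isCont h s"
    using h s by (metis continuous_on_eq_continuous_at holomorphic_on_imp_continuous_on open_ball)
  then have "((\<lambda>t. (t - s)\<^sup>2 * h t) \<longlongrightarrow> (s - s)\<^sup>2 * h s) (at s)"
    by (intro tendsto_intros) (simp add: isCont_def)
  ultimately have "((\<lambda>t. (\<Sum>x\<in>X. (t - s)\<^sup>2 * (1 / ((lattice_pt x z)\<^sup>2 - t)\<^sup>2)) + (t - s)\<^sup>2 * h t) \<longlongrightarrow>
      (\<Sum>x\<in>X. if (lattice_pt x z)\<^sup>2 = s then 1 else 0) + (s - s)\<^sup>2 * h s) (at s)"
    by (intro tendsto_add tendsto_sum)
  also have "(\<Sum>x\<in>X. if (lattice_pt x z)\<^sup>2 = s then 1 else 0) + (s - s)\<^sup>2 * h s =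
      of_nat (card {x\<in>X. (lattice_pt x z)\<^sup>2 = s})"
    using X(1) by (simp add: sum.If_cases Int_def)
  finally have lim: "((\<lambda>t. (\<Sum>x\<in>X. (t - s)\<^sup>2 * (1 / ((lattice_pt x z)\<^sup>2 - t)\<^sup>2)) + (t - s)\<^sup>2 * h t) \<longlongrightarrow>
      of_nat (card {x\<in>P. (lattice_pt x z)\<^sup>2 = s})) (at s)"
    unfolding * .
  have "\<forall>\<^sub>F t in at s. t \<in> ball 0 R"
    using s by (intro eventually_at_in_open') auto
  then have "\<forall>\<^sub>F t in at s. (\<Sum>x\<in>X. (t - s)\<^sup>2 * (1 / ((lattice_pt x z)\<^sup>2 - t)\<^sup>2)) + (t - s)\<^sup>2 * h t =
      (t - s)\<^sup>2 * pole_sum P z t"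
    by eventually_elim (simp only: eq distrib_left sum_distrib_left)
  then show "((\<lambda>t. (t - s)\<^sup>2 * pole_sum P z t) \<longlongrightarrow> of_nat (card {x\<in>P. (lattice_pt x z)\<^sup>2 = s})) (at s)"
    using lim by (rule Lim_transform_eventually[rotated])
qed

text \<open>The differentiated geometric series expands 1 / (p^2 - t)^2 in powers of t, and the two
  summations are interchanged. With double poles the coefficients start at weight 4; simple poles
  would bring in the sum of 1 / p^2, which diverges absolutely for a residue class.\<close>

lemma pole_sum_Taylor:
  assumes "z \<in> \<H>" "P \<subseteq> UNIV - {(0, 0)}"
  obtains r where "r > 0"
    "\<forall>t. cmod t \<le> r \<longrightarrow> pole_sum P z t = (\<Sum>\<^sub>\<infinity>k. of_nat (Suc k) * t ^ k * lattice_sum P (k + 2) z)"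
proof -
  obtain K where K: "K > 0" "\<And>x. sqnorm x \<le> K * (cmod (lattice_pt x z))\<^sup>2"
    using lattice_pt_lower_bound_at[OF assms(1)] by blast
  have "pole_sum P z t = (\<Sum>\<^sub>\<infinity>k. of_nat (Suc k) * t ^ k * lattice_sum P (k + 2) z)"
    if t: "cmod t \<le> 1 / (2 * K)" for t
  proof -
    define f where "f = (\<lambda>x k. of_nat (Suc k) * t ^ k * (1 / (lattice_pt x z)\<^sup>2 ^ (k + 2)))"
    define a where "a = (\<lambda>k. real (Suc k) * (1 / 2) ^ k)"
    define b where "b = (\<lambda>x. K ^ 2 * (1 / (sqnorm x)\<^sup>2))"
    \<comment> \<open>4 is (1 - 1/2)^(-2). The ratio t / p^2 is at most 1/2 in modulus because |p|^2
      \<ge> 1 / K for every nonzero lattice point p.\<close>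
    have asum: "(a has_sum 4) UNIV"
      using geometric_deriv_sums[of "1/2 :: real"] unfolding a_def
      by (intro sums_nonneg_imp_has_sum) (auto simp: power2_eq_square)
    have bsum: "b summable_on P"
      unfolding b_def by (intro summable_on_cmult_right summable_on_subset[OF summable_on_sqnorm] assms)
    have ratio: "cmod (t / (lattice_pt x z)\<^sup>2) \<le> 1 / 2" and nz: "lattice_pt x z \<noteq> 0"
      and bb: "norm (1 / (lattice_pt x z)\<^sup>2 ^ 2) \<le> b x" if x: "x \<in> P" for x
    proof -
      have x0: "x \<noteq> (0, 0)" using x assms(2) by auto
      show nz: "lattice_pt x z \<noteq> 0" using x0 assms(1) lattice_pt_nonzero by blast
      have "1 \<le> K * (cmod (lattice_pt x z))\<^sup>2" using sqnorm_ge_1[OF x0] K(2)[of x] by linarith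
      then have "1 / (2 * K) \<le> (cmod (lattice_pt x z))\<^sup>2 / 2" using K(1) by (simp add: field_simps)
      then have "cmod t \<le> (cmod (lattice_pt x z))\<^sup>2 / 2" using t by linarith
      then show "cmod (t / (lattice_pt x z)\<^sup>2) \<le> 1 / 2"
        using nz by (simp add: norm_divide norm_power field_simps)
      show "norm (1 / (lattice_pt x z)\<^sup>2 ^ 2) \<le> b x"
        unfolding b_def by (rule lattice_term_bound[OF K x0]) simp
    qed
    have f_eq: "f x k = of_nat (Suc k) * (t / (lattice_pt x z)\<^sup>2) ^ k * (1 / (lattice_pt x z)\<^sup>2 ^ 2)" for x k
      by (simp add: f_def power_divide power_add)
    have f_bound: "norm (f x k) \<le> b x * a k" if "x \<in> P" for x k
    proof -
      have "norm (f x k) = real (Suc k) * cmod (t / (lattice_pt x z)\<^sup>2) ^ k * norm (1 / (lattice_pt x z)\<^sup>2 ^ 2)"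
        unfolding f_eq norm_mult norm_power norm_of_nat ..
      also have "\<dots> \<le> real (Suc k) * (1 / 2) ^ k * b x"
        using ratio[OF that] bb[OF that] by (intro mult_mono power_mono) (auto simp: b_def)
      finally show ?thesis by (simp add: a_def mult_ac)
    qed
    have "(\<lambda>(x, k). b x * a k) summable_on Sigma P (\<lambda>_. UNIV)"
    proof (rule summable_on_SigmaI)
      show "((\<lambda>k. case (x, k) of (x, k) \<Rightarrow> b x * a k) has_sum b x * 4) UNIV" for x
        using has_sum_cmult_right[OF asum] by simp
      show "(\<lambda>x. b x * 4) summable_on P" using bsum by (rule summable_on_cmult_left)
    qed (auto simp: a_def b_def)
    then have "(\<lambda>y. norm ((\<lambda>(x, k). f x k) y)) summable_on P \<times> UNIV"
      by (rule Infinite_Sum.abs_summable_on_comparison_test') (use f_bound in auto)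
    then have fsum: "(\<lambda>(x, k). f x k) summable_on P \<times> UNIV" by (rule abs_summable_summable)
    have inner: "(\<Sum>\<^sub>\<infinity>k. f x k) = 1 / ((lattice_pt x z)\<^sup>2 - t)\<^sup>2" if x: "x \<in> P" for x
    proof -
      let ?q = "t / (lattice_pt x z)\<^sup>2"
      have "cmod ?q < 1" using ratio[OF x] by linarith
      then have "(\<lambda>k. of_nat (Suc k) * ?q ^ k) sums (1 / (1 - ?q)\<^sup>2)" by (rule geometric_deriv_sums)
      then have "(\<lambda>k. f x k) sums (1 / (1 - ?q)\<^sup>2 * (1 / (lattice_pt x z)\<^sup>2 ^ 2))"
        unfolding f_eq by (rule sums_mult2)
      moreover have "f x summable_on UNIV"
        using fsum x by (rule summable_on_SigmaD1)
      then have "f x sums (\<Sum>\<^sub>\<infinity>k. f x k)" by (intro has_sum_imp_sums has_sum_infsum)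
      moreover have "1 / (1 - ?q)\<^sup>2 * (1 / (lattice_pt x z)\<^sup>2 ^ 2) = 1 / ((1 - ?q) * (lattice_pt x z)\<^sup>2)\<^sup>2"
        by (simp add: power_mult_distrib)
      moreover have "(1 - ?q) * (lattice_pt x z)\<^sup>2 = (lattice_pt x z)\<^sup>2 - t"
        using nz[OF x] by (simp add: left_diff_distrib)
      ultimately show ?thesis by (metis sums_unique2)
    qed
    have "pole_sum P z t = (\<Sum>\<^sub>\<infinity>x\<in>P. \<Sum>\<^sub>\<infinity>k. f x k)"
      unfolding pole_sum_def by (intro infsum_cong) (simp add: inner)
    also have "\<dots> = (\<Sum>\<^sub>\<infinity>k. \<Sum>\<^sub>\<infinity>x\<in>P. f x k)" by (rule infsum_swap_banach[OF fsum])
    also have "\<dots> = (\<Sum>\<^sub>\<infinity>k. of_nat (Suc k) * t ^ k * lattice_sum P (k + 2) z)"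
      unfolding f_def lattice_sum_def by (simp only: infsum_cmult_right')
    finally show ?thesis .
  qed
  with K(1) show ?thesis by (intro that[of "1 / (2 * K)"]) auto
qed

text \<open>By \<open>sums\<close>, \<open>pole_sum P w t\<close> and \<open>c^2\<close> times
  \<open>pole_sum P z (c t)\<close> have the same Taylor coefficients at 0. A disc of radius larger
  than |s| minus finitely many poles is connected, so they agree there, and comparing the
  coefficients of the double pole at \<open>s\<close> shows that \<open>c s\<close> is a square of a
  lattice point of \<open>z\<close>.\<close>

lemma lattice_squares_determined:
  assumes z: "z \<in> \<H>" and w: "w \<in> \<H>" and P: "P \<subseteq> UNIV - {(0, 0)}" and c: "c \<noteq> 0"
    and sums: "\<And>k. k \<ge> 2 \<Longrightarrow> lattice_sum P k w = c ^ k * lattice_sum P k z"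
    and x: "x \<in> P"
  obtains x' where "x' \<in> P" "c * (lattice_pt x w)\<^sup>2 = (lattice_pt x' z)\<^sup>2"
proof -
  define s where "s = (lattice_pt x w)\<^sup>2"
  define R where "R = cmod s + 1"
  obtain r1 where r1: "r1 > 0"
    "\<forall>t. cmod t \<le> r1 \<longrightarrow> pole_sum P w t = (\<Sum>\<^sub>\<infinity>k. of_nat (Suc k) * t ^ k * lattice_sum P (k + 2) w)"
    using pole_sum_Taylor[OF w P] by blast
  obtain r2 where r2: "r2 > 0"
    "\<forall>t. cmod t \<le> r2 \<longrightarrow> pole_sum P z t = (\<Sum>\<^sub>\<infinity>k. of_nat (Suc k) * t ^ k * lattice_sum P (k + 2) z)"
    using pole_sum_Taylor[OF z P] by blast
  obtain F1 where F1: "finite F1" "0 \<notin> F1" "pole_sum P w holomorphic_on ball 0 R - F1"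
    using pole_sum_holomorphic[OF w P, of R] by blast
  obtain F2 where F2: "finite F2" "0 \<notin> F2" "pole_sum P z holomorphic_on ball 0 (cmod c * R) - F2"
    using pole_sum_holomorphic[OF z P, of "cmod c * R"] by blast
  define D where "D = ball 0 R - (F1 \<union> (\<lambda>u. u / c) ` F2)"
  have fin: "finite (F1 \<union> (\<lambda>u. u / c) ` F2)" using F1 F2 by simp
  have D: "open D" "connected D" "0 \<in> D"
    using F1 F2 c fin
    by (auto simp: D_def R_def intro!: open_Diff finite_imp_closed connected_open_delete_finite add_nonneg_pos)
  have h1: "pole_sum P w holomorphic_on D"
    by (rule holomorphic_on_subset[OF F1(3)]) (auto simp: D_def)
  have "(*) c ` D \<subseteq> ball 0 (cmod c * R) - F2"
  proof (rule image_subsetI)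
    fix t assume t: "t \<in> D"
    then have "c * t / c \<notin> (\<lambda>u. u / c) ` F2" using c by (simp add: D_def)
    then have "c * t \<notin> F2" by blast
    moreover have "cmod t < R" using t by (simp add: D_def)
    ultimately show "c * t \<in> ball 0 (cmod c * R) - F2" using c by (simp add: norm_mult)
  qed
  then have "(pole_sum P z \<circ> (*) c) holomorphic_on D"
    by (intro holomorphic_on_compose_gen[OF _ F2(3)] holomorphic_intros)
  then have h2: "(\<lambda>t. c\<^sup>2 * pole_sum P z (c * t)) holomorphic_on D"
    unfolding o_def by (intro holomorphic_intros)
  define r where "r = min r1 (r2 / cmod c)"
  have r: "r > 0" using r1 r2 c by (simp add: r_def)
  have near: "pole_sum P w t = c\<^sup>2 * pole_sum P z (c * t)" if "cmod t < r" for t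
  proof -
    have "pole_sum P w t = (\<Sum>\<^sub>\<infinity>k. of_nat (Suc k) * t ^ k * lattice_sum P (k + 2) w)"
      using that by (intro r1(2)[rule_format]) (simp add: r_def)
    also have "\<dots> = (\<Sum>\<^sub>\<infinity>k. c\<^sup>2 * (of_nat (Suc k) * (c * t) ^ k * lattice_sum P (k + 2) z))"
    proof (rule infsum_cong)
      fix k :: nat
      show "of_nat (Suc k) * t ^ k * lattice_sum P (k + 2) w =
          c\<^sup>2 * (of_nat (Suc k) * (c * t) ^ k * lattice_sum P (k + 2) z)"
        by (subst sums) (simp_all only: power_add power_mult_distrib mult_ac le_add2)
    qed
    also have "\<dots> = c\<^sup>2 * pole_sum P z (c * t)"
      using that c unfolding infsum_cmult_right'
      by (subst r2(2)[rule_format]) (auto simp: r_def norm_mult field_simps)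
    finally show ?thesis .
  qed
  have eq: "pole_sum P w t = c\<^sup>2 * pole_sum P z (c * t)" if "t \<in> D" for t
  proof (rule analytic_continuation_open[of "ball 0 r \<inter> D" D "pole_sum P w" "\<lambda>t. c\<^sup>2 * pole_sum P z (c * t)"])
    have "0 \<in> ball 0 r \<inter> D" using r D(3) by simp
    then show "ball 0 r \<inter> D \<noteq> {}" by blast
  qed (use D h1 h2 near that in auto)
  have lim1: "((\<lambda>t. (t - s)\<^sup>2 * pole_sum P w t) \<longlongrightarrow> of_nat (card {x\<in>P. (lattice_pt x w)\<^sup>2 = s})) (at s)"
    by (rule pole_sum_principal_part[OF w P])
  have "filterlim ((*) c) (at (c * s)) (at s)"
    unfolding filterlim_at using c
    by (auto intro!: tendsto_intros eventually_mono[OF eventually_neq_at_within[of s s UNIV]])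
  from filterlim_compose[OF pole_sum_principal_part(2)[OF z P, of "c * s"] this]
  have lim2: "((\<lambda>t. (c * t - c * s)\<^sup>2 * pole_sum P z (c * t)) \<longlongrightarrow>
      of_nat (card {x\<in>P. (lattice_pt x z)\<^sup>2 = c * s})) (at s)" .
  have "\<forall>\<^sub>F t in at s. t \<notin> F1 \<union> (\<lambda>u. u / c) ` F2"
    using fin by (metis islimpt_finite islimpt_iff_eventually)
  moreover have "\<forall>\<^sub>F t in at s. t \<in> ball 0 R" by (intro eventually_at_in_open') (auto simp: R_def)
  ultimately have "\<forall>\<^sub>F t in at s. (c * t - c * s)\<^sup>2 * pole_sum P z (c * t) = (t - s)\<^sup>2 * pole_sum P w t"
  proof eventually_elim
    case (elim t)
    then have "t \<in> D" by (simp add: D_def)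
    then show ?case by (simp add: eq right_diff_distrib[symmetric] power_mult_distrib)
  qed
  then have "((\<lambda>t. (t - s)\<^sup>2 * pole_sum P w t) \<longlongrightarrow> of_nat (card {x\<in>P. (lattice_pt x z)\<^sup>2 = c * s})) (at s)"
    using lim2 by (rule Lim_transform_eventually[rotated])
  with lim1 have "of_nat (card {x\<in>P. (lattice_pt x w)\<^sup>2 = s}) =
      (of_nat (card {x\<in>P. (lattice_pt x z)\<^sup>2 = c * s}) :: complex)"
    by (rule tendsto_unique[rotated]) simp
  then have "card {x\<in>P. (lattice_pt x z)\<^sup>2 = c * s} = card {x\<in>P. (lattice_pt x w)\<^sup>2 = s}" by simp
  moreover have "card {x\<in>P. (lattice_pt x w)\<^sup>2 = s} \<noteq> 0"
    using card_0_eq[OF pole_sum_principal_part(1)[OF w P, of s]] x unfolding s_def by blast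
  ultimately have "{x\<in>P. (lattice_pt x z)\<^sup>2 = c * s} \<noteq> {}" by force
  then show ?thesis using that by (auto simp: s_def)
qed

definition residue_class :: "nat \<Rightarrow> int \<times> int \<Rightarrow> (int \<times> int) set" where
  "residue_class n v = {x. x \<noteq> (0, 0) \<and> [fst x = fst v] (mod int n) \<and> [snd x = snd v] (mod int n)}"

lemma residue_closed_residue_class: "residue_closed n (residue_class n v)"
  unfolding residue_closed_def residue_class_def
  by (auto intro: cong_trans cong_sym)

text \<open>\<open>lattice_squares_determined\<close> is applied to the generators 1 and
  \<open>w\<close> of the lattice of \<open>w\<close>; the quotient of the two resulting points of
  the lattice of \<open>z\<close> is \<open>w\<close> up to sign. The lost sign survives in the
  congruence for the first entry of \<open>M\<close>. So far \<open>M\<close> is only integral; the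
  relation between the imaginary parts is what later fixes its determinant.\<close>

lemma lattice_sums_transfer:
  fixes z w c :: complex
  assumes z: "z \<in> \<H>" and w: "w \<in> \<H>" and c: "c \<noteq> 0"
    and sums: "\<And>k v. k \<ge> 2 \<Longrightarrow> v \<in> {(0, 1), (1, 0)} \<Longrightarrow>
            lattice_sum (residue_class n v) k w = c ^ k * lattice_sum (residue_class n v) k z"
  obtains M :: "int ^ 2 ^ 2" where "w = modular_act M z"
    "[M $ 1 $ 1 = 1] (mod int n) \<or> [M $ 1 $ 1 = -1] (mod int n)" "[M $ 1 $ 2 = 0] (mod int n)"
    "[M $ 2 $ 1 = 0] (mod int n)" "[M $ 2 $ 2 = 1] (mod int n)"
    "det M > 0" "Im w * cmod c = of_int (det M) * Im z"
proof -
  have sub: "residue_class n v \<subseteq> UNIV - {(0, 0)}" for v by (auto simp: residue_class_def)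
  have in1: "(0, 1) \<in> residue_class n (0, 1)" and in2: "(1, 0) \<in> residue_class n (1, 0)"
    by (auto simp: residue_class_def)
  obtain y where y: "y \<in> residue_class n (0, 1)" "c * (lattice_pt (0, 1) w)\<^sup>2 = (lattice_pt y z)\<^sup>2"
    using lattice_squares_determined[OF z w sub c sums in1] by blast
  obtain x where x: "x \<in> residue_class n (1, 0)" "c * (lattice_pt (1, 0) w)\<^sup>2 = (lattice_pt x z)\<^sup>2"
    using lattice_squares_determined[OF z w sub c sums in2] by blast
  have cy: "c = (lattice_pt y z)\<^sup>2" and cx: "c * w\<^sup>2 = (lattice_pt x z)\<^sup>2"
    using x(2) y(2) by (simp_all add: lattice_pt_def)
  have nz: "lattice_pt y z \<noteq> 0" using c cy by auto
  have "(w * lattice_pt y z)\<^sup>2 = (lattice_pt x z)\<^sup>2" using cx cy by (simp add: power_mult_distrib mult.commute)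
  then have "w * lattice_pt y z = lattice_pt x z \<or> w * lattice_pt y z = - lattice_pt x z"
    by (simp add: power2_eq_iff)
  \<comment> \<open>The sign goes into the upper row, so that the lower row keeps its residues (0,
    1).\<close>
  then obtain \<epsilon> :: int where \<epsilon>: "\<epsilon> = 1 \<or> \<epsilon> = -1" and "w * lattice_pt y z = of_int \<epsilon> * lattice_pt x z"
    by (metis mult_1 mult_minus1 of_int_1 of_int_minus)
  then have weq: "w = (of_int (\<epsilon> * fst x) * z + of_int (\<epsilon> * snd x)) / (of_int (fst y) * z + of_int (snd y))"
    using nz by (simp add: lattice_pt_def field_simps)
  define M :: "int ^ 2 ^ 2" where "M = vector [vector [\<epsilon> * fst x, \<epsilon> * snd x], vector [fst y, snd y]]"
  have M: "M $ 1 $ 1 = \<epsilon> * fst x" "M $ 1 $ 2 = \<epsilon> * snd x" "M $ 2 $ 1 = fst y" "M $ 2 $ 2 = snd y"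
    by (simp_all add: M_def)
  have "of_int (fst y) * z + of_int (snd y) \<noteq> 0" using nz by (simp add: lattice_pt_def)
  then have "Im w = of_int (\<epsilon> * fst x * snd y - \<epsilon> * snd x * fst y) * Im z /
      (cmod (of_int (fst y) * z + of_int (snd y)))\<^sup>2"
    unfolding weq by (rule Im_fractional_linear)
  also have "(cmod (of_int (fst y) * z + of_int (snd y)))\<^sup>2 = cmod c"
    unfolding cy norm_power lattice_pt_def ..
  finally have Im: "Im w = of_int (det M) * Im z / cmod c" by (simp only: det_2 M)
  then have Im': "Im w * cmod c = of_int (det M) * Im z" using c by simp
  moreover have "Im w * cmod c > 0" "Im z > 0" using w z c by (simp_all add: in_upper_half_plane_iff)
  ultimately have "det M > 0" by (metis of_int_0_less_iff zero_less_mult_pos2)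
  have "[fst x = 1] (mod int n)" "[snd x = 0] (mod int n)"
    using x(1) by (auto simp: residue_class_def)
  then have "[\<epsilon> * fst x = \<epsilon> * 1] (mod int n)" "[\<epsilon> * snd x = \<epsilon> * 0] (mod int n)"
    by (simp_all only: cong_mult cong_refl)
  then show ?thesis
    using that[of M] Im' \<open>det M > 0\<close> \<epsilon> y(1) weq
    by (auto simp: M modular_act_eq aut_factor_def residue_class_def)
qed

text \<open>Exchanging \<open>z\<close> and \<open>w\<close> and replacing \<open>c\<close> by
  \<open>1 / c\<close> gives a second matrix. Multiplying the two relations between imaginary parts
  shows that the determinants, both positive integers, have product 1. Determinant 1 read modulo
  \<open>n\<close> then settles the sign of the first entry.\<close>

lemma lattice_sums_separate:
  fixes z w c :: complex
  assumes z: "z \<in> \<H>" and w: "w \<in> \<H>" and c: "c \<noteq> 0"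
    and sums: "\<And>k v. k \<ge> 2 \<Longrightarrow> v \<in> {(0, 1), (1, 0)} \<Longrightarrow>
            lattice_sum (residue_class n v) k w = c ^ k * lattice_sum (residue_class n v) k z"
  shows "\<exists>M\<in>\<Gamma> n. w = modular_act M z"
proof -
  obtain M :: "int ^ 2 ^ 2" where M: "w = modular_act M z"
    "[M $ 1 $ 1 = 1] (mod int n) \<or> [M $ 1 $ 1 = -1] (mod int n)" "[M $ 1 $ 2 = 0] (mod int n)"
    "[M $ 2 $ 1 = 0] (mod int n)" "[M $ 2 $ 2 = 1] (mod int n)"
    "det M > 0" "Im w * cmod c = of_int (det M) * Im z"
    by (rule lattice_sums_transfer[OF z w c sums])
  have c': "1 / c \<noteq> 0" using c by simp
  have "lattice_sum (residue_class n v) k z = (1 / c) ^ k * lattice_sum (residue_class n v) k w"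
    if "k \<ge> 2" "v \<in> {(0, 1), (1, 0)}" for k v
    using sums[OF that] c by (simp add: power_one_over)
  from lattice_sums_transfer[OF w z c' this]
  obtain M' :: "int ^ 2 ^ 2" where M': "det M' > 0" "Im z * cmod (1 / c) = of_int (det M') * Im w"
    by blast
  have "of_int (det M * det M') * (Im z * Im w) = (Im w * cmod c) * (Im z * cmod (1 / c))"
    unfolding M(7) M'(2) by (simp add: mult_ac)
  also have "\<dots> = Im z * Im w" using c by (simp add: norm_divide)
  finally have "real_of_int (det M * det M') = 1"
    using z w by (simp add: in_upper_half_plane_iff)
  then have "det M * det M' = 1" using of_int_eq_1_iff by blast
  then have det: "det M = 1" using M(6) pos_zmult_eq_1_iff by blast
  have "[M $ 1 $ 1 * M $ 2 $ 2 - M $ 1 $ 2 * M $ 2 $ 1 = M $ 1 $ 1 * 1 - 0 * 0] (mod int n)"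
    by (intro cong_diff cong_mult cong_refl M)
  then have "[1 = M $ 1 $ 1] (mod int n)" using det by (simp add: det_2)
  then have "M \<in> \<Gamma> n" using M det by (simp add: Gamma_iff SL2Z_def cong_sym)
  with M(1) show ?thesis by blast
qed

subsection \<open>The Fourier expansion of the Eisenstein series of weight 4\<close>

lemma open_Compl_Ints: "open (- \<int> :: complex set)"
  by (simp add: open_Compl)

lemma not_Ints_imp_not_nonpos_Ints:
  assumes "z \<notin> (\<int> :: complex set)"
  shows "z \<notin> \<int>\<^sub>\<le>\<^sub>0" "1 - z \<notin> \<int>\<^sub>\<le>\<^sub>0" "1 - z \<notin> \<int>"
proof -
  show "1 - z \<notin> \<int>"
  proof
    assume "1 - z \<in> \<int>"
    then have "1 - (1 - z) \<in> \<int>" by (intro Ints_diff) auto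
    then show False using assms by simp
  qed
  then show "1 - z \<notin> \<int>\<^sub>\<le>\<^sub>0" using nonpos_Ints_subset_Ints by blast
  show "z \<notin> \<int>\<^sub>\<le>\<^sub>0" using assms nonpos_Ints_subset_Ints by blast
qed

section \<open>Reflection formula for the third polygamma function\<close>

lemma sin_pi_nonzero:
  assumes "z \<notin> (\<int> :: complex set)"
  shows "sin (of_real pi * z) \<noteq> 0"
proof
  assume "sin (of_real pi * z) = 0"
  then obtain k :: int where "of_real pi * z = of_real (of_int k * pi)"
    by (auto simp: Complex_Transcendental.sin_eq_0)
  then have "of_real pi * z = of_real pi * of_int k" by (simp add: mult.commute)
  then have "z = of_int k" by simp
  then show False using assms by simp
qed

text \<open>This is the logarithmic derivative of the reflection formula for
  \<open>rGamma\<close>.\<close>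

lemma Digamma_reflection_complex:
  assumes "z \<notin> (\<int> :: complex set)"
  shows "Digamma (1 - z) - Digamma z = of_real pi * cos (of_real pi * z) / sin (of_real pi * z)"
proof -
  note ni = not_Ints_imp_not_nonpos_Ints[OF assms]
  have "((\<lambda>z. rGamma z * rGamma (1 - z)) has_field_derivative
      (- rGamma z * Digamma z) * rGamma (1 - z) + rGamma z * (rGamma (1 - z) * Digamma (1 - z))) (at z)"
    using ni by (auto intro!: derivative_eq_intros)
  moreover have "(\<lambda>z. rGamma z * rGamma (1 - z)) = (\<lambda>z::complex. sin (of_real pi * z) / of_real pi)"
    by (simp add: rGamma_reflection_complex)
  moreover have "((\<lambda>z. sin (of_real pi * z) / of_real pi) has_field_derivative cos (of_real pi * z)) (at z)"
    by (auto intro!: derivative_eq_intros)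
  ultimately have "(- rGamma z * Digamma z) * rGamma (1 - z) + rGamma z * (rGamma (1 - z) * Digamma (1 - z)) =
      cos (of_real pi * z)"
    by (simp only: DERIV_unique)
  then have "(Digamma (1 - z) - Digamma z) * (rGamma z * rGamma (1 - z)) = cos (of_real pi * z)"
    by (simp add: algebra_simps)
  then have "(Digamma (1 - z) - Digamma z) * (sin (of_real pi * z) / of_real pi) = cos (of_real pi * z)"
    by (simp only: rGamma_reflection_complex)
  then show ?thesis using sin_pi_nonzero[OF assms] by (simp add: field_simps)
qed

definition nome :: "complex \<Rightarrow> complex" where
  "nome z = exp (2 * of_real pi * \<i> * z)"

lemma nome_has_field_derivative [derivative_intros]:
  "(nome has_field_derivative 2 * of_real pi * \<i> * nome z) (at z within S)"
  unfolding nome_def[abs_def] by (auto intro!: derivative_eq_intros)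

lemma nome_eq_1_iff: "nome z = 1 \<longleftrightarrow> z \<in> \<int>"
proof
  assume "nome z = 1"
  then obtain k :: int where k: "Re (2 * of_real pi * \<i> * z) = 0" "Im (2 * of_real pi * \<i> * z) = of_int (2 * k) * pi"
    unfolding nome_def exp_eq_1 by blast
  then have "Im z = 0" "Re z = of_int k" by auto
  then have "z = of_int k" by (simp add: complex_eq_iff)
  then show "z \<in> \<int>" by simp
next
  assume "z \<in> \<int>"
  then obtain k where "z = of_int k" by (elim Ints_cases)
  then show "nome z = 1" unfolding nome_def exp_eq_1 by auto
qed

lemma cot_eq_nome:
  assumes "z \<notin> (\<int> :: complex set)"
  shows "of_real pi * cos (of_real pi * z) / sin (of_real pi * z) =
           - (of_real pi * \<i>) - 2 * of_real pi * \<i> * (nome z / (1 - nome z))"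
proof -
  define E where "E = exp (\<i> * (of_real pi * z))"
  have E: "E \<noteq> 0" by (simp add: E_def)
  have nE: "nome z = E * E"
    unfolding nome_def E_def exp_add[symmetric] by (simp add: algebra_simps)
  have inv: "exp (- (\<i> * (of_real pi * z))) = 1 / E"
    unfolding E_def by (simp add: exp_minus inverse_eq_divide)
  have s: "sin (of_real pi * z) = (E - 1 / E) / (2 * \<i>)"
    and c: "cos (of_real pi * z) = (E + 1 / E) / 2"
    by (simp_all add: sin_exp_eq cos_exp_eq inv E_def[symmetric] exp_minus inverse_eq_divide)
  have "E * E \<noteq> 1" using assms nome_eq_1_iff[of z] nE by simp
  then have n1: "1 - E * E \<noteq> 0" "E * E - 1 \<noteq> 0" by auto
  have "cos (of_real pi * z) / sin (of_real pi * z) = \<i> * (E * E + 1) / (E * E - 1)"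
    unfolding s c using E n1 by (simp add: field_simps)
  also have "\<dots> = - \<i> - 2 * \<i> * (E * E / (1 - E * E))"
    using n1 by (simp add: field_simps)
  finally have "cos (of_real pi * z) / sin (of_real pi * z) = - \<i> - 2 * \<i> * (E * E / (1 - E * E))" .
  then have "of_real pi * (cos (of_real pi * z) / sin (of_real pi * z)) =
      of_real pi * (- \<i> - 2 * \<i> * (E * E / (1 - E * E)))" by (simp only:)
  then show ?thesis
    unfolding nE by (simp add: algebra_simps)
qed

lemma DERIV_cong_open:
  assumes "(f has_field_derivative D) (at z)" "open U" "z \<in> U" "\<And>w. w \<in> U \<Longrightarrow> f w = g w"
    and "(g has_field_derivative D') (at z)"
  shows "D = D'"
proof -
  have "(f has_field_derivative D') (at z)"
    using has_field_derivative_transform_within_open[OF assms(5,2,3)] assms(4) by metis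
  with assms(1) show ?thesis by (rule DERIV_unique)
qed

text \<open>Each function is q times the derivative of the preceding one: q d/dq is iterated on q /
  (1 - q), and the numerators are Eulerian polynomials. On functions of the nome, d/dz is 2 pi i
  times q d/dq.\<close>

lemma geometric_theta_derivs:
  fixes q :: "'a :: real_normed_field"
  assumes "q \<noteq> 1"
  shows "((\<lambda>q. q / (1 - q)) has_field_derivative 1 / (1 - q)\<^sup>2) (at q)"
    and "((\<lambda>q. q / (1 - q)\<^sup>2) has_field_derivative (1 + q) / (1 - q) ^ 3) (at q)"
    and "((\<lambda>q. q * (1 + q) / (1 - q) ^ 3) has_field_derivative (1 + 4 * q + q\<^sup>2) / (1 - q) ^ 4) (at q)"
  using assms
  by (auto intro!: derivative_eq_intros simp: divide_simps) (simp_all add: algebra_simps eval_nat_numeral)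

text \<open>Three differentiations of the cotangent formula, each bringing a factor 2 pi i. This is
  Lipschitz's formula in closed form: the left side is 6 times the sum of (z + d)^(-4) over all
  integers d.\<close>

lemma Polygamma_3_reflection:
  assumes "z \<notin> (\<int> :: complex set)"
  shows "Polygamma 3 z + Polygamma 3 (1 - z) =
           (2 * of_real pi) ^ 4 * (nome z * (1 + 4 * nome z + (nome z)\<^sup>2) / (1 - nome z) ^ 4)"
proof -
  let ?c = "2 * of_real pi * \<i>"
  have n1: "nome z \<noteq> 1" if "z \<notin> \<int>" for z using that nome_eq_1_iff[of z] by blast
  have D1: "((\<lambda>z. nome z / (1 - nome z)) has_field_derivative 1 / (1 - nome z)\<^sup>2 * (?c * nome z)) (at z)"
    if "z \<notin> \<int>" for z
    by (rule DERIV_chain2[where g = nome and x = z and f = "\<lambda>q. q / (1 - q)"])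
      (rule geometric_theta_derivs n1 that nome_has_field_derivative)+
  have D2: "((\<lambda>z. nome z / (1 - nome z)\<^sup>2) has_field_derivative (1 + nome z) / (1 - nome z) ^ 3 * (?c * nome z)) (at z)"
    if "z \<notin> \<int>" for z
    by (rule DERIV_chain2[where g = nome and x = z and f = "\<lambda>q. q / (1 - q)\<^sup>2"])
      (rule geometric_theta_derivs n1 that nome_has_field_derivative)+
  have D3: "((\<lambda>z. nome z * (1 + nome z) / (1 - nome z) ^ 3) has_field_derivative
       (1 + 4 * nome z + (nome z)\<^sup>2) / (1 - nome z) ^ 4 * (?c * nome z)) (at z)"
    if "z \<notin> \<int>" for z
    by (rule DERIV_chain2[where g = nome and x = z and f = "\<lambda>q. q * (1 + q) / (1 - q) ^ 3"])
      (rule geometric_theta_derivs n1 that nome_has_field_derivative)+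
  note ni = not_Ints_imp_not_nonpos_Ints
  have e0: "Polygamma 0 (1 - z) - Polygamma 0 z = - (of_real pi * \<i>) - ?c * (nome z / (1 - nome z))"
    if "z \<notin> \<int>" for z
    using Digamma_reflection_complex[OF that] cot_eq_nome[OF that] by simp
  have e1: "- Polygamma 1 (1 - z) - Polygamma 1 z = - (?c ^ 2 * (nome z / (1 - nome z)\<^sup>2))"
    if z: "z \<notin> \<int>" for z
  proof (rule DERIV_cong_open[OF _ open_Compl_Ints])
    show "((\<lambda>z. Polygamma 0 (1 - z) - Polygamma 0 z) has_field_derivative
        - Polygamma 1 (1 - z) - Polygamma 1 z) (at z)"
      using ni[OF z] by (auto intro!: derivative_eq_intros DERIV_chain2[OF has_field_derivative_Polygamma])
    show "((\<lambda>z. - (of_real pi * \<i>) - ?c * (nome z / (1 - nome z))) has_field_derivative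
        - (?c ^ 2 * (nome z / (1 - nome z)\<^sup>2))) (at z)"
      by (rule DERIV_cong[OF DERIV_diff[OF DERIV_const DERIV_cmult[OF D1[OF z]]]])
        (simp add: power2_eq_square)
  qed (use z e0 in auto)
  have e2: "Polygamma 2 (1 - z) - Polygamma 2 z = - (?c ^ 3 * (nome z * (1 + nome z) / (1 - nome z) ^ 3))"
    if z: "z \<notin> \<int>" for z
  proof (rule DERIV_cong_open[OF _ open_Compl_Ints])
    show "((\<lambda>z. - Polygamma 1 (1 - z) - Polygamma 1 z) has_field_derivative
        Polygamma 2 (1 - z) - Polygamma 2 z) (at z)"
      using ni[OF z] by (auto intro!: derivative_eq_intros DERIV_chain2[OF has_field_derivative_Polygamma] simp: numeral_2_eq_2)
    show "((\<lambda>z. - (?c ^ 2 * (nome z / (1 - nome z)\<^sup>2))) has_field_derivative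
        - (?c ^ 3 * (nome z * (1 + nome z) / (1 - nome z) ^ 3))) (at z)"
      by (rule DERIV_cong[OF DERIV_minus[OF DERIV_cmult[OF D2[OF z]]]])
        (simp add: eval_nat_numeral)
  qed (use z e1 in auto)
  have "- Polygamma 3 (1 - z) - Polygamma 3 z =
      - (?c ^ 4 * (nome z * (1 + 4 * nome z + (nome z)\<^sup>2) / (1 - nome z) ^ 4))"
  proof (rule DERIV_cong_open[OF _ open_Compl_Ints])
    show "((\<lambda>z. Polygamma 2 (1 - z) - Polygamma 2 z) has_field_derivative
        - Polygamma 3 (1 - z) - Polygamma 3 z) (at z)"
      using ni[OF assms] by (auto intro!: derivative_eq_intros DERIV_chain2[OF has_field_derivative_Polygamma] simp: eval_nat_numeral)
    show "((\<lambda>z. - (?c ^ 3 * (nome z * (1 + nome z) / (1 - nome z) ^ 3))) has_field_derivative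
        - (?c ^ 4 * (nome z * (1 + 4 * nome z + (nome z)\<^sup>2) / (1 - nome z) ^ 4))) (at z)"
      by (rule DERIV_cong[OF DERIV_minus[OF DERIV_cmult[OF D3[OF assms]]]])
        (simp add: eval_nat_numeral)
  qed (use assms e2 in auto)
  moreover have "?c ^ 4 = (2 * of_real pi) ^ 4" by (simp add: power_mult_distrib)
  ultimately show ?thesis by (simp add: algebra_simps)
qed

section \<open>Power series for cubes and the value of zeta at 4\<close>

lemma theta_sums:
  fixes f :: "'a \<Rightarrow> 'a :: {banach,real_normed_field}"
  assumes "\<And>q. norm q < 1 \<Longrightarrow> (\<lambda>n. c n * q ^ n) sums f q"
    and "\<And>q. norm q < 1 \<Longrightarrow> (f has_field_derivative f' q) (at q)"
    and "norm q < 1"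
  shows "(\<lambda>n. (of_nat n * c n) * q ^ n) sums (q * f' q)"
proof -
  have "(\<lambda>n. diffs c n * q ^ n) sums f' q"
    by (rule termdiffs_sums_strong[of 1]) (use assms in auto)
  then have "(\<lambda>n. q * (diffs c n * q ^ n)) sums (q * f' q)" by (rule sums_mult)
  then have "(\<lambda>n. of_nat (Suc n) * c (Suc n) * q ^ Suc n) sums (q * f' q)"
    by (simp add: diffs_def mult_ac)
  then show ?thesis by (subst (asm) sums_Suc_iff) simp
qed

lemma sum_cubes_geometric:
  fixes q :: "'a :: {banach,real_normed_field}"
  assumes "norm q < 1"
  shows "(\<lambda>n. of_nat n ^ 3 * q ^ n) sums (q * (1 + 4 * q + q\<^sup>2) / (1 - q) ^ 4)"
proof -
  have q: "q \<noteq> 1" if "norm q < 1" for q :: 'a using that by auto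
  have s0: "(\<lambda>n. 1 * q ^ n) sums (1 / (1 - q))" if "norm q < 1" for q :: 'a
    using geometric_sums[OF that] by simp
  have "((\<lambda>q. 1 / (1 - q)) has_field_derivative 1 / (1 - q)\<^sup>2) (at q)" if "norm q < 1" for q :: 'a
    using q[OF that] by (auto intro!: derivative_eq_intros simp: power2_eq_square)
  from theta_sums[OF s0 this]
  have s1: "(\<lambda>n. (of_nat n * 1) * q ^ n) sums (q / (1 - q)\<^sup>2)" if "norm q < 1" for q :: 'a
    using that by simp
  from theta_sums[OF s1 geometric_theta_derivs(2)[OF q]]
  have s2: "(\<lambda>n. (of_nat n * (of_nat n * 1)) * q ^ n) sums (q * (1 + q) / (1 - q) ^ 3)" if "norm q < 1" for q :: 'a
    using that by simp
  from theta_sums[OF s2 geometric_theta_derivs(3)[OF q]]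
  have "(\<lambda>n. (of_nat n * (of_nat n * (of_nat n * 1))) * q ^ n) sums (q * (1 + 4 * q + q\<^sup>2) / (1 - q) ^ 4)"
    using assms by simp
  then show ?thesis by (simp add: power3_eq_cube mult_ac)
qed

text \<open>At z = 1/2 the nome is -1 and the reflection formula gives
  \<open>Polygamma 3 (1 / 2) = pi^4\<close>, hence pi^4 / 96 for the sum over odd numbers. The even
  terms make up 1/16 of the whole sum Z, so Z - pi^4 / 96 = Z / 16.\<close>

lemma zeta_4: "(\<lambda>n. 1 / of_nat (Suc n) ^ 4) sums (of_real pi ^ 4 / 90 :: complex)"
proof -
  have half: "1 / 2 \<notin> (\<int> :: complex set)"
    using fraction_not_in_Ints[where 'a = complex, of 2 1] by simp
  have "nome (1 / 2) = -1" by (simp add: nome_def)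
  then have "Polygamma 3 (1 / 2) + Polygamma 3 (1 / 2) = (2 * of_real pi ^ 4 :: complex)"
    using Polygamma_3_reflection[OF half] by simp
  then have P: "Polygamma 3 (1 / 2 :: complex) = of_real pi ^ 4" by simp
  have "(\<lambda>k. inverse ((1 / 2 + of_nat k) ^ Suc 3)) sums ((-1) ^ Suc 3 * Polygamma 3 (1 / 2 :: complex) / fact 3)"
    by (rule Polygamma_LIMSEQ) auto
  then have "(\<lambda>k. 1 / 16 * inverse ((1 / 2 + of_nat k) ^ Suc 3)) sums
      (1 / 16 * ((-1) ^ Suc 3 * Polygamma 3 (1 / 2 :: complex) / fact 3))"
    by (rule sums_mult)
  moreover have "1 / 16 * inverse ((1 / 2 + of_nat k) ^ Suc 3) = (1 / of_nat (2 * k + 1) ^ 4 :: complex)" for k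
  proof -
    have "(2 * (1 / 2 + of_nat k) :: complex) = of_nat (2 * k + 1)" by (simp add: algebra_simps)
    then have "of_nat (2 * k + 1) ^ 4 = (2 * (1 / 2 + of_nat k) :: complex) ^ 4" by (simp only:)
    also have "\<dots> = 16 * (1 / 2 + of_nat k) ^ Suc 3" unfolding power_mult_distrib by simp
    finally show ?thesis by (simp only: inverse_eq_divide) simp
  qed
  ultimately have odd: "(\<lambda>k. 1 / of_nat (2 * k + 1) ^ 4) sums (of_real pi ^ 4 / 96 :: complex)"
    by (simp add: P fact_numeral)
  have "summable (\<lambda>n. inverse (of_nat (Suc n) ^ 4 :: complex))"
    using inverse_power_summable[of 4, where 'a = complex] by (subst summable_Suc_iff) simp
  then obtain Z where Z: "(\<lambda>n. 1 / of_nat (Suc n) ^ 4) sums (Z :: complex)"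
    by (auto simp: summable_def inverse_eq_divide)
  from sums_group[OF this, of 2]
  have "(\<lambda>k. 1 / of_nat (2 * k + 1) ^ 4 + 1 / of_nat (2 * k + 2) ^ 4) sums Z"
    by (simp add: numeral_2_eq_2 mult.commute)
  from sums_diff[OF this odd]
  have even: "(\<lambda>k. 1 / of_nat (2 * k + 2) ^ 4) sums (Z - of_real pi ^ 4 / 96)"
    by (simp only: add_diff_cancel_left')
  have "1 / of_nat (2 * k + 2) ^ 4 = (1 / 16) * (1 / of_nat (Suc k) ^ 4 :: complex)" for k
  proof -
    have "of_nat (2 * k + 2) = (2 * of_nat (Suc k) :: complex)" by simp
    then show ?thesis by (simp only: power_mult_distrib) simp
  qed
  with even have "(\<lambda>k. (1 / 16) * (1 / of_nat (Suc k) ^ 4)) sums (Z - of_real pi ^ 4 / 96)"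
    by (simp only:)
  moreover have "(\<lambda>k. (1 / 16) * (1 / of_nat (Suc k) ^ 4)) sums ((1 / 16) * Z)"
    using Z by (rule sums_mult)
  ultimately have "Z - of_real pi ^ 4 / 96 = (1 / 16) * Z" by (rule sums_unique2)
  then have "Z = of_real pi ^ 4 / 90" by (simp add: field_simps)
  with Z show ?thesis by simp
qed

section \<open>Summation along the rows of the lattice\<close>

lemma nome_norm: "cmod (nome z) = exp (- (2 * pi * Im z))"
  by (simp add: nome_def)

lemma nome_norm_less_1: "z \<in> \<H> \<Longrightarrow> cmod (nome z) < 1"
  by (simp add: nome_norm in_upper_half_plane_iff)

lemma nome_of_nat_mult: "nome (of_nat k * z) = nome z ^ k"
  by (simp add: nome_def exp_of_nat_mult[symmetric] mult_ac)

lemma infsum_int_split: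
  fixes f :: "int \<Rightarrow> 'a :: banach"
  assumes "f summable_on UNIV"
  shows "infsum f UNIV = (\<Sum>\<^sub>\<infinity>n. f (int n)) + (\<Sum>\<^sub>\<infinity>n. f (- int (Suc n)))"
proof -
  have "x \<in> range int \<union> range (\<lambda>n. - int (Suc n))" for x
    by (cases x rule: int_cases) auto
  then have "infsum f UNIV = infsum f (range int \<union> range (\<lambda>n. - int (Suc n)))"
    by (metis UNIV_eq_I)
  also have "\<dots> = infsum f (range int) + infsum f (range (\<lambda>n. - int (Suc n)))"
    by (intro infsum_Un_disjoint summable_on_subset_banach[OF assms]) auto
  also have "\<dots> = (\<Sum>\<^sub>\<infinity>n. f (int n)) + (\<Sum>\<^sub>\<infinity>n. f (- int (Suc n)))"
    by (simp add: infsum_reindex inj_on_def o_def)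
  finally show ?thesis .
qed

lemma infsum_nat_split:
  fixes f :: "nat \<Rightarrow> 'a :: banach"
  assumes "f summable_on UNIV"
  shows "infsum f UNIV = f 0 + (\<Sum>\<^sub>\<infinity>n. f (Suc n))"
proof -
  have "infsum f UNIV = infsum f ({0} \<union> range Suc)"
    by (metis UNIV_nat_eq insert_is_Un)
  also have "\<dots> = infsum f {0} + infsum f (range Suc)"
    by (intro infsum_Un_disjoint summable_on_subset_banach[OF assms]) auto
  also have "\<dots> = f 0 + (\<Sum>\<^sub>\<infinity>n. f (Suc n))"
    by (simp add: infsum_reindex inj_on_def o_def)
  finally show ?thesis .
qed

lemma infsum_eq_sums:
  fixes f :: "nat \<Rightarrow> 'a :: banach"
  assumes "f summable_on UNIV" "f sums s"
  shows "infsum f UNIV = s"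
  using assms by (meson has_sum_imp_sums has_sum_infsum sums_unique2)

lemma lattice_row_summable:
  assumes "z \<in> \<H>"
  shows "(\<lambda>d::int. 1 / ((z + of_int d)\<^sup>2)\<^sup>2) summable_on UNIV"
proof -
  have "(\<lambda>x. 1 / (lattice_pt x z)\<^sup>2 ^ 2) summable_on (range (Pair 1))"
    by (rule abs_summable_summable[OF lattice_sum_abs_summable[OF assms]]) auto
  then have "((\<lambda>x. 1 / (lattice_pt x z)\<^sup>2 ^ 2) \<circ> Pair 1) summable_on UNIV"
    by (subst (asm) summable_on_reindex) (auto simp: inj_on_def)
  then show ?thesis by (simp add: o_def lattice_pt_def)
qed

text \<open>The terms with d = - (k + 1) equal (1 - z + k)^(-4), so the two halves of the row are
  polygamma series at \<open>z\<close> and \<open>1 - z\<close>. The constant is (2 pi)^4 /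
  3!.\<close>

lemma lattice_row_sum:
  assumes "z \<in> \<H>"
  shows "(\<Sum>\<^sub>\<infinity>d::int. 1 / ((z + of_int d)\<^sup>2)\<^sup>2) =
           8 * of_real pi ^ 4 / 3 * (nome z * (1 + 4 * nome z + (nome z)\<^sup>2) / (1 - nome z) ^ 4)"
proof -
  have z: "z \<notin> \<int>" using assms by (auto simp: in_upper_half_plane_iff elim!: Ints_cases)
  note s = lattice_row_summable[OF assms]
  have "(\<lambda>d::int. 1 / ((z + of_int d)\<^sup>2)\<^sup>2) summable_on (range int)"
    "(\<lambda>d::int. 1 / ((z + of_int d)\<^sup>2)\<^sup>2) summable_on (range (\<lambda>n. - int (Suc n)))"
    by (rule summable_on_subset_banach[OF s], simp)+
  then have s1: "(\<lambda>n. 1 / ((z + of_int (int n))\<^sup>2)\<^sup>2) summable_on UNIV"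
    and s2: "(\<lambda>n. 1 / ((z + of_int (- int (Suc n)))\<^sup>2)\<^sup>2) summable_on UNIV"
    using summable_on_reindex[of int UNIV "\<lambda>d. 1 / ((z + of_int d)\<^sup>2)\<^sup>2"]
      summable_on_reindex[of "\<lambda>n. - int (Suc n)" UNIV "\<lambda>d. 1 / ((z + of_int d)\<^sup>2)\<^sup>2"]
    by (auto simp: inj_on_def o_def)
  have "(\<lambda>k. inverse ((z + of_nat k) ^ Suc 3)) sums ((-1) ^ Suc 3 * Polygamma 3 z / fact 3)"
    using z by (intro Polygamma_LIMSEQ) auto
  then have 1: "(\<Sum>\<^sub>\<infinity>n. 1 / ((z + of_int (int n))\<^sup>2)\<^sup>2) = Polygamma 3 z / 6"
    by (intro infsum_eq_sums[OF s1]) (simp add: fact_numeral inverse_eq_divide flip: power_mult)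
  have "(\<lambda>k. inverse ((1 - z + of_nat k) ^ Suc 3)) sums ((-1) ^ Suc 3 * Polygamma 3 (1 - z) / fact 3)"
    using z by (intro Polygamma_LIMSEQ) auto
  moreover have "(1 - z + of_nat k)\<^sup>2 = (z + of_int (- int (Suc k)))\<^sup>2" for k
    by (simp add: power2_eq_square algebra_simps)
  moreover have "(1 - z + of_nat k) ^ Suc 3 = ((1 - z + of_nat k)\<^sup>2)\<^sup>2" for k
    by (simp flip: power_mult)
  ultimately have 2: "(\<Sum>\<^sub>\<infinity>n. 1 / ((z + of_int (- int (Suc n)))\<^sup>2)\<^sup>2) = Polygamma 3 (1 - z) / 6"
    by (intro infsum_eq_sums[OF s2]) (simp add: fact_numeral inverse_eq_divide)
  have "(\<Sum>\<^sub>\<infinity>d::int. 1 / ((z + of_int d)\<^sup>2)\<^sup>2) = (Polygamma 3 z + Polygamma 3 (1 - z)) / 6"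
    using infsum_int_split[OF s] unfolding 1 2 by (simp add: add_divide_distrib)
  also have "\<dots> = 8 * of_real pi ^ 4 / 3 * (nome z * (1 + 4 * nome z + (nome z)\<^sup>2) / (1 - nome z) ^ 4)"
    unfolding Polygamma_3_reflection[OF z] power_mult_distrib by simp
  finally show ?thesis .
qed

section \<open>The Lambert series of sigma3\<close>

definition sigma3_double_term :: "complex \<Rightarrow> nat \<times> nat \<Rightarrow> complex" where
  "sigma3_double_term q = (\<lambda>(i, j). of_nat (Suc j) ^ 3 * (q ^ Suc i) ^ Suc j)"

lemma sigma3_double_summable:
  assumes "cmod q < 1"
  shows "sigma3_double_term q summable_on UNIV \<times> UNIV"
proof -
  define r where "r = cmod q"
  have r: "0 \<le> r" "r < 1" using assms by (auto simp: r_def)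
  define b where "b = (\<lambda>j. real (Suc j) ^ 3 * r ^ Suc j)"
  have "(\<lambda>n. real n ^ 3 * r ^ n) sums (r * (1 + 4 * r + r\<^sup>2) / (1 - r) ^ 4)"
    by (rule sum_cubes_geometric) (use r in auto)
  then have "summable (\<lambda>n. real n ^ 3 * r ^ n)" by (rule sums_summable)
  then have "summable b" unfolding b_def by (rule summable_Suc_iff[THEN iffD2])
  then have b: "b summable_on UNIV"
    using r by (intro summable_nonneg_imp_summable_on) (auto simp: b_def)
  have a: "((\<lambda>i. r ^ i) has_sum 1 / (1 - r)) UNIV"
    using r by (intro sums_nonneg_imp_has_sum geometric_sums) auto
  have "(\<lambda>(j, i). b j * r ^ i) summable_on Sigma UNIV (\<lambda>_. UNIV)"
  proof (rule summable_on_SigmaI)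
    show "((\<lambda>i. case (j, i) of (j, i) \<Rightarrow> b j * r ^ i) has_sum b j * (1 / (1 - r))) UNIV" for j
      using has_sum_cmult_right[OF a] by simp
    show "(\<lambda>j. b j * (1 / (1 - r))) summable_on UNIV" using b by (rule summable_on_cmult_left)
  qed (use r in \<open>auto simp: b_def\<close>)
  then have "(\<lambda>(i, j). b j * r ^ i) summable_on UNIV \<times> UNIV"
    by (subst summable_on_swap) simp
  then have "(\<lambda>x. norm (sigma3_double_term q x)) summable_on UNIV \<times> UNIV"
  proof (rule Infinite_Sum.abs_summable_on_comparison_test')
    fix x :: "nat \<times> nat"
    obtain i j where x: "x = (i, j)" by fastforce
    \<comment> \<open>Bounding the product of the indices below by their sum decouples the two
      summations.\<close>
    have "Suc j + i \<le> Suc i * Suc j" by simp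
    then have "r ^ (Suc i * Suc j) \<le> r ^ (Suc j + i)" using r by (intro power_decreasing) auto
    then have "real (Suc j) ^ 3 * r ^ (Suc i * Suc j) \<le> real (Suc j) ^ 3 * r ^ (Suc j + i)"
      by (intro mult_left_mono) auto
    moreover have "norm (sigma3_double_term q x) = real (Suc j) ^ 3 * r ^ (Suc i * Suc j)"
      unfolding sigma3_double_term_def x prod.case norm_mult norm_power norm_of_nat r_def power_mult ..
    ultimately show "norm (sigma3_double_term q x) \<le> (case x of (i, j) \<Rightarrow> b j * r ^ i)"
      unfolding x b_def prod.case by (simp only: power_add mult_ac)
  qed
  then show ?thesis by (rule abs_summable_summable)
qed

text \<open>One double series is summed in two ways: over \<open>j\<close> first, where
  \<open>sum_cubes_geometric\<close> gives the closed form, and grouped by m + 1 = (i + 1) (j + 1)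
  with divisor d = j + 1.\<close>

lemma sigma3_has_sum:
  assumes "cmod q < 1"
  shows "((\<lambda>m. of_nat (sigma3 (Suc m)) * q ^ Suc m) has_sum
           (\<Sum>\<^sub>\<infinity>i. q ^ Suc i * (1 + 4 * q ^ Suc i + (q ^ Suc i)\<^sup>2) / (1 - q ^ Suc i) ^ 4)) UNIV"
proof -
  have summ: "sigma3_double_term q summable_on UNIV \<times> UNIV" by (rule sigma3_double_summable[OF assms])
  have inner: "((\<lambda>j. sigma3_double_term q (i, j)) has_sum
      q ^ Suc i * (1 + 4 * q ^ Suc i + (q ^ Suc i)\<^sup>2) / (1 - q ^ Suc i) ^ 4) UNIV" for i
  proof -
    have "cmod (q ^ Suc i) \<le> cmod q ^ 1"
      unfolding norm_power using assms by (intro power_decreasing) auto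
    then have "cmod (q ^ Suc i) < 1" using assms by simp
    from sum_cubes_geometric[OF this]
    have "(\<lambda>j. sigma3_double_term q (i, j)) sums (q ^ Suc i * (1 + 4 * q ^ Suc i + (q ^ Suc i)\<^sup>2) / (1 - q ^ Suc i) ^ 4)"
      unfolding sigma3_double_term_def prod.case by (subst sums_Suc_iff) simp
    moreover have "(\<lambda>j. sigma3_double_term q (i, j)) summable_on UNIV"
      using summable_on_SigmaD1[of "\<lambda>i j. sigma3_double_term q (i, j)" UNIV "\<lambda>_. UNIV" i] summ by simp
    ultimately show ?thesis by (metis has_sum_infsum infsum_eq_sums)
  qed
  define S where "S = infsum (sigma3_double_term q) (UNIV \<times> UNIV)"
  have S: "(sigma3_double_term q has_sum S) (UNIV \<times> UNIV)"
    unfolding S_def by (rule has_sum_infsum[OF summ])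
  have "((\<lambda>i. q ^ Suc i * (1 + 4 * q ^ Suc i + (q ^ Suc i)\<^sup>2) / (1 - q ^ Suc i) ^ 4) has_sum S) UNIV"
    by (rule has_sum_SigmaD[OF S inner])
  then have S_eq: "(\<Sum>\<^sub>\<infinity>i. q ^ Suc i * (1 + 4 * q ^ Suc i + (q ^ Suc i)\<^sup>2) / (1 - q ^ Suc i) ^ 4) = S"
    by (rule infsumI)
  have "(sigma3_double_term q has_sum S) (UNIV \<times> UNIV) \<longleftrightarrow>
      ((\<lambda>(m, d). of_nat d ^ 3 * q ^ Suc m) has_sum S) (Sigma UNIV (\<lambda>m. {d. d dvd Suc m}))"
  proof (rule has_sum_reindex_bij_witness[where i = "\<lambda>(m, d). (Suc m div d - 1, d - 1)"
        and j = "\<lambda>(i, j). (Suc i * Suc j - 1, Suc j)"])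
    fix a :: "nat \<times> nat" 
    obtain i j where a: "a = (i, j)" by fastforce
    have "Suc (Suc i * Suc j - 1) = Suc i * Suc j" by simp
    then show "(case (case a of (i, j) \<Rightarrow> (Suc i * Suc j - 1, Suc j)) of (m, d) \<Rightarrow> (Suc m div d - 1, d - 1)) = a"
      "(case a of (i, j) \<Rightarrow> (Suc i * Suc j - 1, Suc j)) \<in> Sigma UNIV (\<lambda>m. {d. d dvd Suc m})"
      "(case case a of (i, j) \<Rightarrow> (Suc i * Suc j - 1, Suc j) of (m, d) \<Rightarrow> of_nat d ^ 3 * q ^ Suc m) = sigma3_double_term q a"
      unfolding a prod.case sigma3_double_term_def
      by (simp_all del: mult_Suc mult_Suc_right of_nat_Suc power_Suc add: power_mult)
  next
    fix b :: "nat \<times> nat" assume b: "b \<in> Sigma UNIV (\<lambda>m. {d. d dvd Suc m})"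
    obtain m d where md: "b = (m, d)" by fastforce
    then have "d dvd Suc m" using b by simp
    then obtain e where e: "Suc m = d * e" by (elim dvdE)
    then have de: "d > 0" "e > 0" by (auto intro!: Nat.gr0I)
    then have "Suc m div d = e" "Suc (e - 1) = e" "Suc (d - 1) = d" using e by simp_all
    moreover have "m = e * d - 1" using e by (metis diff_Suc_1 mult.commute)
    ultimately show "(case (case b of (m, d) \<Rightarrow> (Suc m div d - 1, d - 1)) of (i, j) \<Rightarrow> (Suc i * Suc j - 1, Suc j)) = b"
      unfolding md prod.case by (simp only:)
  qed auto
  with S have "((\<lambda>(m, d). of_nat d ^ 3 * q ^ Suc m) has_sum S) (Sigma UNIV (\<lambda>m. {d. d dvd Suc m}))"
    by blast
  moreover have "((\<lambda>d. case (m, d) of (m, d) \<Rightarrow> of_nat d ^ 3 * q ^ Suc m) has_sum of_nat (sigma3 (Suc m)) * q ^ Suc m)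
      {d. d dvd Suc m}" for m
    by (rule has_sum_finiteI) (simp_all add: sigma3_def sum_distrib_right)
  ultimately have "((\<lambda>m. of_nat (sigma3 (Suc m)) * q ^ Suc m) has_sum S) UNIV"
    by (rule has_sum_SigmaD)
  then show ?thesis unfolding S_eq .
qed

lemma Eisenstein_E4_nome:
  "Eisenstein_E4 z = 1 + 240 * (\<Sum>m. of_nat (sigma3 (Suc m)) * nome z ^ Suc m)"
proof -
  have "exp (2 * of_real pi * \<i> * of_nat (Suc m) * z) = nome z ^ Suc m" for m
    unfolding nome_def exp_of_nat_mult[symmetric] by (simp only: mult_ac)
  then show ?thesis unfolding Eisenstein_E4_def by (simp only:)
qed

section \<open>The Eisenstein series as a lattice sum\<close>

abbreviation full_lattice :: "(int \<times> int) set" where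
  "full_lattice \<equiv> UNIV - {(0, 0)}"

text \<open>Summation by rows. Row 0 gives 2 zeta(4) = pi^4 / 45, opposite rows agree, and row c > 0
  is \<open>lattice_row_sum\<close> at c z. The coefficient 240 arises as 2 (8 pi^4 / 3) / (pi^4 /
  45).\<close>

lemma Eisenstein_E4_lattice_sum:
  assumes z: "z \<in> \<H>"
  shows "lattice_sum full_lattice 2 z = of_real pi ^ 4 / 45 * Eisenstein_E4 z"
proof -
  define C where "C = (\<lambda>q::complex. q * (1 + 4 * q + q\<^sup>2) / (1 - q) ^ 4)"
  define A :: "int \<Rightarrow> int set" where "A = (\<lambda>c. if c = 0 then UNIV - {0} else UNIV)"
  define f where "f = (\<lambda>x. 1 / (lattice_pt x z)\<^sup>2 ^ 2)"
  define T where "T = (\<lambda>c. \<Sum>\<^sub>\<infinity>d\<in>A c. f (c, d))"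
  have full: "full_lattice = Sigma UNIV A" by (auto simp: A_def split: if_splits)
  have "f summable_on full_lattice"
    unfolding f_def by (rule abs_summable_summable[OF lattice_sum_abs_summable[OF z]]) auto
  then have summ: "f summable_on (Sigma UNIV A)" by (simp only: full)
  have eq: "lattice_sum full_lattice 2 z = infsum T UNIV"
    unfolding lattice_sum_def full T_def using infsum_Sigma_banach[OF summ] by (simp add: f_def)
  have Tsum: "T summable_on UNIV"
    unfolding T_def using summ by (rule summable_on_Sigma_banach[of "\<lambda>x y. f (x, y)", simplified])
  have pos: "T (int (Suc i)) = 8 * of_real pi ^ 4 / 3 * C (nome z ^ Suc i)" for i
  proof -
    have "of_nat (Suc i) * z \<in> \<H>" using z by (simp add: in_upper_half_plane_iff)
    from lattice_row_sum[OF this] show ?thesis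
      by (simp only: T_def A_def f_def C_def lattice_pt_def nome_of_nat_mult) simp
  qed
  have neg: "T (- int (Suc i)) = T (int (Suc i))" for i
  proof -
    have "T (- int (Suc i)) = (\<Sum>\<^sub>\<infinity>d. f (- int (Suc i), - d))"
      using infsum_reindex_bij_betw[OF bij_uminus, of "\<lambda>d::int. f (- int (Suc i), d)"]
      by (simp add: T_def A_def del: of_nat_Suc)
    also have "f (- int (Suc i), - d) = f (int (Suc i), d)" for d
    proof -
      have "lattice_pt (- int (Suc i), - d) z = - lattice_pt (int (Suc i), d) z"
        by (simp add: lattice_pt_def algebra_simps)
      then show ?thesis by (simp only: f_def power2_minus)
    qed
    then have "(\<Sum>\<^sub>\<infinity>d. f (- int (Suc i), - d)) = T (int (Suc i))" unfolding T_def A_def by simp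
    finally show ?thesis .
  qed
  have zero: "T 0 = of_real pi ^ 4 / 45"
  proof -
    have R: "UNIV - {0} = range (\<lambda>n. int (Suc n)) \<union> range (\<lambda>n. - int (Suc n))"
    proof (rule set_eqI)
      fix x :: int
      have "x \<in> range (\<lambda>n. int (Suc n))" if "x > 0"
        by (rule range_eqI[of _ _ "nat (x - 1)"]) (use that in simp)
      moreover have "x \<in> range (\<lambda>n. - int (Suc n))" if "x < 0"
        by (rule range_eqI[of _ _ "nat (- x - 1)"]) (use that in simp)
      ultimately have "x \<in> range (\<lambda>n. int (Suc n)) \<union> range (\<lambda>n. - int (Suc n))" if "x \<noteq> 0"
        using that by (meson UnI1 UnI2 linorder_neqE_linordered_idom)
      then show "x \<in> UNIV - {0} \<longleftrightarrow> x \<in> range (\<lambda>n. int (Suc n)) \<union> range (\<lambda>n. - int (Suc n))"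
        by auto
    qed
    have s: "(\<lambda>n. 1 / of_nat (Suc n) ^ 4 :: complex) summable_on UNIV"
    proof (rule norm_summable_imp_summable_on)
      have "summable (\<lambda>n. inverse (of_nat (Suc n) ^ 4 :: real))"
        using inverse_power_summable[of 4, where 'a = real] by (subst summable_Suc_iff) simp
      then show "summable (\<lambda>n. norm (1 / of_nat (Suc n) ^ 4 :: complex))"
        by (simp add: norm_divide norm_power inverse_eq_divide del: of_nat_Suc)
    qed
    have f1: "f (0, int (Suc n)) = 1 / of_nat (Suc n) ^ 4" "f (0, - int (Suc n)) = 1 / of_nat (Suc n) ^ 4" for n
      by (simp_all add: f_def lattice_pt_def del: of_nat_Suc flip: power_mult)
    have r1: "infsum (\<lambda>d. f (0, d)) (range (\<lambda>n. int (Suc n))) = (\<Sum>\<^sub>\<infinity>n. f (0, int (Suc n)))"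
      "infsum (\<lambda>d. f (0, d)) (range (\<lambda>n. - int (Suc n))) = (\<Sum>\<^sub>\<infinity>n. f (0, - int (Suc n)))"
      by (subst infsum_reindex; simp add: inj_on_def o_def)+
    have "(\<lambda>d. f (0, d)) summable_on (range (\<lambda>n. int (Suc n)))" "(\<lambda>d. f (0, d)) summable_on (range (\<lambda>n. - int (Suc n)))"
      by (subst summable_on_reindex; use s f1 in \<open>simp add: inj_on_def o_def del: of_nat_Suc\<close>)+
    then have "T 0 = (\<Sum>\<^sub>\<infinity>n. f (0, int (Suc n))) + (\<Sum>\<^sub>\<infinity>n. f (0, - int (Suc n)))"
      unfolding T_def A_def if_P[OF refl] R r1[symmetric] by (intro infsum_Un_disjoint) auto
    also have "\<dots> = of_real pi ^ 4 / 90 + of_real pi ^ 4 / 90"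
      unfolding f1 infsum_eq_sums[OF s zeta_4] ..
    finally show ?thesis by simp
  qed
  have q: "cmod (nome z) < 1" using z by (rule nome_norm_less_1)
  have E4: "(\<Sum>\<^sub>\<infinity>i. C (nome z ^ Suc i)) = (\<Sum>m. of_nat (sigma3 (Suc m)) * nome z ^ Suc m)"
    using has_sum_imp_sums[OF sigma3_has_sum[OF q]] by (simp only: sums_iff C_def)
  have "T summable_on range int" using Tsum by (rule summable_on_subset_banach) simp
  then have "(\<lambda>n. T (int n)) summable_on UNIV" by (subst (asm) summable_on_reindex) (auto simp: inj_on_def o_def)
  then have "infsum T UNIV = T 0 + (\<Sum>\<^sub>\<infinity>n. T (int (Suc n))) + (\<Sum>\<^sub>\<infinity>n. T (- int (Suc n)))"
    unfolding infsum_int_split[OF Tsum] by (subst infsum_nat_split) auto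
  also have "\<dots> = of_real pi ^ 4 / 45 + 2 * (8 * of_real pi ^ 4 / 3 * (\<Sum>\<^sub>\<infinity>i. C (nome z ^ Suc i)))"
    unfolding neg pos zero infsum_cmult_right' by simp
  also have "\<dots> = of_real pi ^ 4 / 45 * Eisenstein_E4 z"
    unfolding E4 Eisenstein_E4_nome by (simp add: algebra_simps)
  finally show ?thesis unfolding eq .
qed

lemma row_act_full:
  assumes "A \<in> SL2Z"
  shows "row_act A ` full_lattice = full_lattice"
proof -
  have "bij (row_act A)"
    by (rule o_bij[of "row_act (sl2_inv A)"]) (use assms in \<open>auto simp: row_act_inv o_def fun_eq_iff\<close>)
  then have "row_act A ` full_lattice = row_act A ` UNIV - row_act A ` {(0, 0)}"
    by (simp add: image_set_diff bij_is_inj)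
  also have "\<dots> = full_lattice"
    using \<open>bij (row_act A)\<close> by (simp only: bij_is_surj) (simp add: row_act_def)
  finally show ?thesis .
qed

lemma Eisenstein_E4_modular:
  assumes "A \<in> SL2Z" "z \<in> \<H>"
  shows "Eisenstein_E4 (modular_act A z) = aut_factor A z ^ 4 * Eisenstein_E4 z"
proof -
  have "lattice_sum full_lattice 2 (modular_act A z) =
      (aut_factor A z)\<^sup>2 ^ 2 * lattice_sum full_lattice 2 z"
    using lattice_sum_modular_act[OF assms, of full_lattice 2] by (simp add: row_act_full[OF assms(1)])
  then have "of_real pi ^ 4 / 45 * Eisenstein_E4 (modular_act A z) =
      of_real pi ^ 4 / 45 * (aut_factor A z ^ 4 * Eisenstein_E4 z)"
    using assms by (simp add: Eisenstein_E4_lattice_sum modular_act_in_upper_half_plane mult_ac flip: power_mult)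
  then show ?thesis by simp
qed

text \<open>The tail \<open>(Eisenstein_E4 - 1) / (240 * nome)\<close> as a function of the nome.\<close>

definition sigma3_series :: "complex \<Rightarrow> complex" where
  "sigma3_series q = (\<Sum>m. of_nat (sigma3 (Suc m)) * q ^ m)"

lemma sigma3_series_sums:
  assumes "cmod q < 1"
  shows "(\<lambda>m. of_nat (sigma3 (Suc m)) * q ^ m) sums sigma3_series q"
proof (cases "q = 0")
  case True
  then show ?thesis unfolding sigma3_series_def
    by (intro summable_sums) (auto intro: summable_finite[of "{0}"])
next
  case False
  have "(\<lambda>m. q * (of_nat (sigma3 (Suc m)) * q ^ m)) sums
      (\<Sum>\<^sub>\<infinity>i. q ^ Suc i * (1 + 4 * q ^ Suc i + (q ^ Suc i)\<^sup>2) / (1 - q ^ Suc i) ^ 4)"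
    using has_sum_imp_sums[OF sigma3_has_sum[OF assms]] by (simp add: mult_ac)
  then have "summable (\<lambda>m. q * (of_nat (sigma3 (Suc m)) * q ^ m))" by (rule sums_summable)
  then have "summable (\<lambda>m. of_nat (sigma3 (Suc m)) * q ^ m)"
    using False by (simp only: summable_cmult_iff) simp
  then show ?thesis unfolding sigma3_series_def by (rule summable_sums)
qed

lemma sigma3_series_holomorphic: "sigma3_series holomorphic_on ball 0 1"
  by (rule power_series_holomorphic) (use sigma3_series_sums in auto)

lemma Eisenstein_E4_sigma3_series:
  assumes "z \<in> \<H>"
  shows "Eisenstein_E4 z = 1 + 240 * nome z * sigma3_series (nome z)"
proof -
  have "(\<lambda>m. nome z * (of_nat (sigma3 (Suc m)) * nome z ^ m)) sums (nome z * sigma3_series (nome z))"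
    by (intro sums_mult sigma3_series_sums nome_norm_less_1 assms)
  then show ?thesis unfolding Eisenstein_E4_nome by (simp add: sums_iff mult_ac)
qed

subsection \<open>Modular functions from lattice sums\<close>

definition cusp_coord :: "nat \<Rightarrow> complex \<Rightarrow> complex" where
  "cusp_coord n z = exp (2 * of_real pi * \<i> * z / of_nat n)"

lemma cusp_coord_nonzero [simp]: "cusp_coord n z \<noteq> 0"
  by (simp add: cusp_coord_def)

lemma cusp_coord_norm: "cmod (cusp_coord n z) = exp (- (2 * pi * Im z / real n))"
  by (simp add: cusp_coord_def)

lemma cusp_coord_less_1: "n > 0 \<Longrightarrow> z \<in> \<H> \<Longrightarrow> cmod (cusp_coord n z) < 1"
  by (simp add: cusp_coord_norm in_upper_half_plane_iff)

lemma cusp_coord_eq_iff: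
  assumes "n > 0"
  shows "cusp_coord n z = cusp_coord n w \<longleftrightarrow> (\<exists>k::int. z = w + of_nat n * of_int k)"
proof -
  have "cusp_coord n z = cusp_coord n w \<longleftrightarrow>
      (\<exists>k::int. 2 * of_real pi * \<i> * z / of_nat n = 2 * of_real pi * \<i> * w / of_nat n + of_int (2 * k) * of_real pi * \<i>)"
    unfolding cusp_coord_def by (simp add: exp_eq)
  also have "\<dots> \<longleftrightarrow> (\<exists>k::int. z = w + of_nat n * of_int k)"
  proof (rule arg_cong[where f = Ex], rule ext)
    fix k :: int
    have "2 * of_real pi * \<i> * z / of_nat n = 2 * of_real pi * \<i> * w / of_nat n + of_int (2 * k) * of_real pi * \<i>
      \<longleftrightarrow> (2 * of_real pi * \<i> / of_nat n) * z = (2 * of_real pi * \<i> / of_nat n) * (w + of_nat n * of_int k)"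
      using assms by (simp add: field_simps)
    also have "\<dots> \<longleftrightarrow> z = w + of_nat n * of_int k" using assms by simp
    finally show "(2 * of_real pi * \<i> * z / of_nat n = 2 * of_real pi * \<i> * w / of_nat n + of_int (2 * k) * of_real pi * \<i>)
      = (z = w + of_nat n * of_int k)" .
  qed
  finally show ?thesis .
qed

lemma cusp_coord_log:
  assumes "n > 0" "exp l = q"
  shows "cusp_coord n (of_nat n * l / (2 * of_real pi * \<i>)) = q"
  using assms by (simp add: cusp_coord_def)

lemma cusp_coord_preimage_in:
  assumes "n > 0" "cusp_coord n z = q" "cmod q < 1"
  shows "z \<in> \<H>"
proof -
  have "exp (- (2 * pi * Im z / real n)) < 1" using assms by (metis cusp_coord_norm)
  then have "2 * pi * Im z / real n > 0" by simp
  then show ?thesis using assms(1) by (simp add: in_upper_half_plane_iff zero_less_divide_iff zero_less_mult_iff)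
qed

lemma cusp_coord_surj:
  assumes "n > 0" "q \<noteq> 0" "cmod q < 1"
  obtains z where "z \<in> \<H>" "cusp_coord n z = q"
  using cusp_coord_log[OF assms(1), of "Ln q" q] assms cusp_coord_preimage_in[OF assms(1) _ assms(3)] by auto

lemma cusp_coord_altdef: "cusp_coord n z = exp (2 * of_real pi * \<i> / of_nat n * z)"
  by (simp add: cusp_coord_def)

lemma cusp_coord_has_field_derivative:
  "(cusp_coord n has_field_derivative 2 * of_real pi * \<i> / of_nat n * cusp_coord n z) (at z within S)"
proof -
  have "((\<lambda>z. exp (c * z)) has_field_derivative c * exp (c * z)) (at z within S)" for c :: complex
    by (auto intro!: derivative_eq_intros)
  then show ?thesis unfolding cusp_coord_altdef[abs_def] .
qed

lemma cusp_coord_holomorphic: "cusp_coord n holomorphic_on S"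
  unfolding holomorphic_on_def field_differentiable_def using cusp_coord_has_field_derivative by blast

lemma nome_eq_cusp_coord: "n > 0 \<Longrightarrow> nome z = cusp_coord n z ^ n"
  by (simp add: nome_def cusp_coord_def exp_of_nat_mult[symmetric])

lemma periodic_int:
  assumes "\<And>z. z \<in> \<H> \<Longrightarrow> h (z + of_nat n) = h z" "z \<in> \<H>"
  shows "h (z + of_nat n * of_int k) = h z"
proof -
  have *: "h (w + of_nat n * of_nat m) = h w" if "w \<in> \<H>" for w m
  proof (induction m)
    case (Suc m)
    have "w + of_nat n * of_nat m \<in> \<H>" using that by (simp add: in_upper_half_plane_iff)
    from assms(1)[OF this] Suc show ?case by (simp add: algebra_simps)
  qed simp
  show ?thesis
  proof (cases "k \<ge> 0")
    case True
    then show ?thesis using *[OF assms(2), of "nat k"] by simp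
  next
    case False
    have "z + of_nat n * of_int k \<in> \<H>" using assms(2) by (simp add: in_upper_half_plane_iff)
    from *[OF this, of "nat (- k)"] False show ?thesis by simp
  qed
qed

text \<open>Compose \<open>h\<close> with a logarithm; by periodicity the choice of branch is
  immaterial, so the result is holomorphic on the punctured disc. The bound on a half-strip becomes
  a bound near 0, and Riemann's theorem removes the singularity.\<close>

lemma periodic_bounded_factor:
  assumes n: "n > 0" and holo: "h holomorphic_on \<H>"
    and per: "\<And>z. z \<in> \<H> \<Longrightarrow> h (z + of_nat n) = h z"
    and bdd: "\<And>z. Im z \<ge> 1 \<Longrightarrow> \<bar>Re z\<bar> \<le> real n \<Longrightarrow> cmod (h z) \<le> C"
  obtains F where "F holomorphic_on ball 0 1" "\<And>z. z \<in> \<H> \<Longrightarrow> h z = F (cusp_coord n z)"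
proof -
  define lg where "lg = (\<lambda>l::complex. of_nat n * l / (2 * of_real pi * \<i>))"
  define F where "F = (\<lambda>q. h (lg (Ln q)))"
  have inH: "lg l \<in> \<H>" if "exp l = q" "cmod q < 1" for l q
    using cusp_coord_preimage_in[OF n cusp_coord_log[OF n that(1)] that(2)] by (simp add: lg_def)
  have F: "F q = h z" if "cusp_coord n z = q" "cmod q < 1" for z q
  proof -
    have z: "z \<in> \<H>" using cusp_coord_preimage_in[OF n that] .
    have "q \<noteq> 0" using that(1) cusp_coord_nonzero by blast
    then have "cusp_coord n (lg (Ln q)) = cusp_coord n z"
      using cusp_coord_log[OF n, of "Ln q" q] that(1) by (simp add: lg_def)
    then obtain k :: int where "lg (Ln q) = z + of_nat n * of_int k"
      using cusp_coord_eq_iff[OF n] by blast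
    then show ?thesis unfolding F_def using periodic_int[where h = h and n = n, OF per z] by simp
  qed
  have 1: "F holomorphic_on ball 0 1 - \<real>\<^sub>\<le>\<^sub>0"
  proof -
    have "(h \<circ> (\<lambda>q. lg (Ln q))) holomorphic_on ball 0 1 - \<real>\<^sub>\<le>\<^sub>0"
    proof (rule holomorphic_on_compose_gen[OF _ holo])
      show "(\<lambda>q. lg (Ln q)) holomorphic_on ball 0 1 - \<real>\<^sub>\<le>\<^sub>0"
        unfolding lg_def by (intro holomorphic_intros) auto
      show "(\<lambda>q. lg (Ln q)) ` (ball 0 1 - \<real>\<^sub>\<le>\<^sub>0) \<subseteq> \<H>"
      proof (rule image_subsetI)
        fix q :: complex assume q: "q \<in> ball 0 1 - \<real>\<^sub>\<le>\<^sub>0"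
        then have "q \<noteq> 0" by auto
        then show "lg (Ln q) \<in> \<H>" using q by (intro inH[of _ q]) auto
      qed
    qed
    then show ?thesis by (simp add: F_def o_def)
  qed
  \<comment> \<open>The branch \<open>Ln (- q) + \<i> pi\<close> is holomorphic across the negative
    axis, where the first one jumps. The two slit discs cover the punctured disc.\<close>
  have 2: "F holomorphic_on ball 0 1 - \<real>\<^sub>\<ge>\<^sub>0"
  proof (rule holomorphic_transform)
    have neg: "exp (Ln (- q) + \<i> * of_real pi) = q" if "q \<noteq> 0" for q
      using that by (simp add: exp_add)
    have "(h \<circ> (\<lambda>q. lg (Ln (- q) + \<i> * of_real pi))) holomorphic_on ball 0 1 - \<real>\<^sub>\<ge>\<^sub>0"
    proof (rule holomorphic_on_compose_gen[OF _ holo])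
      have "- q \<notin> \<real>\<^sub>\<le>\<^sub>0" if "q \<in> ball 0 1 - \<real>\<^sub>\<ge>\<^sub>0" for q :: complex
        using that by (auto simp: complex_nonpos_Reals_iff complex_nonneg_Reals_iff)
      then show "(\<lambda>q. lg (Ln (- q) + \<i> * of_real pi)) holomorphic_on ball 0 1 - \<real>\<^sub>\<ge>\<^sub>0"
        unfolding lg_def by (intro holomorphic_intros) auto
      show "(\<lambda>q. lg (Ln (- q) + \<i> * of_real pi)) ` (ball 0 1 - \<real>\<^sub>\<ge>\<^sub>0) \<subseteq> \<H>"
      proof (rule image_subsetI)
        fix q :: complex assume q: "q \<in> ball 0 1 - \<real>\<^sub>\<ge>\<^sub>0"
        then have "q \<noteq> 0" by auto
        then show "lg (Ln (- q) + \<i> * of_real pi) \<in> \<H>" using q neg by (intro inH[of _ q]) auto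
      qed
    qed
    then show "(\<lambda>q. h (lg (Ln (- q) + \<i> * of_real pi))) holomorphic_on ball 0 1 - \<real>\<^sub>\<ge>\<^sub>0"
      by (simp add: o_def)
    fix q :: complex assume q: "q \<in> ball 0 1 - \<real>\<^sub>\<ge>\<^sub>0"
    then have "q \<noteq> 0" by auto
    then show "h (lg (Ln (- q) + \<i> * of_real pi)) = F q"
      using F[of "lg (Ln (- q) + \<i> * of_real pi)" q] cusp_coord_log[OF n neg] q by (simp add: lg_def)
  qed
  have "F holomorphic_on (ball 0 1 - \<real>\<^sub>\<le>\<^sub>0) \<union> (ball 0 1 - \<real>\<^sub>\<ge>\<^sub>0)"
    by (rule holomorphic_on_Un[OF 1 2]) (auto intro!: open_Diff)
  moreover have "(ball 0 1 - \<real>\<^sub>\<le>\<^sub>0) \<union> (ball 0 1 - \<real>\<^sub>\<ge>\<^sub>0) = ball (0::complex) 1 - {0}"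
    by (auto simp: complex_nonpos_Reals_iff complex_nonneg_Reals_iff complex_eq_iff)
  ultimately have F_holo: "F holomorphic_on ball 0 1 - {0}" by simp
  define \<rho> where "\<rho> = exp (- (2 * pi / real n))"
  have "\<rho> > 0" "\<rho> < 1" using n by (simp_all add: \<rho>_def)
  have bound: "cmod (F q) \<le> C" if "q \<noteq> 0" "cmod q < \<rho>" for q
    unfolding F_def
  proof (rule bdd)
    have "ln (cmod q) < ln \<rho>" using that \<open>\<rho> > 0\<close> by simp
    then have "- ln (cmod q) > 2 * pi / real n" by (simp add: \<rho>_def)
    moreover have "Im (lg (Ln q)) = real n * (- ln (cmod q)) / (2 * pi)"
      using that(1) by (simp add: lg_def Im_divide power2_eq_square field_simps)
    ultimately have "2 * pi * 1 < 2 * pi * Im (lg (Ln q))" using n by (simp add: field_simps)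
    then show "1 \<le> Im (lg (Ln q))" by (simp only: mult_less_cancel_left_pos pi_gt_zero zero_less_mult_iff zero_less_numeral simp_thms less_imp_le)
    have "\<bar>Im (Ln q)\<bar> \<le> pi" using mpi_less_Im_Ln[OF that(1)] Im_Ln_le_pi[OF that(1)] by linarith
    moreover have "Re (lg (Ln q)) = real n * (Im (Ln q) / (2 * pi))"
      by (simp add: lg_def Re_divide power2_eq_square field_simps)
    ultimately have "\<bar>Re (lg (Ln q))\<bar> = real n * (\<bar>Im (Ln q)\<bar> / (2 * pi))" "\<bar>Im (Ln q)\<bar> / (2 * pi) \<le> 1"
      by (simp_all add: abs_mult)
    then show "\<bar>Re (lg (Ln q))\<bar> \<le> real n" by (simp only: mult_left_le of_nat_0_le_iff)
  qed
  have "\<forall>\<^sub>F q in at 0. cmod (F q) \<le> C"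
    unfolding eventually_at using \<open>\<rho> > 0\<close> bound by (auto intro!: exI[of _ \<rho>])
  then obtain G where G: "G holomorphic_on ball 0 1" "\<And>q. q \<in> ball 0 1 - {0} \<Longrightarrow> G q = F q"
    using holomorphic_on_extend_bounded[OF F_holo] by auto
  show ?thesis
  proof (rule that[OF G(1)])
    fix z assume "z \<in> \<H>"
    then have "cusp_coord n z \<in> ball 0 1 - {0}" using cusp_coord_less_1[OF n] by simp
    with G(2) F[of z "cusp_coord n z"] show "h z = G (cusp_coord n z)" by simp
  qed
qed

section \<open>Expansions and nonvanishing of lattice sums\<close>

lemma lattice_sum_cusp_expansion:
  assumes "n > 0" "residue_closed n P" "k \<ge> 2"
  obtains F where "F holomorphic_on ball 0 1" "\<And>z. z \<in> \<H> \<Longrightarrow> lattice_sum P k z = F (cusp_coord n z)"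
proof -
  have P: "P \<subseteq> full_lattice" using assms(2) by (simp add: residue_closed_def)
  obtain C where C: "\<And>z. Im z \<ge> 1 \<Longrightarrow> \<bar>Re z\<bar> \<le> real n \<Longrightarrow> norm (lattice_sum P k z) \<le> C"
    using lattice_sum_bounded[OF P assms(3)] by metis
  show ?thesis
    using periodic_bounded_factor[OF assms(1) lattice_sum_holomorphic[OF P assms(3)]
        lattice_sum_periodic[OF assms(2)] C] that by metis
qed

lemma residue_closed_full: "residue_closed n full_lattice"
  by (auto simp: residue_closed_def)

text \<open>\<open>Eisenstein_E4\<close> tends to 1 as the nome tends to 0, so any point with a
  small enough nome is a witness.\<close>

lemma lattice_sum_4_nonzero: "\<exists>z\<in>\<H>. lattice_sum full_lattice 2 z \<noteq> 0"
proof -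
  let ?g = "\<lambda>q. 1 + 240 * q * sigma3_series q"
  have "?g holomorphic_on ball 0 1" by (intro holomorphic_intros sigma3_series_holomorphic)
  then have "isCont ?g 0"
    by (metis (no_types, lifting) centre_in_ball continuous_on_eq_continuous_at holomorphic_on_imp_continuous_on open_ball zero_less_one)
  then have "\<forall>\<^sub>F q in nhds 0. ?g q \<noteq> 0"
    by (intro tendsto_imp_eventually_ne[of _ "?g 0"]) (auto simp: isCont_def tendsto_nhds_iff)
  then obtain d where d: "d > 0" "\<And>q. dist q 0 < d \<Longrightarrow> ?g q \<noteq> 0"
    unfolding eventually_nhds_metric by blast
  define q where "q = complex_of_real (min d 1 / 2)"
  have q: "q \<noteq> 0" "cmod q < 1" "cmod q < d" using d(1) by (auto simp: q_def)
  obtain z where z: "z \<in> \<H>" "cusp_coord 1 z = q" using cusp_coord_surj[of 1 q] q by auto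
  then have "nome z = q" using nome_eq_cusp_coord[of 1 z] by simp
  then have "Eisenstein_E4 z \<noteq> 0" using Eisenstein_E4_sigma3_series[OF z(1)] d(2)[of q] q by simp
  then show ?thesis
    by (intro bexI[OF _ z(1)]) (simp add: Eisenstein_E4_lattice_sum[OF z(1)])
qed

text \<open>At a point high on the imaginary axis the row of integers contributes a positive real
  number, at least its single term 1, while all other rows together contribute at most M / y^2 in
  norm.\<close>

lemma lattice_sum_6_nonzero: "\<exists>z\<in>\<H>. lattice_sum full_lattice 3 z \<noteq> 0"
proof -
  define P0 :: "(int \<times> int) set" where "P0 = {x. fst x = 0 \<and> snd x \<noteq> 0}"
  define P1 :: "(int \<times> int) set" where "P1 = {x. fst x \<noteq> 0}"
  define M where "M = (\<Sum>\<^sub>\<infinity>x\<in>P1. 1 / (sqnorm x)\<^sup>2)"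
  \<comment> \<open>\<open>y > M\<close> and \<open>y \<ge> 2\<close> give M < y^2, so the other
    rows stay below 1.\<close>
  define y where "y = \<bar>M\<bar> + 2"
  define z where "z = \<i> * of_real y"
  have y: "y \<ge> 2" "y > M" by (auto simp: y_def)
  have z: "z \<in> \<H>" using y(1) by (simp add: z_def in_upper_half_plane_iff)
  have P: "full_lattice = P0 \<union> P1" "P0 \<inter> P1 = {}" by (auto simp: P0_def P1_def)
  have s0: "(\<lambda>x. norm (1 / (lattice_pt x z)\<^sup>2 ^ 3)) summable_on P0"
    and s1: "(\<lambda>x. norm (1 / (lattice_pt x z)\<^sup>2 ^ 3)) summable_on P1"
    by (rule lattice_sum_abs_summable[OF z]; auto simp: P0_def P1_def)+
  have sum: "lattice_sum full_lattice 3 z = lattice_sum P0 3 z + lattice_sum P1 3 z"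
    unfolding lattice_sum_def P(1)
    by (rule infsum_Un_disjoint[OF abs_summable_summable[OF s0] abs_summable_summable[OF s1] P(2)])
  have val0: "1 / (lattice_pt x z)\<^sup>2 ^ 3 = of_real (1 / (real_of_int (snd x))\<^sup>2 ^ 3)" if "x \<in> P0" for x
    using that by (simp add: P0_def lattice_pt_def)
  have s0': "(\<lambda>x. 1 / (real_of_int (snd x))\<^sup>2 ^ 3) summable_on P0"
    by (rule summable_on_cong[THEN iffD1, OF _ s0]) (simp only: val0 norm_of_real, simp)
  have "lattice_sum P0 3 z = of_real (\<Sum>\<^sub>\<infinity>x\<in>P0. 1 / (real_of_int (snd x))\<^sup>2 ^ 3)"
    unfolding lattice_sum_def using val0 has_sum_of_real[OF has_sum_infsum[OF s0']]
    by (metis (no_types, lifting) infsumI infsum_cong)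
  moreover have "(\<Sum>\<^sub>\<infinity>x\<in>P0. 1 / (real_of_int (snd x))\<^sup>2 ^ 3) \<ge> 1"
  proof -
    have "(\<Sum>\<^sub>\<infinity>x\<in>{(0 :: int, 1)}. 1 / (real_of_int (snd x))\<^sup>2 ^ 3) \<le> (\<Sum>\<^sub>\<infinity>x\<in>P0. 1 / (real_of_int (snd x))\<^sup>2 ^ 3)"
      by (rule infsum_mono2[OF _ s0']) (auto simp: P0_def)
    then show ?thesis by simp
  qed
  ultimately have low: "Re (lattice_sum P0 3 z) \<ge> 1" by simp
  have sq: "(\<lambda>x. 1 / (sqnorm x)\<^sup>2) summable_on P1"
    by (rule summable_on_subset[OF summable_on_sqnorm]) (auto simp: P1_def)
  have "norm (lattice_sum P1 3 z) \<le> 1 / y\<^sup>2 * M"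
    unfolding lattice_sum_def M_def
  proof (rule norm_infsum_le[OF has_sum_infsum[OF abs_summable_summable[OF s1]]
        has_sum_cmult_right[OF has_sum_infsum[OF sq]]])
    fix x assume x: "x \<in> P1"
    define c d where "c = real_of_int (fst x)" and "d = real_of_int (snd x)"
    have "sqnorm x \<ge> 1" using x by (intro sqnorm_ge_1) (auto simp: P1_def)
    have "\<bar>fst x\<bar> \<ge> 1" using x by (auto simp: P1_def)
    then have "\<bar>c\<bar> \<ge> 1" unfolding c_def by linarith
    then have c: "c\<^sup>2 \<ge> 1" using power_mono[of 1 "\<bar>c\<bar>" 2] by simp
    have y1: "y\<^sup>2 \<ge> 1" using y(1) power_mono[of 1 y 2] by simp
    have n: "(cmod (lattice_pt x z))\<^sup>2 = c\<^sup>2 * y\<^sup>2 + d\<^sup>2"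
      by (simp add: lattice_pt_def z_def cmod_power2 c_def d_def power_mult_distrib)
    have "y\<^sup>2 * 1 \<le> y\<^sup>2 * c\<^sup>2" using c by (intro mult_left_mono) auto
    then have n1: "(cmod (lattice_pt x z))\<^sup>2 \<ge> y\<^sup>2" unfolding n by (simp add: mult.commute add_increasing2)
    have "c\<^sup>2 * 1 \<le> c\<^sup>2 * y\<^sup>2" using y1 by (intro mult_left_mono) auto
    then have n2: "(cmod (lattice_pt x z))\<^sup>2 \<ge> sqnorm x" unfolding n by (simp add: sqnorm_def c_def d_def)
    have "y\<^sup>2 * (sqnorm x)\<^sup>2 \<le> (cmod (lattice_pt x z))\<^sup>2 * ((cmod (lattice_pt x z))\<^sup>2)\<^sup>2"
      using \<open>sqnorm x \<ge> 1\<close> by (intro mult_mono[OF n1 power_mono[OF n2]]) auto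
    also have "\<dots> = ((cmod (lattice_pt x z))\<^sup>2) ^ 3" by (simp add: power3_eq_cube power2_eq_square mult_ac)
    finally have "1 / ((cmod (lattice_pt x z))\<^sup>2) ^ 3 \<le> 1 / (y\<^sup>2 * (sqnorm x)\<^sup>2)"
      using y1 \<open>sqnorm x \<ge> 1\<close> by (intro frac_le mult_pos_pos) auto
    then show "norm (1 / (lattice_pt x z)\<^sup>2 ^ 3) \<le> 1 / y\<^sup>2 * (1 / (sqnorm x)\<^sup>2)"
      by (simp add: norm_divide norm_power)
  qed
  moreover have "1 / y\<^sup>2 * M < 1"
  proof -
    have "y * 1 \<le> y * y" using y(1) by (intro mult_left_mono) auto
    then have "M < y\<^sup>2" using y(2) by (simp add: power2_eq_square)
    then show ?thesis using y(1) by (simp add: field_simps)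
  qed
  ultimately have "norm (lattice_sum P1 3 z) < 1" by linarith
  then have "\<bar>Re (lattice_sum P1 3 z)\<bar> < 1" using abs_Re_le_cmod[of "lattice_sum P1 3 z"] by linarith
  then have "Re (lattice_sum full_lattice 3 z) > 0" unfolding sum using low by simp
  then show ?thesis using z by force
qed

lemma holomorphic_eventually_nonzero:
  assumes "f holomorphic_on S" "open S" "connected S" "z \<in> S" "f z \<noteq> 0"
  shows "\<forall>\<^sub>\<approx>w\<in>S. f w \<noteq> 0"
  unfolding eventually_cosparse_open_eq[OF assms(2)]
proof
  fix w assume w: "w \<in> S"
  have "\<not> w islimpt {x \<in> S. f x = 0}"
  proof
    assume "w islimpt {x \<in> S. f x = 0}"
    then have "f z = 0"
      by (intro analytic_continuation[OF assms(1-3) _ w _ _ assms(4), of "{x \<in> S. f x = 0}"]) auto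
    with assms(5) show False by contradiction
  qed
  then have "\<forall>\<^sub>F x in at w. x \<notin> {x \<in> S. f x = 0}" by (simp add: islimpt_iff_eventually)
  moreover have "\<forall>\<^sub>F x in at w. x \<in> S" using w assms(2) by (intro eventually_at_in_open')
  ultimately show "\<forall>\<^sub>F x in at w. f x \<noteq> 0" by eventually_elim auto
qed

text \<open>\<open>lattice_sum P k\<close> has weight 2k and the quotient in parentheses has weight
  -2. Equal values of these functions at two points, for all \<open>P\<close> and \<open>k\<close>,
  mean that the lattice sums differ by the \<open>k\<close>-th powers of one common scale.\<close>

definition lattice_function :: "(int \<times> int) set \<Rightarrow> nat \<Rightarrow> complex \<Rightarrow> complex" where
  "lattice_function P k z =
     lattice_sum P k z * (lattice_sum full_lattice 2 z / lattice_sum full_lattice 3 z) ^ k"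

lemma lattice_function_modular_act:
  assumes "A \<in> SL2Z" "z \<in> \<H>"
  shows "lattice_function P k (modular_act A z) = lattice_function (row_act A ` P) k z"
proof -
  let ?j = "(aut_factor A z)\<^sup>2"
  have j: "?j \<noteq> 0" using aut_factor_nonzero[OF assms] by simp
  show ?thesis
    unfolding lattice_function_def lattice_sum_modular_act[OF assms] row_act_full[OF assms(1)]
    using j by (simp add: power_divide power_mult_distrib eval_nat_numeral field_simps)
qed

lemma modular_function_lattice_function:
  assumes "n > 0" "residue_closed n P" "k \<ge> 2"
  shows "modular_function n (lattice_function P k)"
  unfolding modular_function_def
proof (intro conjI ballI)
  have "lattice_sum P k holomorphic_on \<H>" "lattice_sum full_lattice 2 holomorphic_on \<H>"
    "lattice_sum full_lattice 3 holomorphic_on \<H>"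
    using assms by (auto intro!: lattice_sum_holomorphic simp: residue_closed_def)
  then show "lattice_function P k meromorphic_on \<H>"
    unfolding lattice_function_def[abs_def] using open_upper_half_plane
    by (intro meromorphic_intros analytic_on_imp_meromorphic_on) (simp_all add: analytic_on_open)
next
  fix A assume A: "A \<in> \<Gamma> n"
  from cosparse_upper_half_plane show "\<forall>\<^sub>\<approx>z\<in>\<H>. lattice_function P k (modular_act A z) = lattice_function P k z"
    by eventually_elim
      (simp add: lattice_function_modular_act[OF Gamma_subset_SL2Z[OF A]] row_act_Gamma[OF A assms(2)])
next
  show "meromorphic_at_cusps n (lattice_function P k)"
    unfolding meromorphic_at_cusps_def
  proof
    fix A assume A: "A \<in> SL2Z"
    obtain F where F: "F holomorphic_on ball 0 1"
      "\<And>z. z \<in> \<H> \<Longrightarrow> lattice_sum (row_act A ` P) k z = F (cusp_coord n z)"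
      using lattice_sum_cusp_expansion[OF assms(1) residue_closed_row_act[OF A assms(2)] assms(3)] by metis
    obtain F4 where F4: "F4 holomorphic_on ball 0 1"
      "\<And>z. z \<in> \<H> \<Longrightarrow> lattice_sum full_lattice 2 z = F4 (cusp_coord n z)"
      using lattice_sum_cusp_expansion[OF assms(1) residue_closed_full, of 2] by auto
    obtain F6 where F6: "F6 holomorphic_on ball 0 1"
      "\<And>z. z \<in> \<H> \<Longrightarrow> lattice_sum full_lattice 3 z = F6 (cusp_coord n z)"
      using lattice_sum_cusp_expansion[OF assms(1) residue_closed_full, of 3] by auto
    from cosparse_upper_half_plane have "\<forall>\<^sub>\<approx>z\<in>\<H>. lattice_function P k (modular_act A z) =
        F (exp (2 * of_real pi * \<i> * z / of_nat n)) *
        (F4 (exp (2 * of_real pi * \<i> * z / of_nat n)) / F6 (exp (2 * of_real pi * \<i> * z / of_nat n))) ^ k"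
      by eventually_elim
        (subst lattice_function_modular_act[OF A], assumption,
          simp add: lattice_function_def F(2) F4(2) F6(2) cusp_coord_def)
    moreover have "(\<lambda>q. F q * (F4 q / F6 q) ^ k) meromorphic_on ball 0 1"
      using F(1) F4(1) F6(1)
      by (intro meromorphic_intros analytic_on_imp_meromorphic_on) (simp_all add: analytic_on_open)
    ultimately show "\<exists>F. F meromorphic_on ball 0 1 \<and>
        (\<forall>\<^sub>\<approx>z\<in>\<H>. lattice_function P k (modular_act A z) = F (exp (2 * of_real pi * \<i> * z / of_nat n)))"
      by (intro exI[of _ "\<lambda>q. F q * (F4 q / F6 q) ^ k"]) simp
  qed
qed

text \<open>
  A Hauptmodul separates the orbits of \<open>\<Gamma> n\<close> outside a countable set, because every
  \<open>lattice_function\<close> is a rational function of it and these functions recover the lattice up to scaling.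
\<close>

lemma Hauptmodul_separates:
  assumes "n > 0" "Hauptmodul n f"
  obtains E where "countable E"
    "\<And>w z. w \<in> \<H> - E \<Longrightarrow> z \<in> \<H> - E \<Longrightarrow> f w = f z \<Longrightarrow> \<exists>M\<in>\<Gamma> n. w = modular_act M z"
proof -
  let ?G4 = "lattice_sum full_lattice 2" and ?G6 = "lattice_sum full_lattice 3"
  define V :: "(int \<times> int) set" where "V = {(0, 1), (1, 0)}"
  define separating where "separating = (\<lambda>B k v. countable B \<and> (\<forall>w\<in>\<H> - B. \<forall>z\<in>\<H> - B. f w = f z \<longrightarrow>
      lattice_function (residue_class n v) k w = lattice_function (residue_class n v) k z))"
  have count: "countable {z\<in>\<H>. \<not> Q z}" if "\<forall>\<^sub>\<approx>z\<in>\<H>. Q z" for Q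
    using sparse_imp_countable[OF open_upper_half_plane, of "{z. \<not> Q z}"] that
    by (simp add: eventually_cosparse Int_def)
  have "\<exists>B. separating B k v" if k: "k \<ge> 2" for k v
  proof -
    obtain p q :: "complex poly" where pq: "\<forall>\<^sub>\<approx>z\<in>\<H>. poly q (f z) \<noteq> 0 \<and>
        lattice_function (residue_class n v) k z = poly p (f z) / poly q (f z)"
      using assms(2) modular_function_lattice_function[OF assms(1) residue_closed_residue_class k]
      unfolding Hauptmodul_def by blast
    define B where "B = {z\<in>\<H>. \<not> (poly q (f z) \<noteq> 0 \<and>
      lattice_function (residue_class n v) k z = poly p (f z) / poly q (f z))}"
    have "countable B" unfolding B_def by (rule count[OF pq])
    moreover have "lattice_function (residue_class n v) k z = poly p (f z) / poly q (f z)" if "z \<in> \<H> - B" for z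
      using that by (simp add: B_def)
    ultimately show ?thesis unfolding separating_def by (intro exI[of _ B]) simp
  qed
  then obtain bad where bad: "\<And>k v. k \<ge> 2 \<Longrightarrow> separating (bad k v) k v" by metis
  \<comment> \<open>The polynomials, and with them the exceptional sets, depend on \<open>k\<close>
    and \<open>v\<close>. The union over all weights is countable but need not be sparse.\<close>
  define E where "E = {z\<in>\<H>. \<not> (?G4 z \<noteq> 0)} \<union> {z\<in>\<H>. \<not> (?G6 z \<noteq> 0)} \<union> (\<Union>k\<in>{2..}. \<Union>v\<in>V. bad k v)"
  have "?G4 holomorphic_on \<H>" "?G6 holomorphic_on \<H>" by (auto intro!: lattice_sum_holomorphic)
  then have "\<forall>\<^sub>\<approx>z\<in>\<H>. ?G4 z \<noteq> 0" "\<forall>\<^sub>\<approx>z\<in>\<H>. ?G6 z \<noteq> 0"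
    using lattice_sum_4_nonzero lattice_sum_6_nonzero
      holomorphic_eventually_nonzero[OF _ open_upper_half_plane connected_upper_half_plane] by blast+
  then have "countable {z\<in>\<H>. \<not> (?G4 z \<noteq> 0)}" "countable {z\<in>\<H>. \<not> (?G6 z \<noteq> 0)}"
    by (auto dest: count)
  moreover have "countable (bad k v)" if "k \<ge> 2" for k v
    using bad[OF that] by (simp add: separating_def)
  then have "countable (\<Union>k\<in>{2..}. \<Union>v\<in>V. bad k v)" by (intro countable_UN) (auto simp: V_def)
  ultimately have "countable E" by (simp add: E_def)
  moreover have "\<exists>M\<in>\<Gamma> n. w = modular_act M z" if w: "w \<in> \<H> - E" and z: "z \<in> \<H> - E" and eq: "f w = f z" for w z
  proof -
    have nz: "?G4 w \<noteq> 0" "?G6 w \<noteq> 0" "?G4 z \<noteq> 0" "?G6 z \<noteq> 0" using w z by (auto simp: E_def)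
    \<comment> \<open>Cancelling the weight factors at \<open>w\<close> and \<open>z\<close> leaves
      this scale, the same for all \<open>k\<close> and \<open>v\<close>.\<close>
    define c where "c = (?G6 w / ?G4 w) / (?G6 z / ?G4 z)"
    have "c \<noteq> 0" using nz by (simp add: c_def)
    moreover have "lattice_sum (residue_class n v) k w = c ^ k * lattice_sum (residue_class n v) k z"
      if kv: "k \<ge> 2" "v \<in> {(0, 1), (1, 0)}" for k v
    proof -
      have "w \<notin> bad k v" "z \<notin> bad k v" using w z kv by (auto simp: E_def V_def)
      then have "lattice_function (residue_class n v) k w = lattice_function (residue_class n v) k z"
        using w z eq bad[OF kv(1)] unfolding separating_def by blast
      then show ?thesis
        using nz by (simp add: lattice_function_def c_def power_divide field_simps)
    qed
    ultimately show ?thesis using w z by (intro lattice_sums_separate[of z w c n]) auto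
  qed
  ultimately show ?thesis using that by blast
qed

subsection \<open>Local injectivity of a Hauptmodul\<close>

lemma holomorphic_inj_off_countable:
  assumes holo: "h holomorphic_on U" and U: "open U" "connected U" and S: "countable S"
    and inj: "inj_on h (U - S)"
  shows "inj_on h U"
proof (rule inj_onI, rule ccontr)
  fix a b assume ab: "a \<in> U" "b \<in> U" "h a = h b" "a \<noteq> b"
  have uncount: "uncountable W" if W: "open W" "x \<in> W" for W and x :: complex
  proof -
    obtain e where e: "e > 0" "ball x e \<subseteq> W" using W open_contains_ball by blast
    then show ?thesis using uncountable_ball[OF e(1), of x] countable_subset by blast
  qed
  have nonconst: "\<not> h constant_on U"
  proof
    assume "h constant_on U"
    then have "x = y" if "x \<in> U - S" "y \<in> U - S" for x y
      using that inj unfolding constant_on_def inj_on_def by (metis DiffD1)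
    then have "finite (U - S)"
      by (metis finite.simps subsetI finite_subset singletonI ex_in_conv)
    then have "countable (U - S \<union> S)" by (intro countable_Un[OF countable_finite S])
    then have "countable U" by (rule countable_subset[rotated]) auto
    with uncount[OF U(1) ab(1)] show False by contradiction
  qed
  obtain Ba Bb where B: "open Ba" "open Bb" "a \<in> Ba" "b \<in> Bb" "Ba \<inter> Bb = {}"
    using hausdorff[OF ab(4)] by blast
  have "open (h ` (Ba \<inter> U))" "open (h ` (Bb \<inter> U))"
    using B U nonconst by (auto intro!: open_mapping_thm[OF holo U])
  then have "open (h ` (Ba \<inter> U) \<inter> h ` (Bb \<inter> U))" by (rule open_Int)
  moreover have "h a \<in> h ` (Ba \<inter> U) \<inter> h ` (Bb \<inter> U)" using ab B by (metis IntI imageI)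
  ultimately have "uncountable (h ` (Ba \<inter> U) \<inter> h ` (Bb \<inter> U))" by (rule uncount)
  moreover have "countable (h ` S)" using S by (rule countable_image)
  ultimately obtain y where y: "y \<in> h ` (Ba \<inter> U)" "y \<in> h ` (Bb \<inter> U)" "y \<notin> h ` S"
    by (metis IntD1 IntD2 countable_subset subsetI)
  then obtain a' b' where "a' \<in> Ba \<inter> U" "b' \<in> Bb \<inter> U" "y = h a'" "y = h b'" by blast
  moreover from this have "a' \<notin> S" "b' \<notin> S" using y(3) by blast+
  ultimately have "a' = b'" using inj by (auto dest: inj_onD)
  then show False using B(5) \<open>a' \<in> Ba \<inter> U\<close> \<open>b' \<in> Bb \<inter> U\<close> by blast
qed

text \<open>A lower row (c, d) with nonzero c gives |c z + d| \<ge> Im z, so the imaginary part of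
  the image is at most 1 / Im z < 1. Hence c = 0 and \<open>M\<close> translates by a multiple of
  \<open>n\<close>.\<close>

lemma Gamma_act_near_cusp:
  assumes "M \<in> \<Gamma> n" "n > 0" "Im z > 1" "Im (modular_act M z) > 1"
  shows "cusp_coord n (modular_act M z) = cusp_coord n z"
proof -
  have M: "M \<in> SL2Z" by (rule Gamma_subset_SL2Z[OF assms(1)])
  have z: "z \<in> \<H>" using assms(3) by (simp add: in_upper_half_plane_iff)
  have "M $ 2 $ 1 = 0"
  proof (rule ccontr)
    assume "M $ 2 $ 1 \<noteq> 0"
    then have "\<bar>M $ 2 $ 1\<bar> \<ge> 1" by linarith
    then have "real_of_int \<bar>M $ 2 $ 1\<bar> \<ge> 1" by linarith
    then have "1 * Im z \<le> \<bar>real_of_int (M $ 2 $ 1)\<bar> * Im z" using assms(3) by (intro mult_right_mono) auto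
    also have "\<dots> = \<bar>Im (aut_factor M z)\<bar>" using assms(3) by (simp add: aut_factor_def abs_mult)
    also have "\<dots> \<le> cmod (aut_factor M z)" by (rule abs_Im_le_cmod)
    finally have "(Im z)\<^sup>2 \<le> (cmod (aut_factor M z))\<^sup>2" using assms(3) by (intro power_mono) auto
    moreover have "Im z * 1 < Im z * Im z" using assms(3) by (intro mult_strict_left_mono) auto
    ultimately have "Im z < (cmod (aut_factor M z))\<^sup>2" by (simp add: power2_eq_square)
    then have "Im (modular_act M z) < 1"
      using aut_factor_nonzero[OF M z] by (simp add: Im_modular_act[OF M z])
    with assms(4) show False by simp
  qed
  then obtain k :: int where "modular_act M z = z + of_nat n * of_int k"
    using Gamma_unipotent_act[OF assms(1)] by metis
  then show ?thesis unfolding cusp_coord_eq_iff[OF assms(2)] by blast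
qed

text \<open>
  An element with lower row \<open>(c, d)\<close> that almost fixes a point has \<open>\<bar>c z + d\<bar>\<close> close to \<open>1\<close> and trace
  close to \<open>2 Re (c z + d)\<close>; for \<open>c \<noteq> 0\<close> this contradicts \<open>\<bar>trace\<bar> \<ge> 2\<close>.
\<close>

lemma Gamma_act_locally_injective:
  assumes n: "n \<ge> 2" and z0: "z0 \<in> \<H>"
  obtains \<delta> where "\<delta> > 0"
    "\<And>M z w. M \<in> \<Gamma> n \<Longrightarrow> z \<in> ball z0 \<delta> \<Longrightarrow> w \<in> ball z0 \<delta> \<Longrightarrow> z \<in> \<H> \<Longrightarrow> w = modular_act M z \<Longrightarrow> w = z"
proof -
  define y0 where "y0 = Im z0"
  have y0: "y0 > 0" using z0 by (simp add: y0_def in_upper_half_plane_iff)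
  obtain K where K: "K > 0"
    "\<And>z x. Im z \<ge> y0 / 2 \<Longrightarrow> \<bar>Re z\<bar> \<le> \<bar>Re z0\<bar> + 1 \<Longrightarrow> sqnorm x \<le> K * (cmod (lattice_pt x z))\<^sup>2"
    using lattice_pt_lower_bound[of "y0 / 2"] y0 by (metis half_gt_zero)
  \<comment> \<open>The lower rows with c nonzero that can occur for points near \<open>z0\<close>:
    there Im z / Im w \<le> 2 y0 / (y0 / 2) = 4, which bounds |c z + d|^2. It matters that they are
    finitely many.\<close>
  define X where "X = {x. sqnorm x \<le> K * 4} \<inter> {x. fst x \<noteq> 0}"
  have "finite X" unfolding X_def using finite_sqnorm_le by (intro finite_Int) auto
  define N where "N = nhds z0 \<times>\<^sub>F nhds z0"
  have fst_lim: "(fst \<longlongrightarrow> z0) N" and snd_lim: "(snd \<longlongrightarrow> z0) N"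
    unfolding N_def by (rule filterlim_fst filterlim_snd)+
  \<comment> \<open>A lower row \<open>x\<close> of a matrix carrying \<open>z\<close> to
    \<open>w\<close> is never good: with j = c z + d, |j|^2 equals Im z / Im w, and a - c w = 1 / j
    turns the second expression into the trace a + d.\<close>
  define good where "good = (\<lambda>x (z, w). (cmod (lattice_pt x z))\<^sup>2 \<noteq> Im z / Im w \<or>
      cmod (1 / lattice_pt x z + lattice_pt x z + of_int (fst x) * (w - z)) < 2)"
  have "\<forall>\<^sub>F p in N. good x p" if x: "x \<in> X" for x
  proof -
    define j where "j = lattice_pt x z0"
    have "x \<noteq> (0, 0)" using x by (auto simp: X_def)
    then have j: "j \<noteq> 0" unfolding j_def by (rule lattice_pt_nonzero[OF z0])
    have jlim: "((\<lambda>p. lattice_pt x (fst p)) \<longlongrightarrow> j) N"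
      unfolding j_def lattice_pt_def by (intro tendsto_intros fst_lim)
    show ?thesis
    proof (cases "(cmod j)\<^sup>2 = 1")
      case False
      have "((\<lambda>p. (cmod (lattice_pt x (fst p)))\<^sup>2 - Im (fst p) / Im (snd p)) \<longlongrightarrow> (cmod j)\<^sup>2 - Im z0 / Im z0) N"
        using y0 by (intro tendsto_intros fst_lim snd_lim jlim) (simp add: y0_def)
      then have "\<forall>\<^sub>F p in N. (cmod (lattice_pt x (fst p)))\<^sup>2 - Im (fst p) / Im (snd p) \<noteq> 0"
        by (rule tendsto_imp_eventually_ne) (use y0 False in \<open>simp add: y0_def\<close>)
      then show ?thesis by eventually_elim (auto simp: good_def)
    next
      case True
      have "Im j \<noteq> 0" using x y0 by (simp add: j_def lattice_pt_def X_def y0_def)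
      then have "(Im j)\<^sup>2 > 0" by simp
      then have "(Re j)\<^sup>2 < 1" using True unfolding cmod_power2 by linarith
      then have "\<bar>Re j\<bar> < 1" by (simp add: abs_square_less_1)
      \<comment> \<open>In the limit on the unit circle 1 / j + j is 2 Re j. As Im j is nonzero,
        this is smaller than 2 in modulus.\<close>
      moreover have "1 / j = cnj j" using True by (subst complex_div_cnj) simp
      then have "1 / j + j = of_real (2 * Re j)" by (simp add: complex_eq_iff)
      then have "cmod (1 / j + j) = 2 * \<bar>Re j\<bar>" by (simp only: norm_of_real abs_mult abs_numeral)
      ultimately have "cmod (1 / j + j + of_int (fst x) * (z0 - z0)) < 2" by simp
      moreover have "((\<lambda>p. cmod (1 / lattice_pt x (fst p) + lattice_pt x (fst p) + of_int (fst x) * (snd p - fst p)))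
          \<longlongrightarrow> cmod (1 / j + j + of_int (fst x) * (z0 - z0))) N"
        by (intro tendsto_intros fst_lim snd_lim jlim j)
      ultimately have "\<forall>\<^sub>F p in N. cmod (1 / lattice_pt x (fst p) + lattice_pt x (fst p) + of_int (fst x) * (snd p - fst p)) < 2"
        by (simp only: order_tendstoD(2))
      then show ?thesis by eventually_elim (auto simp: good_def)
    qed
  qed
  then have ev: "\<forall>\<^sub>F p in N. \<forall>x\<in>X. good x p" using \<open>finite X\<close> by (simp add: eventually_ball_finite_distrib)
  then obtain P Q where PQ: "eventually P (nhds z0)" "eventually Q (nhds z0)"
    "\<And>z w. P z \<Longrightarrow> Q w \<Longrightarrow> \<forall>x\<in>X. good x (z, w)"
    unfolding N_def eventually_prod_filter by blast
  then have "\<forall>\<^sub>F z in nhds z0. P z \<and> Q z" by (intro eventually_conj)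
  then obtain \<epsilon> where \<epsilon>: "\<epsilon> > 0" "\<And>z. dist z z0 < \<epsilon> \<Longrightarrow> P z \<and> Q z"
    unfolding eventually_nhds_metric by blast
  \<comment> \<open>The second bound keeps imaginary parts between y0 / 2 and 2 y0; the third makes
    the distance of \<open>z\<close> and \<open>w\<close> less than 1, which rules out translations
    by nonzero multiples of \<open>n\<close>.\<close>
  define \<delta> where "\<delta> = Min {\<epsilon>, y0 / 2, 1 / 2}"
  have \<delta>: "\<delta> > 0" "\<delta> \<le> \<epsilon>" "\<delta> \<le> y0 / 2" "\<delta> \<le> 1 / 2" using \<epsilon>(1) y0 by (auto simp: \<delta>_def)
  show ?thesis
  proof (rule that[OF \<delta>(1)])
    fix M z w
    assume M: "M \<in> \<Gamma> n" and zb: "z \<in> ball z0 \<delta>" and wb: "w \<in> ball z0 \<delta>" and z: "z \<in> \<H>"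
      and w: "w = modular_act M z"
    have SL: "M \<in> SL2Z" by (rule Gamma_subset_SL2Z[OF M])
    define x where "x = (M $ 2 $ 1, M $ 2 $ 2)"
    have jx: "aut_factor M z = lattice_pt x z" by (simp add: aut_factor_def lattice_pt_def x_def)
    have jnz: "lattice_pt x z \<noteq> 0" using aut_factor_nonzero[OF SL z] by (simp add: jx)
    have near: "Im u \<ge> y0 / 2" "Im u \<le> 2 * y0" "\<bar>Re u\<bar> \<le> \<bar>Re z0\<bar> + 1" if "u \<in> ball z0 \<delta>" for u
    proof -
      have "\<bar>Re (z0 - u)\<bar> \<le> 1 / 2" "\<bar>Im (z0 - u)\<bar> \<le> y0 / 2"
        using that \<delta> abs_Re_le_cmod[of "z0 - u"] abs_Im_le_cmod[of "z0 - u"] by (simp_all add: dist_norm)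
      then show "Im u \<ge> y0 / 2" "Im u \<le> 2 * y0" "\<bar>Re u\<bar> \<le> \<bar>Re z0\<bar> + 1"
        unfolding y0_def minus_complex.sel by linarith+
    qed
    have Imw: "Im w > 0" using near(1)[OF wb] y0 by simp
    have jsq: "(cmod (lattice_pt x z))\<^sup>2 = Im z / Im w"
    proof -
      have "Im w = Im z / (cmod (lattice_pt x z))\<^sup>2" using Im_modular_act[OF SL z] unfolding w jx .
      then show ?thesis using Imw jnz by (simp add: field_simps)
    qed
    have "Im z / Im w \<le> (2 * y0) / (y0 / 2)"
      using near[OF zb] near[OF wb] y0 by (intro frac_le) auto
    then have "(cmod (lattice_pt x z))\<^sup>2 \<le> 4" using y0 by (simp add: jsq)
    then have "K * (cmod (lattice_pt x z))\<^sup>2 \<le> K * 4" using K(1) by (intro mult_left_mono) auto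
    then have sq: "sqnorm x \<le> K * 4" using K(2)[OF near(1,3)[OF zb], of x] by linarith
    have "dist z z0 < \<epsilon>" "dist w z0 < \<epsilon>" using zb wb \<delta>(2) by (auto simp: dist_commute)
    then have gd: "\<forall>x\<in>X. good x (z, w)" using \<epsilon>(2) PQ(3) by blast
    have wj: "w * lattice_pt x z = of_int (M $ 1 $ 1) * z + of_int (M $ 1 $ 2)"
      using jnz unfolding w modular_act_eq jx by simp
    have det: "of_int (M $ 1 $ 1) * of_int (M $ 2 $ 2) - of_int (M $ 1 $ 2) * of_int (M $ 2 $ 1) = (1 :: complex)"
      by (rule SL2Z_of_int_det[OF SL])
    have "(of_int (M $ 1 $ 1) - of_int (M $ 2 $ 1) * w) * lattice_pt x z =
        of_int (M $ 1 $ 1) * lattice_pt x z - of_int (M $ 2 $ 1) * (w * lattice_pt x z)"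
      by (simp only: left_diff_distrib mult.assoc)
    also have "\<dots> = of_int (M $ 1 $ 1) * of_int (M $ 2 $ 2) - of_int (M $ 1 $ 2) * of_int (M $ 2 $ 1)"
      unfolding wj by (simp add: lattice_pt_def x_def algebra_simps)
    finally have "(of_int (M $ 1 $ 1) - of_int (M $ 2 $ 1) * w) * lattice_pt x z = 1"
      unfolding det .
    then have "of_int (M $ 1 $ 1) - of_int (M $ 2 $ 1) * w = 1 / lattice_pt x z"
      using jnz by (simp add: field_simps)
    then have tr: "1 / lattice_pt x z + lattice_pt x z + of_int (fst x) * (w - z) = of_int (M $ 1 $ 1 + M $ 2 $ 2)"
      by (simp add: lattice_pt_def x_def algebra_simps)
    have "\<bar>M $ 1 $ 1 + M $ 2 $ 2\<bar> \<ge> 2" by (rule Gamma_trace[OF M n])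
    then have "cmod (of_int (M $ 1 $ 1 + M $ 2 $ 2)) \<ge> 2" unfolding norm_of_int by linarith
    then have "\<not> good x (z, w)" using jsq tr by (simp add: good_def)
    then have "x \<notin> X" using gd by blast
    then have "M $ 2 $ 1 = 0" using sq by (simp add: X_def x_def)
    then obtain k :: int where k: "w = z + of_nat n * of_int k"
      using Gamma_unipotent_act[OF M] w by metis
    have "dist w z < 1" using zb wb \<delta>(4) dist_triangle[of w z z0] by (simp add: dist_commute)
    then have "real n * \<bar>of_int k\<bar> < 1" by (simp add: k dist_norm norm_mult)
    moreover have "real n * \<bar>of_int k\<bar> \<ge> 2 * 1" if "k \<noteq> 0"
      using n that by (intro mult_mono) auto
    ultimately have "k = 0" by force
    then show "w = z" using k by simp
  qed
qed

text \<open>Equal values of \<open>F\<close> come from points equivalent under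
  \<open>\<Gamma> n\<close>, after conjugation by \<open>A\<close>. At \<open>q0 = 0\<close> such
  points are translates and have the same \<open>q\<close>; elsewhere a small neighbourhood of a
  preimage of \<open>q0\<close> contains no two distinct equivalent points.\<close>

lemma Hauptmodul_expansion_inj_off_countable:
  assumes n: "n \<ge> 2" and f: "Hauptmodul n f" and A: "A \<in> SL2Z"
    and F: "\<forall>\<^sub>\<approx>z\<in>\<H>. f (modular_act A z) = F (cusp_coord n z)" and q0: "q0 \<in> ball 0 1"
  obtains U S where "open U" "q0 \<in> U" "countable S" "inj_on F (U - S)"
proof -
  have n0: "n > 0" using n by simp
  obtain E where E: "countable E"
    "\<And>w z. w \<in> \<H> - E \<Longrightarrow> z \<in> \<H> - E \<Longrightarrow> f w = f z \<Longrightarrow> \<exists>M\<in>\<Gamma> n. w = modular_act M z"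
    using Hauptmodul_separates[OF n0 f] by metis
  define bad where "bad = {z\<in>\<H>. f (modular_act A z) \<noteq> F (cusp_coord n z)}"
  have "countable bad"
    using sparse_imp_countable[OF open_upper_half_plane, of "{z. f (modular_act A z) \<noteq> F (cusp_coord n z)}"] F
    by (simp add: eventually_cosparse bad_def Int_def)
  \<comment> \<open>0 is included because it is the coordinate of no point of
    \<open>\<H>\<close>.\<close>
  define S where "S = insert 0 (cusp_coord n ` (bad \<union> modular_act (sl2_inv A) ` E))"
  have S: "countable S" unfolding S_def using E(1) \<open>countable bad\<close> by auto
  have key: "\<exists>M\<in>\<Gamma> n. w = modular_act M z"
    if asm: "w \<in> \<H>" "z \<in> \<H>" "cusp_coord n w \<notin> S" "cusp_coord n z \<notin> S" "F (cusp_coord n w) = F (cusp_coord n z)" for w z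
  proof -
    have *: "modular_act A u \<in> \<H> - E" "f (modular_act A u) = F (cusp_coord n u)"
      if u: "u \<in> \<H>" "cusp_coord n u \<notin> S" for u
    proof -
      have "u \<notin> bad" using u(2) by (auto simp: S_def)
      then show "f (modular_act A u) = F (cusp_coord n u)" using u(1) by (simp add: bad_def)
      have "modular_act A u \<notin> E"
      proof
        assume "modular_act A u \<in> E"
        then have "modular_act (sl2_inv A) (modular_act A u) \<in> modular_act (sl2_inv A) ` E" by (rule imageI)
        then show False using u modular_act_sl2_inv(1)[OF A u(1)] by (auto simp: S_def)
      qed
      then show "modular_act A u \<in> \<H> - E" using modular_act_in_upper_half_plane[OF A u(1)] by simp
    qed
    obtain M where M: "M \<in> \<Gamma> n" "modular_act A w = modular_act M (modular_act A z)"
      using E(2)[OF *(1)[OF asm(1,3)] *(1)[OF asm(2,4)]] *(2)[OF asm(1,3)] *(2)[OF asm(2,4)] asm(5) by auto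
    have SL: "M \<in> SL2Z" "sl2_inv A \<in> SL2Z" using M(1) A by (simp_all add: Gamma_subset_SL2Z sl2_inv_in_SL2Z)
    have "w = modular_act (sl2_inv A) (modular_act A w)" using modular_act_sl2_inv(1)[OF A asm(1)] by simp
    also have "\<dots> = modular_act (sl2_inv A ** M ** A) z"
      using SL A asm(2) unfolding M(2)
      by (simp add: modular_act_mult SL2Z_mult modular_act_in_upper_half_plane)
    finally show ?thesis using Gamma_normal[OF A M(1)] by blast
  qed
  show ?thesis
  proof (cases "q0 = 0")
    case True
    \<comment> \<open>The modulus of \<open>q\<close> at height 1, the height required by
      \<open>Gamma_act_near_cusp\<close>.\<close>
    define \<rho> where "\<rho> = exp (- (2 * pi / real n))"
    have \<rho>: "\<rho> > 0" "\<rho> \<le> 1" by (auto simp: \<rho>_def)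
    have lift: "\<exists>z. z \<in> \<H> \<and> Im z > 1 \<and> cusp_coord n z = q" if q: "q \<in> ball 0 \<rho> - S" for q
    proof -
      have "q \<noteq> 0" "cmod q < 1" using q \<rho> by (auto simp: S_def)
      then obtain z where z: "z \<in> \<H>" "cusp_coord n z = q" using cusp_coord_surj[OF n0] by metis
      then have "exp (- (2 * pi * Im z / real n)) < \<rho>" using q cusp_coord_norm[of n z] by simp
      then have "2 * pi / real n * 1 < 2 * pi / real n * Im z" by (simp add: \<rho>_def)
      moreover have "2 * pi / real n > 0" using n by simp
      ultimately have "Im z > 1" by (simp only: mult_less_cancel_left_pos)
      then show ?thesis using z by blast
    qed
    have "inj_on F (ball 0 \<rho> - S)"
    proof (rule inj_onI)
      fix q1 q2 assume q: "q1 \<in> ball 0 \<rho> - S" "q2 \<in> ball 0 \<rho> - S" "F q1 = F q2"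
      obtain w where w: "w \<in> \<H>" "Im w > 1" "cusp_coord n w = q1" using lift[OF q(1)] by blast
      obtain z where z: "z \<in> \<H>" "Im z > 1" "cusp_coord n z = q2" using lift[OF q(2)] by blast
      obtain M where "M \<in> \<Gamma> n" "w = modular_act M z" using key[OF w(1) z(1)] w z q by auto
      then show "q1 = q2" using Gamma_act_near_cusp[of M n z] n0 w z by simp
    qed
    then show ?thesis using that[of "ball 0 \<rho>" S] True \<rho>(1) S by simp
  next
    case False
    then obtain z0 where z0: "z0 \<in> \<H>" "cusp_coord n z0 = q0" using cusp_coord_surj[OF n0] q0 by auto
    obtain \<delta> where \<delta>: "\<delta> > 0"
      "\<And>M z w. M \<in> \<Gamma> n \<Longrightarrow> z \<in> ball z0 \<delta> \<Longrightarrow> w \<in> ball z0 \<delta> \<Longrightarrow> z \<in> \<H> \<Longrightarrow> w = modular_act M z \<Longrightarrow> w = z"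
      using Gamma_act_locally_injective[OF n z0(1)] by metis
    define B where "B = ball z0 \<delta> \<inter> \<H>"
    have B: "open B" "z0 \<in> B" using \<delta>(1) z0 by (auto simp: B_def open_upper_half_plane)
    have "open (cusp_coord n ` B)"
    proof (rule open_mapping_thm[of "cusp_coord n" UNIV])
      show "\<not> cusp_coord n constant_on UNIV"
      proof
        assume "cusp_coord n constant_on UNIV"
        then have "cusp_coord n 0 = cusp_coord n (of_real (1 / 2))"
          unfolding constant_on_def by (metis UNIV_I)
        then obtain k :: int where "0 = complex_of_real (1 / 2) + of_nat n * of_int k"
          using cusp_coord_eq_iff[OF n0] by blast
        then have "Re 0 = Re (complex_of_real (1 / 2) + of_nat n * of_int k)" by (rule arg_cong)
        then have "real_of_int (2 * (int n * k)) = - 1" by simp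
        then have "2 * (int n * k) = - 1" by linarith
        then show False by presburger
      qed
    qed (auto simp: cusp_coord_holomorphic B)
    moreover have "inj_on F (cusp_coord n ` B - S)"
    proof (rule inj_onI)
      fix q1 q2 assume q: "q1 \<in> cusp_coord n ` B - S" "q2 \<in> cusp_coord n ` B - S" "F q1 = F q2"
      obtain w where w: "w \<in> B" "cusp_coord n w = q1" using q(1) by auto
      obtain z where z: "z \<in> B" "cusp_coord n z = q2" using q(2) by auto
      have wz: "w \<in> \<H>" "z \<in> \<H>" using w(1) z(1) by (auto simp: B_def)
      obtain M where "M \<in> \<Gamma> n" "w = modular_act M z" using key[OF wz] w z q by auto
      then have "w = z" using \<delta>(2)[of M z w] w z by (auto simp: B_def)
      then show "q1 = q2" using w z by simp
    qed
    moreover have "q0 \<in> cusp_coord n ` B" using B(2) z0(2) by blast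
    ultimately show ?thesis using that S by blast
  qed
qed

text \<open>A meromorphic singularity is removable for \<open>F\<close> or for its inverse. The
  extension is injective off a countable set, hence injective, and injective holomorphic functions
  have nonzero derivative. In particular a pole is simple.\<close>

lemma meromorphic_inj_local_form:
  assumes F: "F meromorphic_on {q0}" and U: "open U" "q0 \<in> U" and S: "countable S" and inj: "inj_on F (U - S)"
  obtains h where "h analytic_on {q0}" "deriv h q0 \<noteq> 0"
    "(\<forall>\<^sub>F q in at q0. F q = h q) \<or> h q0 = 0 \<and> (\<forall>\<^sub>F q in at q0. F q = 1 / h q)"
proof -
  have regular: "\<exists>h. h analytic_on {q0} \<and> deriv h q0 \<noteq> 0 \<and> h q0 = c \<and> (\<forall>\<^sub>F q in at q0. g q = h q)"
    if iso: "isolated_singularity_at g q0" and lim: "g \<midarrow>q0\<rightarrow> c" and g: "inj_on g (U - S)" for g c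
  proof -
    obtain r where r: "r > 0" "g analytic_on ball q0 r - {q0}"
      using iso unfolding isolated_singularity_at_def by blast
    obtain e where e: "e > 0" "ball q0 e \<subseteq> U" using U open_contains_ball by blast
    define B where "B = ball q0 (min r e)"
    have B: "open B" "connected B" "q0 \<in> B" "B \<subseteq> ball q0 r" "B \<subseteq> U" using r e by (auto simp: B_def)
    define h where "h = (\<lambda>q. if q = q0 then c else g q)"
    have "g holomorphic_on B - {q0}"
      using analytic_imp_holomorphic[OF r(2)] B(4) by (auto intro: holomorphic_on_subset)
    then have holo: "h holomorphic_on B"
      unfolding h_def by (rule removable_singularity[OF _ B(1) lim])
    have "inj_on h (B - insert q0 S)"
      using g B(5) by (auto simp: h_def inj_on_def)
    then have "inj_on h B"
      by (rule holomorphic_inj_off_countable[OF holo B(1,2), rotated]) (use S in auto)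
    then have "deriv h q0 \<noteq> 0"
      by (rule holomorphic_injective_imp_regular[OF holo B(1) _ B(3)])
    moreover have "h analytic_on {q0}" using holo B by (meson analytic_at)
    moreover have "\<forall>\<^sub>F q in at q0. g q = h q"
      using eventually_neq_at_within[of q0 q0 UNIV] by eventually_elim (simp add: h_def)
    ultimately show ?thesis by (intro exI[of _ h]) (simp add: h_def)
  qed
  have F': "isolated_singularity_at F q0" "not_essential F q0" using F by (auto simp: meromorphic_at_iff)
  show ?thesis
  proof (cases "is_pole F q0")
    case False
    then obtain c where "F \<midarrow>q0\<rightarrow> c" using F'(2) unfolding not_essential_def by blast
    from regular[OF F'(1) this inj] show ?thesis using that by blast
  next
    case True
    have "isolated_singularity_at (\<lambda>q. inverse (F q)) q0"
      using meromorphic_on_inverse[OF F] by (simp add: meromorphic_at_iff)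
    moreover have "(\<lambda>q. inverse (F q)) \<midarrow>q0\<rightarrow> 0"
      using True unfolding is_pole_def by (rule filterlim_compose[OF tendsto_inverse_0])
    \<comment> \<open>Zeros of \<open>F\<close> do no harm: with \<open>inverse 0 = 0\<close> the
      inversion is injective everywhere.\<close>
    moreover have "inj_on (\<lambda>q. inverse (F q)) (U - S)" using inj by (auto simp: inj_on_def)
    ultimately obtain h where h: "h analytic_on {q0}" "deriv h q0 \<noteq> 0" "h q0 = 0"
      "\<forall>\<^sub>F q in at q0. inverse (F q) = h q"
      using regular by blast
    have "\<forall>\<^sub>F q in at q0. F q = 1 / h q"
      using h(4) by eventually_elim (metis inverse_eq_divide inverse_inverse_eq)
    then show ?thesis using that h by blast
  qed
qed

subsection \<open>The maximum principle on the modular curve\<close>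

text \<open>Below height 1/2, the map w -> -1 / (w - k) with k the integer nearest to Re w at least
  doubles the imaginary part, since |w - k|^2 \<le> 1/4 + 1/4. Finitely many doublings
  suffice.\<close>

lemma SL2Z_orbit_Im_ge:
  assumes "z \<in> \<H>"
  obtains A where "A \<in> SL2Z" "Im (modular_act A z) \<ge> 1 / 2"
proof -
  have step: "\<exists>B\<in>SL2Z. Im (modular_act B w) \<ge> 2 * Im w" if w: "w \<in> \<H>" "Im w < 1 / 2" for w
  proof -
    define k where "k = round (Re w)"
    define B :: "int ^ 2 ^ 2" where "B = vector [vector [0, -1], vector [1, - k]]"
    have B: "B \<in> SL2Z" by (simp add: B_def SL2Z_iff)
    have aut: "aut_factor B w = w - of_int k" by (simp add: B_def aut_factor_def)
    have pos: "Im w > 0" using w(1) by (simp add: in_upper_half_plane_iff)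
    have "\<bar>Re w - of_int k\<bar> \<le> 1 / 2" unfolding k_def using of_int_round_abs_le[of "Re w"] by (simp add: abs_minus_commute)
    then have "\<bar>Re w - of_int k\<bar>\<^sup>2 \<le> (1 / 2)\<^sup>2" by (rule power_mono) simp
    then have "(Re w - of_int k)\<^sup>2 \<le> (1 / 2)\<^sup>2" by (simp only: power2_abs)
    moreover have "(Im w)\<^sup>2 \<le> (1 / 2)\<^sup>2" using w(2) pos by (intro power_mono) auto
    ultimately have "(cmod (aut_factor B w))\<^sup>2 \<le> 1 / 2" by (simp add: aut cmod_power2 power_divide)
    moreover have "(cmod (aut_factor B w))\<^sup>2 > 0" using aut_factor_nonzero[OF B w(1)] by simp
    ultimately have "Im w / (1 / 2) \<le> Im w / (cmod (aut_factor B w))\<^sup>2" using pos by (intro divide_left_mono) auto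
    then show ?thesis using B by (intro bexI[of _ B]) (simp_all add: Im_modular_act[OF B w(1)])
  qed
  have "\<exists>A\<in>SL2Z. Im (modular_act A z) \<ge> 1 / 2 \<or> Im (modular_act A z) \<ge> 2 ^ N * Im z" for N
  proof (induction N)
    case 0
    then show ?case using mat_1_in_SL2Z by (intro bexI[of _ "mat 1"]) auto
  next
    case (Suc N)
    then obtain A where A: "A \<in> SL2Z" "Im (modular_act A z) \<ge> 1 / 2 \<or> Im (modular_act A z) \<ge> 2 ^ N * Im z" by blast
    show ?case
    proof (cases "Im (modular_act A z) \<ge> 1 / 2")
      case False
      then obtain B where B: "B \<in> SL2Z" "Im (modular_act B (modular_act A z)) \<ge> 2 * Im (modular_act A z)"
        using step[OF modular_act_in_upper_half_plane[OF A(1) assms]] by auto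
      have "2 ^ Suc N * Im z \<le> 2 * Im (modular_act A z)" using A(2) False by simp
      then show ?thesis
        using A(1) B assms by (intro bexI[of _ "B ** A"]) (auto simp: modular_act_mult SL2Z_mult)
    qed (use A in blast)
  qed
  note * = this
  have pos: "Im z > 0" using assms by (simp add: in_upper_half_plane_iff)
  obtain N where "1 / 2 / Im z < 2 ^ N" using real_arch_pow[of 2 "1 / 2 / Im z"] by auto
  then have "2 ^ N * Im z \<ge> 1 / 2" using pos by (simp add: field_simps)
  with *[of N] that show ?thesis by force
qed

text \<open>Every orbit meets a closed disc |q| \<le> r of some expansion. The maximum over these
  finitely many compact discs therefore bounds \<open>h\<close>, and with it every expansion on the
  whole unit disc. It is attained inside the unit disc, so one expansion is constant, then
  \<open>h\<close>, then all of them.\<close>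

lemma modular_maximum_principle:
  fixes G :: "'i \<Rightarrow> complex \<Rightarrow> complex"
  assumes n: "n > 0" and I: "finite I"
    and holo: "\<And>i. i \<in> I \<Longrightarrow> G i holomorphic_on ball 0 1"
    and cover: "\<And>A. A \<in> SL2Z \<Longrightarrow> \<exists>i\<in>I. \<forall>z\<in>\<H>. h (modular_act A z) = G i (cusp_coord n z)"
    and occurs: "\<And>i. i \<in> I \<Longrightarrow> \<exists>A\<in>SL2Z. \<forall>z\<in>\<H>. h (modular_act A z) = G i (cusp_coord n z)"
  obtains C where "\<And>i q. i \<in> I \<Longrightarrow> q \<in> ball 0 1 \<Longrightarrow> q \<noteq> 0 \<Longrightarrow> G i q = C"
proof -
  \<comment> \<open>The modulus of \<open>q\<close> at height 1/2, the height reached by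
    \<open>SL2Z_orbit_Im_ge\<close>.\<close>
  define r where "r = exp (- (pi / real n))"
  have r: "0 < r" "r < 1" using n by (simp_all add: r_def)
  have K: "cball 0 r \<subseteq> ball (0 :: complex) 1" using r by auto
  have Ine: "I \<noteq> {}" using cover[OF mat_1_in_SL2Z] by blast
  have "\<exists>p\<in>cball 0 r. \<forall>q\<in>cball 0 r. cmod (G i q) \<le> cmod (G i p)" if "i \<in> I" for i
  proof (rule continuous_attains_sup)
    show "continuous_on (cball 0 r) (\<lambda>q. cmod (G i q))"
      using holomorphic_on_imp_continuous_on[OF holomorphic_on_subset[OF holo[OF that] K]]
      by (intro continuous_intros)
  qed (use r in auto)
  then obtain p where p: "\<And>i. i \<in> I \<Longrightarrow> p i \<in> cball 0 r"
    "\<And>i q. i \<in> I \<Longrightarrow> q \<in> cball 0 r \<Longrightarrow> cmod (G i q) \<le> cmod (G i (p i))"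
    by metis
  have "Max ((\<lambda>i. cmod (G i (p i))) ` I) \<in> (\<lambda>i. cmod (G i (p i))) ` I" using I Ine by (intro Max_in) auto
  then obtain i0 where i0: "i0 \<in> I" "cmod (G i0 (p i0)) = Max ((\<lambda>i. cmod (G i (p i))) ` I)" by auto
  have max: "cmod (G i q) \<le> cmod (G i0 (p i0))" if "i \<in> I" "q \<in> cball 0 r" for i q
  proof -
    have "cmod (G i (p i)) \<le> Max ((\<lambda>i. cmod (G i (p i))) ` I)" using I that(1) by (intro Max_ge) auto
    with p(2)[OF that] show ?thesis by (simp add: i0(2))
  qed
  have h_le: "cmod (h z) \<le> cmod (G i0 (p i0))" if z: "z \<in> \<H>" for z
  proof -
    obtain A where A: "A \<in> SL2Z" "Im (modular_act A z) \<ge> 1 / 2" using SL2Z_orbit_Im_ge[OF z] by metis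
    define w where "w = modular_act A z"
    have w: "w \<in> \<H>" unfolding w_def by (rule modular_act_in_upper_half_plane[OF A(1) z])
    obtain i where i: "i \<in> I" "\<And>z. z \<in> \<H> \<Longrightarrow> h (modular_act (sl2_inv A) z) = G i (cusp_coord n z)"
      using cover[OF sl2_inv_in_SL2Z[OF A(1)]] by blast
    have "h z = h (modular_act (sl2_inv A) w)" unfolding w_def by (simp add: modular_act_sl2_inv(1)[OF A(1) z])
    also have "\<dots> = G i (cusp_coord n w)" by (rule i(2)[OF w])
    finally have hz: "h z = G i (cusp_coord n w)" .
    have "pi / real n * 1 \<le> pi / real n * (2 * Im w)"
      using A(2) n unfolding w_def by (intro mult_left_mono) auto
    then have "cmod (cusp_coord n w) \<le> r" by (simp add: cusp_coord_norm r_def mult_ac)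
    then show ?thesis unfolding hz by (intro max i) simp
  qed
  have le: "cmod (G i q) \<le> cmod (G i0 (p i0))" if i: "i \<in> I" and q: "q \<in> ball 0 1" for i q
  proof (cases "q = 0")
    case True
    then show ?thesis using r by (intro max[OF i]) simp
  next
    case False
    then obtain z where z: "z \<in> \<H>" "cusp_coord n z = q" using cusp_coord_surj[OF n, of q] q by auto
    obtain A where A: "A \<in> SL2Z" "\<And>z. z \<in> \<H> \<Longrightarrow> h (modular_act A z) = G i (cusp_coord n z)"
      using occurs[OF i] by blast
    show ?thesis using h_le[OF modular_act_in_upper_half_plane[OF A(1) z(1)]] A(2)[OF z(1)] z(2) by simp
  qed
  have "G i0 constant_on ball 0 1"
  proof (rule maximum_modulus_principle[OF holo[OF i0(1)], of "ball 0 1" "p i0"])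
    show "p i0 \<in> ball 0 1" using p(1)[OF i0(1)] K by blast
  qed (use le i0(1) in auto)
  then obtain C where C: "\<And>q. q \<in> ball 0 1 \<Longrightarrow> G i0 q = C" unfolding constant_on_def by blast
  obtain A0 where A0: "A0 \<in> SL2Z" "\<And>z. z \<in> \<H> \<Longrightarrow> h (modular_act A0 z) = G i0 (cusp_coord n z)"
    using occurs[OF i0(1)] by blast
  have hC: "h z = C" if z: "z \<in> \<H>" for z
  proof -
    have w: "modular_act (sl2_inv A0) z \<in> \<H>"
      using A0(1) z by (intro modular_act_in_upper_half_plane sl2_inv_in_SL2Z)
    have "h z = G i0 (cusp_coord n (modular_act (sl2_inv A0) z))"
      using A0(2)[OF w] by (simp add: modular_act_sl2_inv(2)[OF A0(1) z])
    also have "\<dots> = C" using cusp_coord_less_1[OF n w] by (intro C) simp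
    finally show ?thesis .
  qed
  show ?thesis
  proof (rule that)
    fix i q assume i: "i \<in> I" and q: "q \<in> ball 0 1" "q \<noteq> (0 :: complex)"
    then obtain z where z: "z \<in> \<H>" "cusp_coord n z = q" using cusp_coord_surj[OF n, of q] by auto
    obtain A where A: "A \<in> SL2Z" "\<And>z. z \<in> \<H> \<Longrightarrow> h (modular_act A z) = G i (cusp_coord n z)"
      using occurs[OF i] by blast
    show "G i q = C"
      using hC[OF modular_act_in_upper_half_plane[OF A(1) z(1)]] A(2)[OF z(1)] z(2) by simp
  qed
qed

section \<open>Identities that hold off sparse sets\<close>

lemma nonzero_derivative_filterlim_at:
  fixes \<phi> :: "complex \<Rightarrow> complex"
  assumes "(\<phi> has_field_derivative D) (at z)" "D \<noteq> 0"
  shows "filterlim \<phi> (at (\<phi> z)) (at z)"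
proof -
  have "((\<lambda>w. (\<phi> w - \<phi> z) / (w - z)) \<longlongrightarrow> D) (at z)" using assms(1) by (simp add: has_field_derivative_iff)
  then have "\<forall>\<^sub>F w in at z. (\<phi> w - \<phi> z) / (w - z) \<noteq> 0" using assms(2) by (rule tendsto_imp_eventually_ne)
  then have "\<forall>\<^sub>F w in at z. \<phi> w \<noteq> \<phi> z" by eventually_elim auto
  moreover have "(\<phi> \<longlongrightarrow> \<phi> z) (at z)" using DERIV_isCont[OF assms(1)] by (simp add: isCont_def)
  ultimately show ?thesis by (simp add: filterlim_at)
qed

text \<open>A map with nonzero derivative sends small punctured neighbourhoods into punctured
  neighbourhoods, so preimages of sparse sets are sparse.\<close>

lemma eventually_cosparse_compose:
  fixes \<phi> :: "complex \<Rightarrow> complex"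
  assumes "\<forall>\<^sub>\<approx>w\<in>B. P w" "open A" "open B" "\<And>z. z \<in> A \<Longrightarrow> \<phi> z \<in> B"
    and "\<And>z. z \<in> A \<Longrightarrow> \<exists>D. (\<phi> has_field_derivative D) (at z) \<and> D \<noteq> 0"
  shows "\<forall>\<^sub>\<approx>z\<in>A. P (\<phi> z)"
  unfolding eventually_cosparse_open_eq[OF assms(2)]
proof
  fix z assume z: "z \<in> A"
  then obtain D where "(\<phi> has_field_derivative D) (at z)" "D \<noteq> 0" using assms(5) by blast
  then have "filterlim \<phi> (at (\<phi> z)) (at z)" by (rule nonzero_derivative_filterlim_at)
  moreover have "\<forall>\<^sub>F w in at (\<phi> z). P w" using assms(1,4) z by (simp add: eventually_cosparse_open_eq[OF assms(3)])
  ultimately show "\<forall>\<^sub>F w in at z. P (\<phi> w)" by (simp add: filterlim_iff)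
qed

lemma cosparse_modular_act:
  assumes "\<forall>\<^sub>\<approx>w\<in>\<H>. P w" "A \<in> SL2Z"
  shows "\<forall>\<^sub>\<approx>z\<in>\<H>. P (modular_act A z)"
  by (rule eventually_cosparse_compose[OF assms(1) open_upper_half_plane open_upper_half_plane])
    (use modular_act_in_upper_half_plane modular_act_has_derivative aut_factor_nonzero assms(2) in
      \<open>auto intro!: exI[of _ "1 / (aut_factor A _)\<^sup>2"]\<close>)

lemma cosparse_cusp_coord:
  assumes "\<forall>\<^sub>\<approx>q\<in>ball 0 1. P q" "n > 0"
  shows "\<forall>\<^sub>\<approx>z\<in>\<H>. P (cusp_coord n z)"
proof (rule eventually_cosparse_compose[OF assms(1) open_upper_half_plane])
  show "\<exists>D. (cusp_coord n has_field_derivative D) (at z) \<and> D \<noteq> 0" for z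
    using cusp_coord_has_field_derivative[of n z UNIV] assms(2)
    by (intro exI[of _ "2 * of_real pi * \<i> / of_nat n * cusp_coord n z"]) auto
qed (use cusp_coord_less_1 assms(2) in auto)

lemma eventually_at_imp_eventually_at_nhds:
  fixes z :: "'a :: t1_space"
  assumes "\<forall>\<^sub>F w in at z. P w"
  shows "\<forall>\<^sub>F w in at z. \<forall>\<^sub>F v in nhds w. P v"
proof -
  obtain U where U: "open U" "z \<in> U" "\<And>w. w \<in> U \<Longrightarrow> w \<noteq> z \<Longrightarrow> P w"
    using assms unfolding eventually_at_topological by blast
  show ?thesis
    unfolding eventually_at_topological
  proof (intro exI[of _ U] conjI ballI impI U)
    fix w assume w: "w \<in> U" "w \<noteq> z"
    have "open (U - {z})" using U(1) by (intro open_Diff) auto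
    then show "\<forall>\<^sub>F v in nhds w. P v" using w U(3) unfolding eventually_nhds by blast
  qed
qed

text \<open>Turns equality off a sparse set into equality on full neighbourhoods, as needed to
  compare derivatives.\<close>

lemma eventually_cosparse_nhds:
  fixes A :: "'a :: t1_space set"
  assumes "\<forall>\<^sub>\<approx>z\<in>A. P z" "open A"
  shows "\<forall>\<^sub>\<approx>z\<in>A. \<forall>\<^sub>F w in nhds z. P w"
  using assms(1) eventually_at_imp_eventually_at_nhds unfolding eventually_cosparse_open_eq[OF assms(2)] by blast

lemma cosparse_eq_holomorphic:
  fixes f g :: "complex \<Rightarrow> complex"
  assumes "\<forall>\<^sub>\<approx>z\<in>A. f z = g z" "open A" "f holomorphic_on A" "g holomorphic_on A" "z \<in> A"
  shows "f z = g z"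
proof -
  have "isCont f z" "isCont g z"
    using assms by (metis continuous_on_eq_continuous_at holomorphic_on_imp_continuous_on)+
  then have "f \<midarrow>z\<rightarrow> f z" and lim: "g \<midarrow>z\<rightarrow> g z" by (auto simp: isCont_def)
  moreover have "\<forall>\<^sub>F w in at z. f w = g w" using assms(1,2,5) by (simp add: eventually_cosparse_open_eq)
  ultimately have "g \<midarrow>z\<rightarrow> f z" using Lim_transform_eventually by blast
  then show ?thesis using lim by (rule LIM_unique)
qed

lemma remove_sings_locally_analytic:
  assumes "open B" "\<And>p. p \<in> B \<Longrightarrow> \<exists>k. k analytic_on {p} \<and> (\<forall>\<^sub>F q in at p. g q = k q)"
  shows "remove_sings g holomorphic_on B" "\<forall>\<^sub>\<approx>q\<in>B. remove_sings g q = g q"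
proof -
  have iso: "isolated_singularity_at g p" "\<exists>c. g \<midarrow>p\<rightarrow> c" if p: "p \<in> B" for p
  proof -
    obtain k where k: "k analytic_on {p}" "\<forall>\<^sub>F q in at p. g q = k q" using assms(2)[OF p] by blast
    show "isolated_singularity_at g p"
      using isolated_singularity_at_cong[OF k(2) refl] isolated_singularity_at_analytic[OF k(1)] by blast
    have "k \<midarrow>p\<rightarrow> k p" using k(1) by (simp add: analytic_at_imp_isCont isContD)
    then have "g \<midarrow>p\<rightarrow> k p" by (rule Lim_transform_eventually) (use k(2) in \<open>auto elim: eventually_mono\<close>)
    then show "\<exists>c. g \<midarrow>p\<rightarrow> c" ..
  qed
  then have "remove_sings g analytic_on {p}" if "p \<in> B" for p
    using that remove_sings_analytic_at by blast
  then show "remove_sings g holomorphic_on B"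
    using analytic_on_analytic_at analytic_imp_holomorphic by blast
  show "\<forall>\<^sub>\<approx>q\<in>B. remove_sings g q = g q"
    unfolding eventually_cosparse_open_eq[OF assms(1)] using iso(1) eventually_remove_sings_eq_at by blast
qed

text \<open>The maximum principle for functions whose values matter only off sparse sets:
  singularities of the expansions are removed, and by continuity the transformation rules then hold
  everywhere. It is applied to the Schwarzian quotient and, to produce a pole, to the Hauptmodul
  itself.\<close>

lemma modular_function_constant:
  assumes n: "n > 0" and R: "finite R" "R \<subseteq> SL2Z"
    and cover: "\<And>A. A \<in> SL2Z \<Longrightarrow> \<exists>B\<in>R. \<forall>\<^sub>\<approx>z\<in>\<H>. g (modular_act A z) = \<Phi> B (cusp_coord n z)"
    and occurs: "\<And>B. B \<in> R \<Longrightarrow> \<forall>\<^sub>\<approx>z\<in>\<H>. g (modular_act B z) = \<Phi> B (cusp_coord n z)"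
    and local: "\<And>B p. B \<in> R \<Longrightarrow> p \<in> ball 0 1 \<Longrightarrow> \<exists>k. k analytic_on {p} \<and> (\<forall>\<^sub>F q in at p. \<Phi> B q = k q)"
  obtains C where "\<And>B. B \<in> R \<Longrightarrow> \<forall>\<^sub>\<approx>q\<in>ball 0 1. \<Phi> B q = C"
proof -
  define \<Psi> where "\<Psi> = (\<lambda>B. remove_sings (\<Phi> B))"
  have \<Psi>: "\<Psi> B holomorphic_on ball 0 1" "\<forall>\<^sub>\<approx>q\<in>ball 0 1. \<Psi> B q = \<Phi> B q" if "B \<in> R" for B
    unfolding \<Psi>_def by (rule remove_sings_locally_analytic[OF open_ball local[OF that]]; assumption)+
  obtain B1 where B1: "B1 \<in> R" "\<forall>\<^sub>\<approx>z\<in>\<H>. g (modular_act (mat 1) z) = \<Phi> B1 (cusp_coord n z)"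
    using cover[OF mat_1_in_SL2Z] by blast
  define h where "h = (\<lambda>z. \<Psi> B1 (cusp_coord n z))"
  have im: "cusp_coord n ` \<H> \<subseteq> ball 0 1" using cusp_coord_less_1[OF n] by auto
  have comp: "(\<lambda>z. \<Psi> B (cusp_coord n z)) holomorphic_on \<H>" if "B \<in> R" for B
    using holomorphic_on_compose_gen[OF cusp_coord_holomorphic[of n \<H>] \<Psi>(1)[OF that] im]
    by (simp add: o_def)
  have hg: "\<forall>\<^sub>\<approx>z\<in>\<H>. h z = g z"
    using B1(2) cosparse_cusp_coord[OF \<Psi>(2)[OF B1(1)] n] by eventually_elim (simp add: h_def)
  have trans: "\<forall>z\<in>\<H>. h (modular_act A z) = \<Psi> B (cusp_coord n z)"
    if A: "A \<in> SL2Z" and B: "B \<in> R" "\<forall>\<^sub>\<approx>z\<in>\<H>. g (modular_act A z) = \<Phi> B (cusp_coord n z)" for A B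
  proof
    fix z assume z: "z \<in> \<H>"
    have "\<forall>\<^sub>\<approx>z\<in>\<H>. h (modular_act A z) = \<Psi> B (cusp_coord n z)"
      using B(2) cosparse_modular_act[OF hg A] cosparse_cusp_coord[OF \<Psi>(2)[OF B(1)] n]
      by eventually_elim simp
    moreover have "(\<lambda>z. h (modular_act A z)) holomorphic_on \<H>"
    proof -
      have "modular_act A ` \<H> \<subseteq> \<H>" using modular_act_in_upper_half_plane[OF A] by blast
      from holomorphic_on_compose_gen[OF modular_act_holomorphic[OF A] comp[OF B1(1)] this]
      show ?thesis by (simp add: o_def h_def)
    qed
    ultimately show "h (modular_act A z) = \<Psi> B (cusp_coord n z)"
      by (rule cosparse_eq_holomorphic[OF _ open_upper_half_plane _ comp[OF B(1)] z])
  qed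
  obtain C where C: "\<And>B q. B \<in> R \<Longrightarrow> q \<in> ball 0 1 \<Longrightarrow> q \<noteq> 0 \<Longrightarrow> \<Psi> B q = C"
  proof (rule modular_maximum_principle[OF n R(1), of \<Psi> h])
    show "\<exists>B\<in>R. \<forall>z\<in>\<H>. h (modular_act A z) = \<Psi> B (cusp_coord n z)" if "A \<in> SL2Z" for A
      using cover[OF that] trans[OF that] by blast
    show "\<exists>A\<in>SL2Z. \<forall>z\<in>\<H>. h (modular_act A z) = \<Psi> B (cusp_coord n z)" if "B \<in> R" for B
      using occurs[OF that] trans[OF _ that] that R(2) by blast
  qed (use \<Psi>(1) that in blast)+
  show ?thesis
  proof (rule that)
    fix B assume B: "B \<in> R"
    have "\<forall>\<^sub>\<approx>q\<in>ball 0 1. q \<noteq> (0 :: complex)"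
      using eventually_not_in_cosparse[of "{0 :: complex}"] by simp
    moreover have "\<forall>\<^sub>\<approx>q\<in>ball 0 1. q \<in> ball (0 :: complex) 1" by (rule eventually_in_cosparse) auto
    ultimately show "\<forall>\<^sub>\<approx>q\<in>ball 0 1. \<Phi> B q = C"
      using \<Psi>(2)[OF B] by eventually_elim (use C[OF B] in auto)
  qed
qed

text \<open>One representative is chosen for each matrix of residues that occurs;
  \<open>mult_sl2_inv_in_Gamma\<close> does the rest.\<close>

lemma Gamma_finite_cosets:
  assumes "n > 0"
  obtains R where "finite R" "R \<subseteq> SL2Z" "\<And>A. A \<in> SL2Z \<Longrightarrow> \<exists>B\<in>R. A ** sl2_inv B \<in> \<Gamma> n"
proof -
  define red where "red = (\<lambda>A :: int ^ 2 ^ 2. ((A $ 1 $ 1 mod int n, A $ 1 $ 2 mod int n), (A $ 2 $ 1 mod int n, A $ 2 $ 2 mod int n)))"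
  have "red ` SL2Z \<subseteq> ({0..<int n} \<times> {0..<int n}) \<times> ({0..<int n} \<times> {0..<int n})"
    using assms by (auto simp: red_def)
  then have "finite (red ` SL2Z)" by (rule finite_subset) auto
  define rep where "rep = (\<lambda>t. SOME B. B \<in> SL2Z \<and> red B = t)"
  have rep: "rep (red A) \<in> SL2Z" "red (rep (red A)) = red A" if "A \<in> SL2Z" for A
    unfolding rep_def by (rule someI2[of _ A]; use that in blast)+
  show ?thesis
  proof (rule that)
    show "finite (rep ` red ` SL2Z)" using \<open>finite (red ` SL2Z)\<close> by simp
    show "rep ` red ` SL2Z \<subseteq> SL2Z" using rep(1) by blast
    fix A assume A: "A \<in> SL2Z"
    have "[A $ i $ j = rep (red A) $ i $ j] (mod int n)" for i j :: 2
    proof -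
      have "(i = 1 \<or> i = 2) \<and> (j = 1 \<or> j = 2)" using exhaust_2 by blast
      then show ?thesis using rep(2)[OF A] by (auto simp: red_def cong_def)
    qed
    then have "A ** sl2_inv (rep (red A)) \<in> \<Gamma> n" by (rule mult_sl2_inv_in_Gamma[OF A rep(1)[OF A]])
    then show "\<exists>B\<in>rep ` red ` SL2Z. A ** sl2_inv B \<in> \<Gamma> n" using A by blast
  qed
qed

subsection \<open>The Schwarzian derivative\<close>

definition pre_Schwarz :: "(complex \<Rightarrow> complex) \<Rightarrow> complex \<Rightarrow> complex" where
  "pre_Schwarz f z = deriv (deriv f) z / deriv f z"

lemma Schwarz_deriv_pre_Schwarz: "Schwarz_deriv f z = 2 * deriv (pre_Schwarz f) z - (pre_Schwarz f z)\<^sup>2"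
  by (simp add: Schwarz_deriv_def pre_Schwarz_def[abs_def])

lemma eventually_deriv_cong:
  assumes "\<forall>\<^sub>F w in nhds z. f w = g w"
  shows "\<forall>\<^sub>F w in nhds z. deriv f w = deriv g w"
proof -
  have "\<forall>\<^sub>F w in nhds z. \<forall>\<^sub>F v in nhds w. f v = g v" using assms by (simp add: eventually_eventually)
  then show ?thesis by eventually_elim (rule deriv_cong_ev[OF _ refl])
qed

lemma eventually_pre_Schwarz_cong:
  assumes "\<forall>\<^sub>F w in nhds z. f w = g w"
  shows "\<forall>\<^sub>F w in nhds z. pre_Schwarz f w = pre_Schwarz g w"
  using eventually_deriv_cong[OF assms] eventually_deriv_cong[OF eventually_deriv_cong[OF assms]]
  by eventually_elim (simp add: pre_Schwarz_def)

lemma Schwarz_deriv_cong: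
  assumes "\<forall>\<^sub>F w in nhds z. f w = g w"
  shows "Schwarz_deriv f z = Schwarz_deriv g z"
  using eventually_nhds_x_imp_x[OF eventually_pre_Schwarz_cong[OF assms]]
    deriv_cong_ev[OF eventually_pre_Schwarz_cong[OF assms] refl]
  by (simp add: Schwarz_deriv_pre_Schwarz)

lemma pre_Schwarz_analytic:
  assumes "f analytic_on {z}" "deriv f z \<noteq> 0"
  shows "pre_Schwarz f analytic_on {z}"
  unfolding pre_Schwarz_def[abs_def] using assms by (intro analytic_intros analytic_deriv) auto

lemma Schwarz_deriv_analytic:
  assumes "f analytic_on {z}" "deriv f z \<noteq> 0"
  shows "Schwarz_deriv f analytic_on {z}"
  unfolding Schwarz_deriv_pre_Schwarz[abs_def]
  using pre_Schwarz_analytic[OF assms] by (intro analytic_intros analytic_deriv) auto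

lemma analytic_at_DERIV: "f analytic_on {z} \<Longrightarrow> (f has_field_derivative deriv f z) (at z)"
  by (simp add: analytic_on_imp_differentiable_at DERIV_deriv_iff_field_differentiable)

lemma eventually_analytic_at:
  assumes "f analytic_on {z}"
  shows "\<forall>\<^sub>F w in nhds z. f analytic_on {w}"
proof -
  obtain U where "open U" "z \<in> U" "f holomorphic_on U" using assms analytic_at by blast
  then show ?thesis unfolding eventually_nhds by (metis analytic_at)
qed

lemma eventually_analytic_nonzero:
  assumes "f analytic_on {z}" "f z \<noteq> 0"
  shows "\<forall>\<^sub>F w in nhds z. f w \<noteq> 0"
  using analytic_at_imp_isCont[OF assms(1)] assms(2)
  by (intro tendsto_imp_eventually_ne[of _ "f z"]) (auto simp: isCont_def tendsto_at_iff_tendsto_nhds)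

lemma DERIV_compose_analytic:
  assumes "\<phi> analytic_on {z}" "F analytic_on {\<phi> z}"
  shows "((\<lambda>w. F (\<phi> w)) has_field_derivative deriv F (\<phi> z) * deriv \<phi> z) (at z)"
  by (rule DERIV_chain2[OF analytic_at_DERIV[OF assms(2)] analytic_at_DERIV[OF assms(1)]])

text \<open>\<open>pre_Schwarz\<close> obeys an affine chain rule. In 2 P' - P^2 the mixed term of
  the square cancels against the term with the second derivative of \<phi>.\<close>

lemma Schwarz_deriv_compose:
  assumes \<phi>: "\<phi> analytic_on {z}" "deriv \<phi> z \<noteq> 0" and F: "F analytic_on {\<phi> z}" "deriv F (\<phi> z) \<noteq> 0"
  shows "Schwarz_deriv (\<lambda>w. F (\<phi> w)) z = Schwarz_deriv F (\<phi> z) * (deriv \<phi> z)\<^sup>2 + Schwarz_deriv \<phi> z"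
proof -
  note dF = analytic_deriv[OF F(1)] and d\<phi> = analytic_deriv[OF \<phi>(1)]
  have "filterlim \<phi> (nhds (\<phi> z)) (nhds z)"
    using analytic_at_imp_isCont[OF \<phi>(1)] by (simp add: isCont_def tendsto_at_iff_tendsto_nhds)
  then have F': "\<forall>\<^sub>F w in nhds z. F analytic_on {\<phi> w}" "\<forall>\<^sub>F w in nhds z. deriv F (\<phi> w) \<noteq> 0"
    using eventually_analytic_at[OF F(1)] eventually_analytic_nonzero[OF dF F(2)]
    by (auto simp: filterlim_iff)
  note \<phi>' = eventually_analytic_at[OF \<phi>(1)] eventually_analytic_nonzero[OF d\<phi> \<phi>(2)]
  have 1: "\<forall>\<^sub>F w in nhds z. deriv (\<lambda>w. F (\<phi> w)) w = deriv F (\<phi> w) * deriv \<phi> w"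
    using F'(1) \<phi>'(1) by eventually_elim (intro DERIV_imp_deriv DERIV_compose_analytic)
  have "\<forall>\<^sub>F w in nhds z. deriv (deriv (\<lambda>w. F (\<phi> w))) w =
      deriv (deriv F) (\<phi> w) * (deriv \<phi> w)\<^sup>2 + deriv F (\<phi> w) * deriv (deriv \<phi>) w"
    using eventually_deriv_cong[OF 1] F'(1) \<phi>'(1)
  proof eventually_elim
    case (elim w)
    have "((\<lambda>w. deriv F (\<phi> w) * deriv \<phi> w) has_field_derivative
        deriv (deriv F) (\<phi> w) * deriv \<phi> w * deriv \<phi> w + deriv (deriv \<phi>) w * deriv F (\<phi> w)) (at w)"
      by (intro DERIV_mult DERIV_compose_analytic analytic_at_DERIV analytic_deriv elim)
    then show ?case using elim(1) by (simp add: DERIV_imp_deriv power2_eq_square mult_ac)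
  qed
  then have "\<forall>\<^sub>F w in nhds z. pre_Schwarz (\<lambda>w. F (\<phi> w)) w = pre_Schwarz F (\<phi> w) * deriv \<phi> w + pre_Schwarz \<phi> w"
    using 1 F'(2) \<phi>'(2)
    by eventually_elim (simp add: pre_Schwarz_def field_simps power2_eq_square)
  note pre = this eventually_nhds_x_imp_x[OF this]
  have "((\<lambda>w. pre_Schwarz F (\<phi> w) * deriv \<phi> w + pre_Schwarz \<phi> w) has_field_derivative
      deriv (pre_Schwarz F) (\<phi> z) * deriv \<phi> z * deriv \<phi> z + deriv (deriv \<phi>) z * pre_Schwarz F (\<phi> z)
        + deriv (pre_Schwarz \<phi>) z) (at z)"
    by (intro DERIV_add DERIV_mult DERIV_compose_analytic analytic_at_DERIV analytic_deriv pre_Schwarz_analytic \<phi> F)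
  then have d: "deriv (pre_Schwarz (\<lambda>w. F (\<phi> w))) z =
      deriv (pre_Schwarz F) (\<phi> z) * deriv \<phi> z * deriv \<phi> z + deriv (deriv \<phi>) z * pre_Schwarz F (\<phi> z)
        + deriv (pre_Schwarz \<phi>) z"
    using deriv_cong_ev[OF pre(1) refl] by (simp add: DERIV_imp_deriv)
  have "deriv (deriv \<phi>) z = pre_Schwarz \<phi> z * deriv \<phi> z" using \<phi>(2) by (simp add: pre_Schwarz_def)
  then show ?thesis
    unfolding Schwarz_deriv_pre_Schwarz d pre(2) by (simp add: power2_eq_square algebra_simps)
qed

text \<open>Here P = \<open>pre_Schwarz\<close> equals - 2 c / (c w + d), a solution of 2 P' = P^2.
  Used for the modular action and for inversion at poles.\<close>

lemma Schwarz_deriv_moebius: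
  fixes a b c d :: complex
  assumes "c * z + d \<noteq> 0" "a * d - b * c \<noteq> 0"
  shows "(\<lambda>w. (a * w + b) / (c * w + d)) analytic_on {z}"
    and "deriv (\<lambda>w. (a * w + b) / (c * w + d)) z = (a * d - b * c) / (c * z + d)\<^sup>2"
    and "Schwarz_deriv (\<lambda>w. (a * w + b) / (c * w + d)) z = 0"
proof -
  let ?f = "\<lambda>w. (a * w + b) / (c * w + d)" and ?D = "a * d - b * c"
  show "?f analytic_on {z}" using assms(1) by (intro analytic_intros) auto
  have "(\<lambda>w. c * w + d) analytic_on {z}" by (intro analytic_intros)
  then have nz: "\<forall>\<^sub>F w in nhds z. c * w + d \<noteq> 0" using assms(1) by (rule eventually_analytic_nonzero)
  have 1: "\<forall>\<^sub>F w in nhds z. deriv ?f w = ?D / (c * w + d)\<^sup>2"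
    using nz
  proof eventually_elim
    case (elim w)
    have "(?f has_field_derivative (a * (c * w + d) - (a * w + b) * c) / ((c * w + d) * (c * w + d))) (at w)"
      by (intro DERIV_divide elim) (auto intro!: derivative_eq_intros)
    then have "deriv ?f w = (a * (c * w + d) - (a * w + b) * c) / ((c * w + d) * (c * w + d))" by (rule DERIV_imp_deriv)
    then show ?case by (simp add: power2_eq_square algebra_simps)
  qed
  then show "deriv ?f z = ?D / (c * z + d)\<^sup>2" by (rule eventually_nhds_x_imp_x)
  have "\<forall>\<^sub>F w in nhds z. deriv (deriv ?f) w = - 2 * c * ?D / (c * w + d) ^ 3"
    using eventually_deriv_cong[OF 1] nz
  proof eventually_elim
    case (elim w)
    have "((\<lambda>w. ?D / (c * w + d)\<^sup>2) has_field_derivative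
        (0 * (c * w + d)\<^sup>2 - ?D * (2 * (c * w + d) * c)) / ((c * w + d)\<^sup>2 * (c * w + d)\<^sup>2)) (at w)"
      using elim(2) by (auto intro!: derivative_eq_intros)
    then have "deriv (deriv ?f) w = (0 * (c * w + d)\<^sup>2 - ?D * (2 * (c * w + d) * c)) / ((c * w + d)\<^sup>2 * (c * w + d)\<^sup>2)"
      unfolding elim(1) by (rule DERIV_imp_deriv)
    also have "\<dots> = - 2 * c * ?D / (c * w + d) ^ 3"
      using elim(2) by (simp add: divide_simps) (simp add: eval_nat_numeral)
    finally show ?case .
  qed
  then have 2: "\<forall>\<^sub>F w in nhds z. pre_Schwarz ?f w = - 2 * c / (c * w + d)"
    using 1 nz
  proof eventually_elim
    case (elim w)
    then show ?case using assms(2) unfolding pre_Schwarz_def elim(1,2)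
      by (simp add: divide_simps) (simp add: eval_nat_numeral)
  qed
  have "((\<lambda>w. - 2 * c / (c * w + d)) has_field_derivative (0 * (c * z + d) - (- 2 * c) * c) / ((c * z + d) * (c * z + d))) (at z)"
    using assms(1) by (auto intro!: derivative_eq_intros)
  then have "deriv (pre_Schwarz ?f) z = 2 * c * c / ((c * z + d) * (c * z + d))"
    using deriv_cong_ev[OF 2 refl] by (simp add: DERIV_imp_deriv)
  then show "Schwarz_deriv ?f z = 0"
    using assms(1) eventually_nhds_x_imp_x[OF 2]
    by (simp add: Schwarz_deriv_pre_Schwarz power2_eq_square)
qed

text \<open>\<open>pre_Schwarz\<close> is the constant 2 pi i / n, so the Schwarzian is minus its
  square. This is where the constant of the theorem comes from.\<close>

lemma Schwarz_deriv_cusp_coord: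
  assumes "n > 0"
  shows "deriv (cusp_coord n) z = 2 * of_real pi * \<i> / of_nat n * cusp_coord n z"
    and "Schwarz_deriv (cusp_coord n) z = 4 * (of_real pi)\<^sup>2 / (of_nat n)\<^sup>2"
proof -
  let ?c = "2 * of_real pi * \<i> / of_nat n"
  have d: "deriv (cusp_coord n) = (\<lambda>z. ?c * cusp_coord n z)"
    by (rule ext) (rule DERIV_imp_deriv[OF cusp_coord_has_field_derivative])
  then show "deriv (cusp_coord n) z = ?c * cusp_coord n z" by simp
  have "deriv (\<lambda>z. ?c * cusp_coord n z) = (\<lambda>z. ?c * (?c * cusp_coord n z))"
    by (rule ext) (rule DERIV_imp_deriv[OF DERIV_cmult[OF cusp_coord_has_field_derivative]])
  then have "pre_Schwarz (cusp_coord n) = (\<lambda>_. ?c)"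
    unfolding pre_Schwarz_def[abs_def] d using assms by (intro ext) simp
  then show "Schwarz_deriv (cusp_coord n) z = 4 * (of_real pi)\<^sup>2 / (of_nat n)\<^sup>2"
    by (simp add: Schwarz_deriv_pre_Schwarz power_divide power_mult_distrib)
qed

text \<open>
  In terms of \<open>F\<close>, where \<open>f (A z) = F (cusp_coord n z)\<close>, this is the value at \<open>A z\<close> of the quotient
  \<open>({f, z} - 4 \<pi>\<^sup>2 / n\<^sup>2 * E\<^sub>4) / f'\<^sup>2\<close>. Since \<open>n \<ge> 2\<close> it has no pole at \<open>q = 0\<close>.
\<close>

definition Schwarz_quotient :: "nat \<Rightarrow> (complex \<Rightarrow> complex) \<Rightarrow> complex \<Rightarrow> complex" where
  "Schwarz_quotient n F q =
     (Schwarz_deriv F q + 240 * q ^ (n - 2) * sigma3_series (q ^ n)) / (deriv F q)\<^sup>2"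

text \<open>Apply the chain rule to both sides of \<open>f \<circ> A = F \<circ> q\<close>. With
  q'^2 = - \<kappa> q^2, numerator and denominator share the factor - \<kappa> j^4 q^2: the constant
  term \<kappa> cancels against that of \<kappa> E4, and q^n = q^2 q^(n - 2) supplies q^2 in the
  rest.\<close>

lemma Schwarz_quotient_modular_act:
  assumes n: "n \<ge> 2" and A: "A \<in> SL2Z" and z: "z \<in> \<H>"
    and eq: "\<forall>\<^sub>F w in nhds z. f (modular_act A w) = F (cusp_coord n w)"
    and f: "f analytic_on {modular_act A z}"
    and F: "F analytic_on {cusp_coord n z}" "deriv F (cusp_coord n z) \<noteq> 0"
  shows "deriv f (modular_act A z) \<noteq> 0"
    and "(Schwarz_deriv f (modular_act A z) - 4 * (of_real pi)\<^sup>2 / (of_nat n)\<^sup>2 * Eisenstein_E4 (modular_act A z)) /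
         (deriv f (modular_act A z))\<^sup>2 = Schwarz_quotient n F (cusp_coord n z)"
proof -
  define q j \<kappa> where "q = cusp_coord n z" and "j = aut_factor A z" and "\<kappa> = (4 * (of_real pi)\<^sup>2 / (of_nat n)\<^sup>2 :: complex)"
  have n0: "n > 0" using n by simp
  have j: "j \<noteq> 0" unfolding j_def by (rule aut_factor_nonzero[OF A z])
  have q: "q \<noteq> 0" by (simp add: q_def)
  have \<kappa>: "\<kappa> \<noteq> 0" using n0 by (simp add: \<kappa>_def)
  have an_A: "modular_act A analytic_on {z}"
    using modular_act_holomorphic[OF A] z open_upper_half_plane by (meson analytic_at)
  have dA: "deriv (modular_act A) z = 1 / j\<^sup>2"
    unfolding j_def by (rule DERIV_imp_deriv[OF modular_act_has_derivative[OF A z]])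
  have SA: "Schwarz_deriv (modular_act A) z = 0"
  proof -
    have "of_int (A $ 1 $ 1) * of_int (A $ 2 $ 2) - of_int (A $ 1 $ 2) * of_int (A $ 2 $ 1) \<noteq> (0 :: complex)"
      using A by (simp add: SL2Z_of_int_det)
    then show ?thesis
      using Schwarz_deriv_moebius(3)[of "of_int (A $ 2 $ 1)" z "of_int (A $ 2 $ 2)" "of_int (A $ 1 $ 1)" "of_int (A $ 1 $ 2)"]
        aut_factor_nonzero[OF A z] by (simp add: modular_act_eq[abs_def] aut_factor_def)
  qed
  have an_q: "cusp_coord n analytic_on {z}"
    using cusp_coord_holomorphic[of n UNIV] analytic_on_open[OF open_UNIV] analytic_on_subset by blast
  have dq: "deriv (cusp_coord n) z = 2 * of_real pi * \<i> / of_nat n * q" and Sq: "Schwarz_deriv (cusp_coord n) z = \<kappa>"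
    unfolding q_def \<kappa>_def by (rule Schwarz_deriv_cusp_coord[OF n0])+
  have dq2: "(deriv (cusp_coord n) z)\<^sup>2 = - \<kappa> * q\<^sup>2"
    unfolding dq \<kappa>_def by (simp add: power_mult_distrib power_divide)
  have dq0: "deriv (cusp_coord n) z \<noteq> 0" unfolding dq using n0 q by simp
  have d: "deriv f (modular_act A z) * (1 / j\<^sup>2) = deriv F q * deriv (cusp_coord n) z"
    using deriv_cong_ev[OF eq refl] DERIV_imp_deriv[OF DERIV_compose_analytic[OF an_A f]]
      DERIV_imp_deriv[OF DERIV_compose_analytic[OF an_q F(1)]] by (simp only: dA q_def)
  then have df: "deriv f (modular_act A z) = j\<^sup>2 * (deriv F q * deriv (cusp_coord n) z)"
    using j by (simp add: field_simps)
  then show nz: "deriv f (modular_act A z) \<noteq> 0" using j F(2) dq0 by (simp add: q_def)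
  have "Schwarz_deriv f (modular_act A z) * (1 / j\<^sup>2)\<^sup>2 + 0 = Schwarz_deriv F q * (- \<kappa> * q\<^sup>2) + \<kappa>"
    using Schwarz_deriv_cong[OF eq] Schwarz_deriv_compose[OF an_A _ f nz] Schwarz_deriv_compose[OF an_q dq0 F]
    using j by (simp add: dA SA Sq dq2 q_def)
  then have S: "Schwarz_deriv f (modular_act A z) = j ^ 4 * (\<kappa> - \<kappa> * q\<^sup>2 * Schwarz_deriv F q)"
    using j by (simp add: field_simps flip: power_mult)
  have nq: "nome z = q ^ n" by (simp only: q_def nome_eq_cusp_coord[OF n0])
  have "2 + (n - 2) = n" using n by simp
  then have "q ^ n = q\<^sup>2 * q ^ (n - 2)" by (simp only: power_add[symmetric])
  then have E: "Eisenstein_E4 (modular_act A z) = j ^ 4 * (1 + q\<^sup>2 * (240 * q ^ (n - 2) * sigma3_series (q ^ n)))"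
    unfolding Eisenstein_E4_modular[OF A z] Eisenstein_E4_sigma3_series[OF z] nq j_def by (simp only: mult_ac)
  have "(Schwarz_deriv f (modular_act A z) - \<kappa> * Eisenstein_E4 (modular_act A z)) / (deriv f (modular_act A z))\<^sup>2 =
      (- \<kappa> * j ^ 4 * q\<^sup>2) * (Schwarz_deriv F q + 240 * q ^ (n - 2) * sigma3_series (q ^ n)) /
      ((- \<kappa> * j ^ 4 * q\<^sup>2) * (deriv F q)\<^sup>2)"
    unfolding S E df power_mult_distrib dq2 by (simp add: algebra_simps flip: power_mult)
  also have "\<dots> = Schwarz_quotient n F q"
    unfolding Schwarz_quotient_def using j q \<kappa> by (subst mult_divide_mult_cancel_left) auto
  finally show "(Schwarz_deriv f (modular_act A z) - 4 * (of_real pi)\<^sup>2 / (of_nat n)\<^sup>2 * Eisenstein_E4 (modular_act A z)) /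
         (deriv f (modular_act A z))\<^sup>2 = Schwarz_quotient n F (cusp_coord n z)"
    unfolding \<kappa>_def q_def .
qed

text \<open>If \<open>F = 1 / h\<close>, then \<open>F\<close> and \<open>h\<close> have the same
  Schwarzian derivative and F' = - h' / h^2. The quotient of \<open>F\<close> is that of
  \<open>h\<close> times h^4, so its analytic extension \<open>k\<close> vanishes at the
  pole.\<close>

lemma Schwarz_quotient_local:
  assumes n: "n > 0" and p: "p \<in> ball 0 1" and h: "h analytic_on {p}" "deriv h p \<noteq> 0"
    and Fh: "(\<forall>\<^sub>F q in at p. F q = h q) \<or> h p = 0 \<and> (\<forall>\<^sub>F q in at p. F q = 1 / h q)"
  obtains k where "k analytic_on {p}" "\<forall>\<^sub>F q in at p. Schwarz_quotient n F q = k q"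
    "\<forall>\<^sub>F q in at p. F analytic_on {q} \<and> deriv F q \<noteq> 0" "(\<forall>\<^sub>F q in at p. F q = h q) \<or> k p = 0"
proof -
  have "cmod (p ^ n) < 1" using p n by (simp add: norm_power power_less_one_iff)
  then have "sigma3_series analytic_on {p ^ n}"
    using sigma3_series_holomorphic by (intro analytic_at[THEN iffD2]) (auto intro!: exI[of _ "ball 0 1"])
  then have "(sigma3_series \<circ> (\<lambda>q. q ^ n)) analytic_on {p}"
    by (intro analytic_on_compose) (auto intro!: analytic_intros)
  then have "(\<lambda>q. sigma3_series (q ^ n)) analytic_on {p}" by (simp add: o_def)
  then have k0: "Schwarz_quotient n h analytic_on {p}"
    unfolding Schwarz_quotient_def[abs_def] using Schwarz_deriv_analytic[OF h] h
    by (intro analytic_intros analytic_deriv) auto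
  have ev: "\<forall>\<^sub>F q in at p. h analytic_on {q}" "\<forall>\<^sub>F q in at p. deriv h q \<noteq> 0"
    using eventually_analytic_at[OF h(1)] eventually_analytic_nonzero[OF analytic_deriv[OF h(1)] h(2)]
    by (auto simp: eventually_at_filter elim: eventually_mono)
  from Fh show ?thesis
  proof (elim disjE conjE)
    assume *: "\<forall>\<^sub>F q in at p. F q = h q"
    then have near: "\<forall>\<^sub>F q in at p. \<forall>\<^sub>F r in nhds q. F r = h r" by (rule eventually_at_imp_eventually_at_nhds)
    have 1: "\<forall>\<^sub>F q in at p. Schwarz_quotient n F q = Schwarz_quotient n h q"
      using near by eventually_elim (simp add: Schwarz_quotient_def Schwarz_deriv_cong[of F h] deriv_cong_ev[of F h])
    have 2: "\<forall>\<^sub>F q in at p. F analytic_on {q} \<and> deriv F q \<noteq> 0"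
      using near ev
    proof eventually_elim
      case (elim q)
      then show ?case using analytic_at_cong[OF elim(1) refl] deriv_cong_ev[OF elim(1) refl] by simp
    qed
    show ?thesis using that[OF k0 1 2] * by blast
  next
    assume hp: "h p = 0" and *: "\<forall>\<^sub>F q in at p. F q = 1 / h q"
    have near: "\<forall>\<^sub>F q in at p. \<forall>\<^sub>F r in nhds q. F r = 1 / h r"
      using * by (rule eventually_at_imp_eventually_at_nhds)
    have "filterlim h (at (h p)) (at p)"
      using nonzero_derivative_filterlim_at[OF analytic_at_DERIV[OF h(1)] h(2)] .
    then have h0: "\<forall>\<^sub>F q in at p. h q \<noteq> 0" by (simp add: filterlim_at hp)
    have both: "\<forall>\<^sub>F q in at p. (F analytic_on {q} \<and> deriv F q \<noteq> 0) \<and>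
        Schwarz_quotient n F q = Schwarz_quotient n h q * h q ^ 4"
      using near h0 ev
    proof eventually_elim
      case (elim q)
      have inv: "(\<lambda>w. 1 / w) analytic_on {h q}" "deriv (\<lambda>w. 1 / w) (h q) = - 1 / (h q)\<^sup>2"
        "Schwarz_deriv (\<lambda>w. 1 / w) (h q) = 0"
        using Schwarz_deriv_moebius[of 1 "h q" 0 0 1] elim(2) by simp_all
      have d: "deriv F q = - 1 / (h q)\<^sup>2 * deriv h q"
        using deriv_cong_ev[OF elim(1) refl] DERIV_imp_deriv[OF DERIV_compose_analytic[OF elim(3) inv(1)]] inv(2)
        by simp
      have "Schwarz_deriv F q = Schwarz_deriv h q"
        using Schwarz_deriv_cong[OF elim(1)] Schwarz_deriv_compose[OF elim(3,4) inv(1)] inv(2,3) elim(2) by simp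
      then have "Schwarz_quotient n F q = Schwarz_quotient n h q * h q ^ 4"
        unfolding Schwarz_quotient_def d using elim(2) by (simp add: power_divide power_mult_distrib flip: power_mult)
      moreover have "(\<lambda>r. 1 / h r) analytic_on {q}" using elim(2,3) by (intro analytic_intros) auto
      then have "F analytic_on {q}" using analytic_at_cong[OF elim(1) refl] by simp
      ultimately show ?case using d elim(2,4) by simp
    qed
    have "(\<lambda>q. Schwarz_quotient n h q * h q ^ 4) analytic_on {p}" using k0 h(1) by (intro analytic_intros)
    then show ?thesis
      by (rule that) (use both hp in \<open>auto elim: eventually_mono\<close>)
  qed
qed

section \<open>Vanishing of the quotient and the two differential equations\<close>

lemma Hauptmodul_Schwarz_deriv:
  assumes n: "n \<ge> 2" and H: "Hauptmodul n f"
  shows "\<forall>\<^sub>\<approx>z\<in>\<H>. f analytic_on {z} \<and> deriv f z \<noteq> 0 \<and>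
           Schwarz_deriv f z = 4 * (of_real pi)\<^sup>2 / (of_nat n)\<^sup>2 * Eisenstein_E4 z"
proof -
  have n0: "n > 0" using n by simp
  have mero: "f meromorphic_on \<H>"
    and inv: "\<And>M. M \<in> \<Gamma> n \<Longrightarrow> \<forall>\<^sub>\<approx>z\<in>\<H>. f (modular_act M z) = f z"
    and cusps: "meromorphic_at_cusps n f"
    using H by (auto simp: Hauptmodul_def modular_function_def)
  have "\<forall>A\<in>SL2Z. \<exists>F. F meromorphic_on ball 0 1 \<and> (\<forall>\<^sub>\<approx>z\<in>\<H>. f (modular_act A z) = F (cusp_coord n z))"
    using cusps unfolding meromorphic_at_cusps_def cusp_coord_def .
  then obtain Fs where Fs: "\<And>A. A \<in> SL2Z \<Longrightarrow> Fs A meromorphic_on ball 0 1"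
    "\<And>A. A \<in> SL2Z \<Longrightarrow> \<forall>\<^sub>\<approx>z\<in>\<H>. f (modular_act A z) = Fs A (cusp_coord n z)"
    by metis
  obtain R where R: "finite R" "R \<subseteq> SL2Z" "\<And>A. A \<in> SL2Z \<Longrightarrow> \<exists>B\<in>R. A ** sl2_inv B \<in> \<Gamma> n"
    using Gamma_finite_cosets[OF n0] by metis
  \<comment> \<open>Write A = C B with C in \<open>\<Gamma> n\<close> and B a representative;
    invariance under C makes the expansion for B serve for A.\<close>
  have cover: "\<exists>B\<in>R. \<forall>\<^sub>\<approx>z\<in>\<H>. f (modular_act A z) = Fs B (cusp_coord n z)" if A: "A \<in> SL2Z" for A
  proof -
    obtain B where B: "B \<in> R" "A ** sl2_inv B \<in> \<Gamma> n" using R(3)[OF A] by blast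
    have SL: "B \<in> SL2Z" using B(1) R(2) by blast
    have AB: "A ** sl2_inv B ** B = A"
      by (simp add: matrix_mul_assoc[symmetric] sl2_inv_left[OF SL])
    from cosparse_upper_half_plane have "\<forall>\<^sub>\<approx>z\<in>\<H>. f (modular_act A z) = Fs B (cusp_coord n z)"
      using cosparse_modular_act[OF inv[OF B(2)] SL] Fs(2)[OF SL]
    proof eventually_elim
      case (elim z)
      have "modular_act (A ** sl2_inv B) (modular_act B z) = modular_act A z"
        using modular_act_mult[OF Gamma_subset_SL2Z[OF B(2)] SL elim(1)] AB by simp
      then show ?case using elim(2,3) by simp
    qed
    then show ?thesis using B(1) by blast
  qed
  \<comment> \<open>The last alternative keeps track of poles: either the expansion is regular at
    \<open>p\<close>, or the extended quotient vanishes there.\<close>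
  have local: "\<exists>k. k analytic_on {p} \<and> (\<forall>\<^sub>F q in at p. Schwarz_quotient n (Fs B) q = k q) \<and>
      (\<forall>\<^sub>F q in at p. Fs B analytic_on {q} \<and> deriv (Fs B) q \<noteq> 0) \<and>
      ((\<exists>h. h analytic_on {p} \<and> deriv h p \<noteq> 0 \<and> (\<forall>\<^sub>F q in at p. Fs B q = h q)) \<or> k p = 0)"
    if B: "B \<in> R" and p: "p \<in> ball 0 1" for B p
  proof -
    have SL: "B \<in> SL2Z" using B R(2) by blast
    obtain U S where U: "open U" "p \<in> U" "countable S" "inj_on (Fs B) (U - S)"
      using Hauptmodul_expansion_inj_off_countable[OF n H SL Fs(2)[OF SL] p] by metis
    have "Fs B meromorphic_on {p}" using Fs(1)[OF SL] p by (auto intro: meromorphic_on_subset)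
    from meromorphic_inj_local_form[OF this U] obtain h where h: "h analytic_on {p}" "deriv h p \<noteq> 0"
      "(\<forall>\<^sub>F q in at p. Fs B q = h q) \<or> h p = 0 \<and> (\<forall>\<^sub>F q in at p. Fs B q = 1 / h q)" by blast
    show ?thesis by (rule Schwarz_quotient_local[OF n0 p h]) (use h in blast)
  qed
  define g where "g = (\<lambda>z. (Schwarz_deriv f z - 4 * (of_real pi)\<^sup>2 / (of_nat n)\<^sup>2 * Eisenstein_E4 z) / (deriv f z)\<^sup>2)"
  have quot: "\<forall>\<^sub>\<approx>z\<in>\<H>. f analytic_on {modular_act A z} \<and> deriv f (modular_act A z) \<noteq> 0 \<and>
      g (modular_act A z) = Schwarz_quotient n (Fs B) (cusp_coord n z)"
    if A: "A \<in> SL2Z" and B: "B \<in> R" and eq: "\<forall>\<^sub>\<approx>z\<in>\<H>. f (modular_act A z) = Fs B (cusp_coord n z)" for A B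
  proof -
    have "\<forall>\<^sub>\<approx>q\<in>ball 0 1. Fs B analytic_on {q} \<and> deriv (Fs B) q \<noteq> 0"
      unfolding eventually_cosparse_open_eq[OF open_ball] using local[OF B] by blast
    note 1 = cosparse_cusp_coord[OF this n0]
    have "\<forall>\<^sub>\<approx>z\<in>\<H>. f analytic_on {z}"
      using meromorphic_on_imp_analytic_cosparse[OF mero] .
    note 2 = cosparse_modular_act[OF this A]
    from cosparse_upper_half_plane show ?thesis
      using 1 2 eventually_cosparse_nhds[OF eq open_upper_half_plane]
    proof eventually_elim
      case (elim z)
      then show ?case
        using Schwarz_quotient_modular_act[OF n A elim(1,4,3)] by (simp add: g_def)
    qed
  qed
  obtain C where C: "\<And>B. B \<in> R \<Longrightarrow> \<forall>\<^sub>\<approx>q\<in>ball 0 1. Schwarz_quotient n (Fs B) q = C"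
  proof (rule modular_function_constant[where g = g and \<Phi> = "\<lambda>B. Schwarz_quotient n (Fs B)", OF n0 R(1,2)])
    show "\<exists>B\<in>R. \<forall>\<^sub>\<approx>z\<in>\<H>. g (modular_act A z) = Schwarz_quotient n (Fs B) (cusp_coord n z)" if A: "A \<in> SL2Z" for A
    proof -
      obtain B where B: "B \<in> R" "\<forall>\<^sub>\<approx>z\<in>\<H>. f (modular_act A z) = Fs B (cusp_coord n z)" using cover[OF A] by blast
      show ?thesis using quot[OF A B] B(1) by (auto elim!: eventually_mono)
    qed
    show "\<forall>\<^sub>\<approx>z\<in>\<H>. g (modular_act B z) = Schwarz_quotient n (Fs B) (cusp_coord n z)" if B: "B \<in> R" for B
    proof -
      have "B \<in> SL2Z" using B R(2) by blast
      from quot[OF this B Fs(2)[OF this]] show ?thesis by (auto elim!: eventually_mono)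
    qed
    show "\<exists>k. k analytic_on {p} \<and> (\<forall>\<^sub>F q in at p. Schwarz_quotient n (Fs B) q = k q)"
      if "B \<in> R" "p \<in> ball 0 1" for B p
      using local[OF that] by blast
  qed (use that in blast)
  have "C = 0"
  proof (rule ccontr)
    assume "C \<noteq> 0"
    \<comment> \<open>A pole would force the constant \<open>C\<close> to be 0. Without poles the
      expansions satisfy the hypotheses of \<open>modular_function_constant\<close>, so they are
      constant, against the nonzero derivative of \<open>h\<close> at 0.\<close>
    have no_pole: "\<exists>h. h analytic_on {p} \<and> deriv h p \<noteq> 0 \<and> (\<forall>\<^sub>F q in at p. Fs B q = h q)"
      if B: "B \<in> R" and p: "p \<in> ball 0 1" for B p
    proof -
      from local[OF B p] obtain k where k: "k analytic_on {p}" "\<forall>\<^sub>F q in at p. Schwarz_quotient n (Fs B) q = k q"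
        "(\<exists>h. h analytic_on {p} \<and> deriv h p \<noteq> 0 \<and> (\<forall>\<^sub>F q in at p. Fs B q = h q)) \<or> k p = 0" by blast
      have "\<forall>\<^sub>F q in at p. Schwarz_quotient n (Fs B) q = C"
        using C[OF B] p by (simp add: eventually_cosparse_open_eq)
      with k(2) have "\<forall>\<^sub>F q in at p. k q = C" by eventually_elim simp
      then have "k \<midarrow>p\<rightarrow> C" by (rule tendsto_eventually)
      moreover have "k \<midarrow>p\<rightarrow> k p" using k(1) by (simp add: analytic_at_imp_isCont isContD)
      ultimately have "k p = C" by (metis LIM_unique)
      then show ?thesis using k(3) \<open>C \<noteq> 0\<close> by blast
    qed
    obtain c where c: "\<And>B. B \<in> R \<Longrightarrow> \<forall>\<^sub>\<approx>q\<in>ball 0 1. Fs B q = c"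
    proof (rule modular_function_constant[where g = f and \<Phi> = Fs, OF n0 R(1,2)])
      show "\<exists>B\<in>R. \<forall>\<^sub>\<approx>z\<in>\<H>. f (modular_act A z) = Fs B (cusp_coord n z)" if "A \<in> SL2Z" for A
        by (rule cover[OF that])
      show "\<forall>\<^sub>\<approx>z\<in>\<H>. f (modular_act B z) = Fs B (cusp_coord n z)" if "B \<in> R" for B
        using Fs(2) R(2) that by blast
      show "\<exists>k. k analytic_on {p} \<and> (\<forall>\<^sub>F q in at p. Fs B q = k q)" if "B \<in> R" "p \<in> ball 0 1" for B p
        using no_pole[OF that] by blast
    qed (use that in blast)+
    obtain B where B: "B \<in> R" using R(3)[OF mat_1_in_SL2Z] by blast
    obtain h where h: "h analytic_on {0}" "deriv h 0 \<noteq> 0" "\<forall>\<^sub>F q in at 0. Fs B q = h q"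
      using no_pole[OF B, of 0] by auto
    have "\<forall>\<^sub>F q in at 0. Fs B q = c" using c[OF B] by (simp add: eventually_cosparse_open_eq)
    with h(3) have hc: "\<forall>\<^sub>F q in at 0. h q = c" by eventually_elim simp
    have "filterlim h (at (h 0)) (at 0)"
      using nonzero_derivative_filterlim_at[OF analytic_at_DERIV[OF h(1)] h(2)] .
    then have "\<forall>\<^sub>F q in at 0. h q \<noteq> h 0" and lim: "h \<midarrow>0\<rightarrow> h 0" by (auto simp: filterlim_at)
    moreover have "h \<midarrow>0\<rightarrow> c" using hc by (rule tendsto_eventually)
    ultimately have "h 0 = c" by (metis LIM_unique)
    from eventually_conj[OF \<open>\<forall>\<^sub>F q in at 0. h q \<noteq> h 0\<close> hc] show False
      by (simp add: \<open>h 0 = c\<close>)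
  qed
  obtain B where B: "B \<in> R" "\<forall>\<^sub>\<approx>z\<in>\<H>. f (modular_act (mat 1) z) = Fs B (cusp_coord n z)"
    using cover[OF mat_1_in_SL2Z] by blast
  show ?thesis
    using quot[OF mat_1_in_SL2Z B] cosparse_cusp_coord[OF C[OF B(1)] n0]
    by eventually_elim (auto simp: g_def \<open>C = 0\<close>)
qed

theorem theorem4p1:
  fixes n :: nat and f :: "complex \<Rightarrow> complex"
  assumes "n \<in> {2, 3, 4, 5}"
    and "Hauptmodul n f"
  shows "(\<forall>\<^sub>\<approx>z\<in>\<H>. Schwarz_deriv f z = 4 * (of_real pi)\<^sup>2 / (of_nat n)\<^sup>2 * Eisenstein_E4 z) \<and>
    (let u = (\<lambda>z. - (of_nat n / (2 * of_real pi * \<i>)) * (deriv (deriv f) z / deriv f z))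
     in \<forall>\<^sub>\<approx>z\<in>\<H>. of_nat n / (\<i> * of_real pi) * deriv u z + (u z)\<^sup>2 = Eisenstein_E4 z)"
proof -
  have n: "n \<ge> 2" using assms(1) by auto
  note * = Hauptmodul_Schwarz_deriv[OF n assms(2)]
  define c where "c = - (of_nat n / (2 * of_real pi * \<i>))"
  have "\<forall>\<^sub>\<approx>z\<in>\<H>. of_nat n / (\<i> * of_real pi) * deriv (\<lambda>z. c * pre_Schwarz f z) z + (c * pre_Schwarz f z)\<^sup>2 =
      Eisenstein_E4 z"
    using *
  proof eventually_elim
    case (elim z)
    have "((\<lambda>z. c * pre_Schwarz f z) has_field_derivative c * deriv (pre_Schwarz f) z) (at z)"
      by (intro DERIV_cmult analytic_at_DERIV pre_Schwarz_analytic) (use elim in auto)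
    then have d: "deriv (\<lambda>z. c * pre_Schwarz f z) z = c * deriv (pre_Schwarz f) z" by (rule DERIV_imp_deriv)
    have c2: "c\<^sup>2 = - ((of_nat n)\<^sup>2 / (4 * (of_real pi)\<^sup>2))"
      by (simp add: c_def power_divide power_mult_distrib)
    have c1: "of_nat n / (\<i> * of_real pi) * c = - 2 * c\<^sup>2"
      by (simp add: c_def power2_eq_square field_simps)
    have "of_nat n / (\<i> * of_real pi) * deriv (\<lambda>z. c * pre_Schwarz f z) z + (c * pre_Schwarz f z)\<^sup>2 =
        (of_nat n / (\<i> * of_real pi) * c) * deriv (pre_Schwarz f) z + c\<^sup>2 * (pre_Schwarz f z)\<^sup>2"
      unfolding d by (simp add: power_mult_distrib)
    \<comment> \<open>The factor c is chosen so that n / (pi i) c = - 2 c^2; the left side of the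
      Riccati equation then is - c^2 (2 P' - P^2) for P = \<open>pre_Schwarz f\<close>, and - c^2 =
      n^2 / (4 pi^2).\<close>
    also have "\<dots> = - c\<^sup>2 * Schwarz_deriv f z"
      unfolding c1 Schwarz_deriv_pre_Schwarz by (simp add: algebra_simps)
    also have "\<dots> = Eisenstein_E4 z"
      using elim n unfolding c2 by simp
    finally show ?case .
  qed
  moreover have "\<forall>\<^sub>\<approx>z\<in>\<H>. Schwarz_deriv f z = 4 * (of_real pi)\<^sup>2 / (of_nat n)\<^sup>2 * Eisenstein_E4 z"
    using * by eventually_elim simp
  ultimately show ?thesis by (simp add: Let_def c_def pre_Schwarz_def)
qed

end
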